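(* Let $F\in\mathcal{S}^{\mathrm{poly}}$, assume that all zeros $\rho$ of $F$ with $\operatorname{Im}\rho>0$ are simple, and let $f(z,F)$, $a$, $b$, $L$ and $g(n)$ be as in the context. Then $f(z,F)$ is analytic on $\mathbb{H}=\{z:\operatorname{Im}z>0\}$ and for $z\in\mathbb{H}$ $$2\pi i f(z,F)=f_1(z,F)+f_2(z,F)-e^{bz}\sum_{n=1}^\infty\frac{g(n)}{n^b(z-\log n)},$$ where the last term on the right is a meromorphic function on the whole complex plane with poles at $z=\log n$, $n=1,2,\ldots$; the function $$f_1(z,F)=\int_{a+i\infty}^{a}\frac{\zeta(s-1)}{F(s)}e^{sz}\,ds$$ is analytic on $\mathbb{H}$, and $$f_2(z,F)=\int_L\frac{\zeta(s-1)}{F(s)}e^{sz}\,ds$$ is analytic on the whole complex plane.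
   Context: The Selberg class $\mathcal{S}$ consists of functions $F(s)=\sum_{n\ge1}a_F(n)n^{-s}$ ($s=\sigma+it$) such that: (i) the series converges absolutely for $\sigma>1$; (ii) for some integer $m\ge0$, $(s-1)^mF(s)$ is entire of finite order; (iii) $\Phi(s)=\omega\overline{\Phi(1-\bar s)}$ where $\Phi(s)=Q^s\prod_{j=1}^r\Gamma(\lambda_js+\mu_j)F(s)$ with $r\ge0$, $Q>0$, $\lambda_j>0$, $\operatorname{Re}\mu_j\ge0$, $|\omega|=1$; (iv) $a_F(n)\ll n^{\varepsilon}$ for every $\varepsilon>0$; (v) $F(s)=\prod_p\exp\big(\sum_{\ell\ge0}b_F(p^\ell)p^{-\ell s}\big)$ with $b_F(n)=0$ unless $n=p^m$, $m\ge1$, and $b_F(n)\ll n^{\vartheta}$ for some $\vartheta<1/2$. $\mathcal{S}^{\mathrm{poly}}$ is the set of $F\in\mathcal{S}$ having, for $\sigma>1$, a polynomial Euler product $F(s)=\prod_p\prod_{j=1}^d(1-\alpha_j(p)p^{-s})^{-1}$ with $|\alpha_j(p)|\le1$. $\zeta$ is the Riemann zeta function. For $\operatorname{Im}z>0$, $f(z,F)=\lim_{n\to\infty}\sum_{0<\operatorname{Im}\rho<T_n}e^{\rho z}\zeta(\rho-1)/F'(\rho)$, the sum over non-trivial zeros $\rho$ of $F$ (together with any trivial zeros of $F$ on the positive imaginary axis), where $(T_n)$ is chosen as follows: for large $T$ and $H=D\log\log T$ ($D$ a large constant), in each unit interval $[n,n+1]\subset[T-H,T+H]$ one picks $T_n$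 with $|F(\sigma+iT_n)|^{-1}=O(\exp(C(\log T)^2))$ uniformly for $\sigma\ge-2$. The real numbers $a,b$ satisfy $b>5/2$ and $\max\{-3/2,\tfrac12\max\{\operatorname{Re}\rho:\rho \text{ a zero of } F,\ \operatorname{Re}\rho<0\}\}<a<0$. Let $\alpha=\tfrac12\min\{\operatorname{Im}\rho:\operatorname{Im}\rho>0\}$ (over the zeros $\rho$ considered above), and $L$ is the path consisting of the segments $[a,\tfrac{a+b}{2}+i\alpha]$ and $[\tfrac{a+b}{2}+i\alpha,b]$. Define $\mu_F(n)$ by $1/F(s)=\sum_{n\ge1}\mu_F(n)n^{-s}=\prod_p\prod_{j=1}^d(1-\alpha_j(p)p^{-s})$ for $\sigma>1$, and $g(n)=\sum_{d\mid n}\mu_F(d)\,n/d$, so that $\zeta(s-1)/F(s)=\sum_{n}g(n)n^{-s}$ for $\sigma>2$. *)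

theory Defs
  imports "HOL-Complex_Analysis.Complex_Analysis" "HOL-Library.Landau_Symbols"
    "HOL-Computational_Algebra.Primes"
begin

text \<open>
  The Riemann zeta function, as the analytic continuation of its Dirichlet series to
  \<^term>\<open>- {1 :: complex}\<close> (unique there by the identity theorem).
  Its value at the pole \<open>1\<close> is unspecified.
\<close>

definition zeta :: "complex \<Rightarrow> complex" where
  "zeta = (SOME Z. Z holomorphic_on (- {1}) \<and>
     (\<forall>s. Re s > 1 \<longrightarrow> ((\<lambda>n. of_nat n powr (- s)) has_sum Z s) {1::nat..}))"


definition entire_finite_order :: "(complex \<Rightarrow> complex) \<Rightarrow> bool" where
  "entire_finite_order G \<longleftrightarrow> G holomorphic_on UNIV \<and>
     (\<exists>A::real. (\<lambda>s. norm (G s)) \<in> O[at_infinity](\<lambda>s. exp (norm s powr A)))"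

definition dirichlet_abs_conv :: "(complex \<Rightarrow> complex) \<Rightarrow> (nat \<Rightarrow> complex) \<Rightarrow> bool" where
  "dirichlet_abs_conv F a \<longleftrightarrow> (\<forall>s. Re s > 1 \<longrightarrow>
     (\<lambda>n. norm (a n * of_nat n powr (- s))) summable_on {1..} \<and>
     ((\<lambda>n. a n * of_nat n powr (- s)) has_sum F s) {1..})"

definition completed_fn ::
  "(complex \<Rightarrow> complex) \<Rightarrow> real \<Rightarrow> nat \<Rightarrow> (nat \<Rightarrow> real) \<Rightarrow> (nat \<Rightarrow> complex) \<Rightarrow> complex \<Rightarrow> complex" where
  "completed_fn F Q r lam mu s =
     of_real Q powr s * (\<Prod>j<r. Gamma (of_real (lam j) * s + mu j)) * F s"

text \<open>
  The functional equation is an identity of meromorphic functions. Since \<^const>\<open>Gamma\<close> is \<open>0\<close>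
  at its poles by convention, and \<open>F\<close> may have a pole at \<open>1\<close>, it is required only at those
  points at which neither side involves a pole of a Gamma factor or the value \<open>F 1\<close>.
\<close>

definition functional_eq ::
  "(complex \<Rightarrow> complex) \<Rightarrow> real \<Rightarrow> nat \<Rightarrow> (nat \<Rightarrow> real) \<Rightarrow> (nat \<Rightarrow> complex) \<Rightarrow> complex \<Rightarrow> bool" where
  "functional_eq F Q r lam mu \<omega> \<longleftrightarrow>
     Q > 0 \<and> (\<forall>j<r. lam j > 0 \<and> Re (mu j) \<ge> 0) \<and> norm \<omega> = 1 \<and>
     (\<forall>s. s \<noteq> 0 \<longrightarrow> s \<noteq> 1 \<longrightarrow>
        (\<forall>j<r. of_real (lam j) * s + mu j \<notin> \<int>\<^sub>\<le>\<^sub>0 \<and>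
               of_real (lam j) * (1 - cnj s) + mu j \<notin> \<int>\<^sub>\<le>\<^sub>0) \<longrightarrow>
        completed_fn F Q r lam mu s = \<omega> * cnj (completed_fn F Q r lam mu (1 - cnj s)))"

text \<open>
  Products over the primes are products over all natural numbers, in increasing order,
  with factor \<open>1\<close> at non-primes.
\<close>

definition log_euler_product :: "(complex \<Rightarrow> complex) \<Rightarrow> (nat \<Rightarrow> complex) \<Rightarrow> bool" where
  "log_euler_product F b \<longleftrightarrow>
     (\<forall>n. (\<nexists>p m. prime p \<and> m \<ge> 1 \<and> n = p ^ m) \<longrightarrow> b n = 0) \<and>
     (\<exists>\<theta><1/2. (\<lambda>n. norm (b n)) \<in> O(\<lambda>n. real n powr \<theta>)) \<and>
     (\<forall>s. Re s > 1 \<longrightarrow>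
        (\<lambda>p. if prime p then exp (\<Sum>l. b (p ^ l) * of_nat p powr (- (of_nat l * s))) else 1)
          has_prod F s)"

text \<open>
  The value of a member at \<open>1\<close> is not constrained.
\<close>

definition selberg_class :: "(complex \<Rightarrow> complex) set" where
  "selberg_class = {F.
     (\<exists>a. dirichlet_abs_conv F a \<and>
          (\<forall>\<epsilon>>0. (\<lambda>n. norm (a n)) \<in> O(\<lambda>n. real n powr \<epsilon>))) \<and>
     (\<exists>m G. entire_finite_order G \<and> (\<forall>s. s \<noteq> 1 \<longrightarrow> G s = (s - 1) ^ m * F s)) \<and>
     (\<exists>Q r lam mu \<omega>. functional_eq F Q r lam mu \<omega>) \<and>
     (\<exists>b. log_euler_product F b)}"

definition selberg_poly :: "(complex \<Rightarrow> complex) set" where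
  "selberg_poly = {F \<in> selberg_class. \<exists>d (\<alpha> :: nat \<Rightarrow> nat \<Rightarrow> complex).
     (\<forall>p j. prime p \<longrightarrow> j < d \<longrightarrow> norm (\<alpha> j p) \<le> 1) \<and>
     (\<forall>s. Re s > 1 \<longrightarrow>
        (\<lambda>p. if prime p then \<Prod>j<d. inverse (1 - \<alpha> j p * of_nat p powr (- s)) else 1)
          has_prod F s)}"


text \<open>
  Trivial zeros are the zeros at poles of the Gamma factors of the functional equation.
\<close>

definition trivial_zeros :: "(complex \<Rightarrow> complex) \<Rightarrow> complex set" where
  "trivial_zeros F = {\<rho>. F \<rho> = 0 \<and>
     (\<exists>Q r lam mu \<omega>. functional_eq F Q r lam mu \<omega> \<and>
        (\<exists>j<r. of_real (lam j) * \<rho> + mu j \<in> \<int>\<^sub>\<le>\<^sub>0))}"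

definition nontrivial_zeros :: "(complex \<Rightarrow> complex) \<Rightarrow> complex set" where
  "nontrivial_zeros F = {\<rho>. F \<rho> = 0} - trivial_zeros F"

definition upper_zeros :: "(complex \<Rightarrow> complex) \<Rightarrow> complex set" where
  "upper_zeros F = {\<rho> \<in> nontrivial_zeros F. Im \<rho> > 0} \<union>
     {\<rho> \<in> trivial_zeros F. Re \<rho> = 0 \<and> Im \<rho> > 0}"

text \<open>
  The non-vanishing is stated separately because \<open>inverse 0 = 0\<close>.
\<close>

definition admissible_heights :: "(complex \<Rightarrow> complex) \<Rightarrow> (nat \<Rightarrow> real) \<Rightarrow> bool" where
  "admissible_heights F T \<longleftrightarrow> (\<exists>D>0. \<exists>C K X0. \<forall>X\<ge>X0. \<forall>n.
     {real n..real n + 1} \<subseteq> {X - D * ln (ln X)..X + D * ln (ln X)} \<longrightarrow>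
       T n \<in> {real n..real n + 1} \<and>
       (\<forall>\<sigma>\<ge>-2. F (Complex \<sigma> (T n)) \<noteq> 0 \<and>
          inverse (norm (F (Complex \<sigma> (T n)))) \<le> K * exp (C * (ln X)\<^sup>2)))"

definition zero_sum :: "(complex \<Rightarrow> complex) \<Rightarrow> real \<Rightarrow> complex \<Rightarrow> complex" where
  "zero_sum F t z =
     (\<Sum>\<rho> | \<rho> \<in> upper_zeros F \<and> Im \<rho> < t. exp (\<rho> * z) * zeta (\<rho> - 1) / deriv F \<rho>)"

definition f_lim :: "(complex \<Rightarrow> complex) \<Rightarrow> (nat \<Rightarrow> real) \<Rightarrow> complex \<Rightarrow> complex" where
  "f_lim F T z = lim (\<lambda>n. zero_sum F (T n) z)"


definition zeta_kernel :: "(complex \<Rightarrow> complex) \<Rightarrow> complex \<Rightarrow> complex \<Rightarrow> complex" where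
  "zeta_kernel F z s = zeta (s - 1) / F s * exp (s * z)"

definition f1 :: "(complex \<Rightarrow> complex) \<Rightarrow> real \<Rightarrow> complex \<Rightarrow> complex" where
  "f1 F a z =
     Lim at_top (\<lambda>R. contour_integral (linepath (Complex a R) (of_real a)) (zeta_kernel F z))"

definition path_L :: "real \<Rightarrow> real \<Rightarrow> real \<Rightarrow> real \<Rightarrow> complex" where
  "path_L a b \<alpha> = linepath (of_real a) (Complex ((a + b) / 2) \<alpha>) +++
                  linepath (Complex ((a + b) / 2) \<alpha>) (of_real b)"

definition f2 :: "(complex \<Rightarrow> complex) \<Rightarrow> real \<Rightarrow> real \<Rightarrow> real \<Rightarrow> complex \<Rightarrow> complex" where
  "f2 F a b \<alpha> z = contour_integral (path_L a b \<alpha>) (zeta_kernel F z)"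

text \<open>
  The coefficients of \<open>1 / F\<close>, determined for \<open>n \<ge> 1\<close> by uniqueness of Dirichlet series.
\<close>

definition mu_coeff :: "(complex \<Rightarrow> complex) \<Rightarrow> nat \<Rightarrow> complex" where
  "mu_coeff F = (SOME m. dirichlet_abs_conv (\<lambda>s. 1 / F s) m)"

definition g_coeff :: "(complex \<Rightarrow> complex) \<Rightarrow> nat \<Rightarrow> complex" where
  "g_coeff F n = (\<Sum>d | d dvd n. mu_coeff F d * of_nat (n div d))"

definition log_term :: "(complex \<Rightarrow> complex) \<Rightarrow> real \<Rightarrow> complex \<Rightarrow> nat \<Rightarrow> complex" where
  "log_term F b z n = g_coeff F n / (of_real (real n powr b) * (z - of_real (ln (real n))))"

definition log_series :: "(complex \<Rightarrow> complex) \<Rightarrow> real \<Rightarrow> complex \<Rightarrow> complex" where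
  "log_series F b z = exp (of_real b * z) * (\<Sum>n. log_term F b z (Suc n))"

end

theory Submission
  imports Defs "HOL-Real_Asymp.Real_Asymp"
begin

text \<open>
  The theorem is the residue theorem for \<open>\<zeta>(s - 1) / F(s) e\<^sup>s\<^sup>z\<close> on the contour
  \<open>a + iT\<^sub>n \<rightarrow> a \<rightarrow> L \<rightarrow> b \<rightarrow> b + iT\<^sub>n \<rightarrow> a + iT\<^sub>n\<close>, with \<open>n \<rightarrow> \<infinity>\<close>. The polynomial growth of \<open>\<zeta>\<close> in vertical
  strips and the choice of \<open>T\<^sub>n\<close> kill the horizontal side, because \<open>\<bar>e\<^sup>s\<^sup>z\<bar>\<close> decays like
  \<open>exp (- T\<^sub>n Im z)\<close>. On the left side the functional equation moves \<open>1 / F(a + it)\<close> to the region of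
  absolute convergence at the cost of a quotient of Gamma values, which is polynomially bounded. On
  the right side the Dirichlet series of \<open>\<zeta>(s - 1) / F(s)\<close> is integrated term by term. The triangles
  between \<open>L\<close> and the line \<open>Im s = \<alpha>\<close> contain no zero of \<open>F\<close>, so \<open>L\<close> may be replaced by the bottom side
  of a rectangle.
\<close>

subsection \<open>Analytic continuation and growth of the zeta function\<close>

text \<open>The contour argument is short; most of the work goes into the facts it consumes.
  \<open>zeta\<close> and \<open>mu_coeff\<close> are defined by choice, so they say nothing until
  suitable objects have been built: a continuation of the Hurwitz zeta function, one unit at a time,
  whose recursion yields the growth bound along with the continuation, and a coefficient sequence
  obtained by multiplying out the Euler product. The Gamma quotient is bounded by comparing Gamma
  with itself: Euler's product controls a shift of a positive real part to the right, and the
  recurrence carries a negative real part to a positive one. Degrees of polynomial bounds are never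
  tracked, since the decay in the height is exponential. The condition on \<open>a\<close> makes the
  strip 2 a \<le> Re s < 0 free of zeros, so the line Re s = a runs inside it; b > 5/2 puts the
  right side where the Dirichlet series of zeta (s - 1) / F (s) converges absolutely. The path L
  leaves the real axis because of the pole of zeta (s - 1) at 2, the point 1, where the value of
  \<open>F\<close> is unconstrained, and possible real zeros of \<open>F\<close>.\<close>

lemma holomorphic_on_integral_param:
  fixes f :: "complex \<Rightarrow> real \<Rightarrow> complex"
  assumes U: "open U"
    and cont: "continuous_on (U \<times> {c..d}) (\<lambda>(s, t). f s t)"
    and hol: "\<And>t. t \<in> {c..d} \<Longrightarrow> (\<lambda>s. f s t) holomorphic_on U"
  shows "(\<lambda>s. integral {c..d} (f s)) holomorphic_on U"
proof (cases "c < d")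
  case False
  then have "integral {c..d} (f s) = 0" for s
    by (cases "c = d") auto
  then show ?thesis by simp
next
  case True
  \<comment> \<open>The interval becomes a complex path, so that Fubini's theorem for contour
    integrals can exchange it with a side of a triangle; \<open>Re\<close> recovers the real
    parameter.\<close>
  define h where "h = linepath (complex_of_real c) (complex_of_real d)"
  have h_img: "path_image h = of_real ` {c..d}"
    using True by (simp add: h_def closed_segment_of_real closed_segment_eq_real_ivl)
  have conv: "integral {c..d} g = contour_integral h (\<lambda>v. g (Re v))" for g :: "real \<Rightarrow> complex"
    using True unfolding h_def by (subst contour_integral_linepath_Reals_eq) auto
  have cont_seg: "continuous_on (S \<times> path_image h) (\<lambda>(s, v). f s (Re v))" if "S \<subseteq> U" for S
  proof -
    have "continuous_on (S \<times> path_image h) ((\<lambda>(s, t). f s t) \<circ> (\<lambda>(s, v). (s, Re v)))"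
      using that h_img
      by (intro continuous_on_compose continuous_on_subset[OF cont])
         (auto simp: split_beta intro!: continuous_intros)
    then show ?thesis by (simp add: o_def split_beta)
  qed
  have swap: "contour_integral (linepath p q) (\<lambda>s. integral {c..d} (f s)) =
      contour_integral h (\<lambda>v. contour_integral (linepath p q) (\<lambda>s. f s (Re v)))"
    and cint: "(\<lambda>v. contour_integral (linepath p q) (\<lambda>s. f s (Re v))) contour_integrable_on h"
    if "closed_segment p q \<subseteq> U" for p q
  proof -
    show "contour_integral (linepath p q) (\<lambda>s. integral {c..d} (f s)) =
      contour_integral h (\<lambda>v. contour_integral (linepath p q) (\<lambda>s. f s (Re v)))"
      unfolding conv using cont_seg[OF that]
      by (intro contour_integral_swap) (auto simp: h_def vector_derivative_linepath_at)
    have *: "continuous_on (path_image h \<times> cbox 0 1)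
        ((\<lambda>(s, v). f s (Re v)) \<circ> (\<lambda>(v, t). (linepath p q t, v)))"
      using that linepath_in_path[of _ p q]
      by (intro continuous_on_compose continuous_on_subset[OF cont_seg[OF that]])
         (auto simp: split_beta linepath_def intro!: continuous_intros)
    have "continuous_on (path_image h)
        (\<lambda>v. integral (cbox 0 1) (\<lambda>t. f (linepath p q t) (Re v) * (q - p)))"
      by (intro integral_continuous_on_param) 
         (use * in \<open>auto simp: split_beta o_def intro!: continuous_intros\<close>)
    then show "(\<lambda>v. contour_integral (linepath p q) (\<lambda>s. f s (Re v))) contour_integrable_on h"
      unfolding h_def by (intro contour_integrable_continuous_linepath)
        (simp add: contour_integral_integral vector_derivative_linepath_at)
  qed
  have "(\<lambda>s. integral {c..d} (f s)) analytic_on U"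
  proof (intro Morera_triangle impI)
    show "continuous_on U (\<lambda>s. integral {c..d} (f s))"
      using integral_continuous_on_param[of U c d f] cont by simp
  next
    fix p q r assume tri: "convex hull {p, q, r} \<subseteq> U"
    have seg: "closed_segment p q \<subseteq> U" "closed_segment q r \<subseteq> U" "closed_segment r p \<subseteq> U"
      by (intro order_trans[OF _ tri] segments_subset_convex_hull)+
    let ?I = "\<lambda>p q v. contour_integral (linepath p q) (\<lambda>s. f s (Re v))"
    \<comment> \<open>For a fixed parameter Cauchy's theorem kills the triangle integral. After the
      exchange this is the inner integral, so Morera's theorem applies.\<close>
    have zero: "?I p q v + ?I q r v + ?I r p v = 0" if "v \<in> path_image h" for v
    proof -
      have "(\<lambda>s. f s (Re v)) holomorphic_on convex hull {p, q, r}"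
        using that h_img tri by (intro holomorphic_on_subset[OF hol]) auto
      from Cauchy_theorem_triangle[OF this] holomorphic_on_imp_continuous_on[OF this]
      show ?thesis
        using segments_subset_convex_hull[of p q r]
        by (metis (no_types, lifting) contour_integral_unique has_chain_integral_chain_integral3)
    qed
    show "contour_integral (linepath p q) (\<lambda>s. integral {c..d} (f s)) +
        contour_integral (linepath q r) (\<lambda>s. integral {c..d} (f s)) +
        contour_integral (linepath r p) (\<lambda>s. integral {c..d} (f s)) = 0"
      unfolding swap[OF seg(1)] swap[OF seg(2)] swap[OF seg(3)]
      using zero cint[OF seg(1)] cint[OF seg(2)] cint[OF seg(3)]
      by (simp flip: contour_integral_add add: contour_integrable_add cong: contour_integral_cong)
  qed (rule U)
  then show ?thesis by (rule analytic_imp_holomorphic)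
qed

section \<open>The Hurwitz zeta function: series, continuation and growth\<close>

definition hurwitz_sum :: "complex \<Rightarrow> real \<Rightarrow> complex" where
  "hurwitz_sum s x = (\<Sum>n. of_real (real n + x) powr (- s))"

text \<open>
  \<open>hurwitz_cont k s x\<close> is \<open>(s - 1) \<zeta>(s, x)\<close> for \<open>Re s > 1 - k\<close>. Integrating
  \<open>\<partial>\<zeta>(s, x) / \<partial>x = - s \<zeta>(s + 1, x)\<close> and \<open>\<integral>\<^sub>x\<^sup>x\<^sup>+\<^sup>1 \<zeta>(s, u) du = x\<^sup>1\<^sup>-\<^sup>s / (s - 1)\<close> yields
  \<open>\<zeta>(s, x) = x\<^sup>1\<^sup>-\<^sup>s / (s - 1) + s \<integral>\<^sub>0\<^sup>1 (1 - v) \<zeta>(s + 1, x + v) dv\<close>, which continues \<open>\<zeta>(s, x)\<close> one unit to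
  the left; the factor \<open>s - 1\<close> removes the pole.
\<close>

primrec hurwitz_cont :: "nat \<Rightarrow> complex \<Rightarrow> real \<Rightarrow> complex" where
  "hurwitz_cont 0 s x = (s - 1) * hurwitz_sum s x"
| "hurwitz_cont (Suc k) s x = of_real x powr (1 - s) +
     (s - 1) * integral {0..1} (\<lambda>v. of_real (1 - v) * hurwitz_cont k (s + 1) (x + v))"

lemma summable_Suc_powr:
  fixes e :: real assumes "e > 1" shows "summable (\<lambda>n. real (Suc n) powr - e)"
  using assms summable_real_powr_iff[of "-e"] by (subst summable_Suc_iff) auto

text \<open>The majorant depends on neither \<open>s\<close> nor \<open>x\<close>: for x \<ge> 1 the
  base \<open>real n + x\<close> is at least \<open>Suc n\<close>. The M-test then gives convergence
  uniform in both variables at once, as is needed when \<open>x\<close> is integrated over while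
  \<open>s\<close> varies.\<close>

lemma hurwitz_term_bound:
  assumes "Re s \<ge> e" "e \<ge> 0" "x \<ge> 1"
  shows "norm (complex_of_real (real n + x) powr (- s)) \<le> real (Suc n) powr - e"
proof -
  have "norm (complex_of_real (real n + x) powr (- s)) = (real n + x) powr (- Re s)"
    using assms by (subst norm_powr_real_powr) auto
  also have "\<dots> \<le> (real n + x) powr (- e)"
    using assms by (intro powr_mono) auto
  also have "\<dots> \<le> real (Suc n) powr - e"
    using assms by (intro powr_mono2') auto
  finally show ?thesis .
qed

lemma hurwitz_uniform:
  assumes "e > 1"
  shows "uniform_limit {p. Re (fst p) \<ge> e \<and> snd p \<ge> 1}
     (\<lambda>N p. \<Sum>n<N. complex_of_real (real n + snd p) powr (- fst p))
     (\<lambda>p. hurwitz_sum (fst p) (snd p)) sequentially"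
  unfolding hurwitz_sum_def
  using assms by (intro Weierstrass_m_test[OF _ summable_Suc_powr[OF assms]] hurwitz_term_bound) auto

lemma hurwitz_sums:
  assumes "Re s > 1" "x \<ge> 1"
  shows "(\<lambda>n. complex_of_real (real n + x) powr (- s)) sums hurwitz_sum s x"
  using tendsto_uniform_limitI[OF hurwitz_uniform[of "Re s"], of "(s, x)"] assms
  by (simp add: sums_def)

lemma continuous_on_hurwitz_sum:
  "continuous_on {p. Re (fst p) > 1 \<and> snd p \<ge> 1} (\<lambda>p. hurwitz_sum (fst p) (snd p))"
  (is "continuous_on ?U ?f")
  unfolding continuous_on_eq_continuous_within
proof
  fix p :: "complex \<times> real" assume p: "p \<in> ?U"
  \<comment> \<open>Halfway between 1 and the given real part: the closed half-plane Re \<ge> e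
    still contains a neighbourhood of the point, and convergence is uniform on it.\<close>
  define e where "e = (1 + Re (fst p)) / 2"
  have e: "e > 1" "e < Re (fst p)" using p by (auto simp: e_def)
  let ?V = "{q :: complex \<times> real. Re (fst q) > e}"
  let ?W = "{p :: complex \<times> real. Re (fst p) \<ge> e \<and> snd p \<ge> 1}"
  have "continuous_on ?W ?f"
    by (rule uniform_limit_theorem[OF _ hurwitz_uniform[OF e(1)]])
       (auto simp del: of_real_add intro!: always_eventually continuous_intros)
  then have "continuous (at p within ?W) ?f"
    by (rule continuous_on_eq_continuous_within[THEN iffD1, THEN bspec]) (use p e in auto)
  moreover have "at p within ?W = at p within ?U"
    using e p by (intro at_within_nhd[of _ ?V])
       (auto intro!: open_Collect_less continuous_intros)
  ultimately show "continuous (at p within ?U) ?f" by simp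
qed

lemma holomorphic_on_hurwitz_sum:
  assumes "x \<ge> 1"
  shows "(\<lambda>s. hurwitz_sum s x) holomorphic_on {s. Re s > 1}"
proof (rule holomorphic_uniform_sequence)
  show "open {s. Re s > 1}" by (rule open_halfspace_Re_gt)
  show "(\<lambda>s. \<Sum>n<N. complex_of_real (real n + x) powr (- s)) holomorphic_on {s. Re s > 1}" for N
    by (intro holomorphic_intros)
  fix z assume "z \<in> {s. Re s > 1}"
  then have z: "Re z > 1" by simp
  define d where "d = (Re z - 1) / 2"
  have d: "d > 0" "Re z - d > 1" using z by (auto simp: d_def field_simps)
  have sub: "Re w \<ge> Re z - d" if "w \<in> cball z d" for w
    using that abs_Re_le_cmod[of "z - w"] by (auto simp: dist_norm)
  have "uniform_limit (cball z d) (\<lambda>N s. \<Sum>n<N. complex_of_real (real n + x) powr (- s))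
      (\<lambda>s. hurwitz_sum s x) sequentially"
    unfolding hurwitz_sum_def
    using assms sub d
    by (intro Weierstrass_m_test[OF _ summable_Suc_powr[OF d(2)]] hurwitz_term_bound) auto
  moreover have "cball z d \<subseteq> {s. Re s > 1}" using sub d by force
  ultimately show "\<exists>d>0. cball z d \<subseteq> {s. Re s > 1} \<and> uniform_limit (cball z d)
      (\<lambda>N s. \<Sum>n<N. complex_of_real (real n + x) powr (- s)) (\<lambda>s. hurwitz_sum s x) sequentially"
    using d(1) by blast
qed

text \<open>Joint continuity is what the parameter integral of the next level asks for, both for
  integrability in \<open>v\<close> and for holomorphy in \<open>s\<close>.\<close>

lemma continuous_on_hurwitz_cont:
  "continuous_on {p. Re (fst p) > 1 - real k \<and> snd p \<ge> 1} (\<lambda>p. hurwitz_cont k (fst p) (snd p))"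
proof (induction k)
  case 0
  then show ?case using continuous_on_hurwitz_sum by (auto intro!: continuous_intros)
next
  case (Suc k)
  let ?U = "{p. Re (fst p) > 1 - real (Suc k) \<and> snd p \<ge> 1}"
  have *: "continuous_on (?U \<times> cbox 0 1)
      (\<lambda>q. hurwitz_cont k (fst (fst q) + 1) (snd (fst q) + snd q))"
    using continuous_on_compose2[OF Suc,
      where f = "\<lambda>q. (fst (fst q) + 1, snd (fst q) + snd q)" and s = "?U \<times> cbox 0 1"]
    by (force intro!: continuous_intros)
  have "continuous_on ?U (\<lambda>p. integral (cbox 0 1)
      (\<lambda>v. of_real (1 - v) * hurwitz_cont k (fst p + 1) (snd p + v)))"
    by (intro integral_continuous_on_param)
       (use * in \<open>auto simp: split_beta intro!: continuous_intros\<close>)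
  then show ?case by (auto intro!: continuous_intros)
qed

lemma holomorphic_on_hurwitz_cont:
  assumes "x \<ge> 1"
  shows "(\<lambda>s. hurwitz_cont k s x) holomorphic_on {s. Re s > 1 - real k}"
  using assms
proof (induction k arbitrary: x)
  case 0
  then show ?case using holomorphic_on_hurwitz_sum by (auto intro!: holomorphic_intros)
next
  case (Suc k)
  let ?U = "{s. Re s > 1 - real (Suc k)}"
  have "(\<lambda>s. integral {0..1} (\<lambda>v. of_real (1 - v) * hurwitz_cont k (s + 1) (x + v))) holomorphic_on ?U"
  proof (rule holomorphic_on_integral_param)
    have "continuous_on (?U \<times> {0..1}) (\<lambda>q. hurwitz_cont k (fst q + 1) (x + snd q))"
      using continuous_on_compose2[OF continuous_on_hurwitz_cont[of k],
        where f = "\<lambda>q. (fst q + 1, x + snd q)" and s = "?U \<times> {0..1}"] Suc.prems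
      by (force intro!: continuous_intros)
    then show "continuous_on (?U \<times> {0..1})
        (\<lambda>(s, v). of_real (1 - v) * hurwitz_cont k (s + 1) (x + v))"
      by (auto simp: split_beta intro!: continuous_intros)
    fix v :: real assume v: "v \<in> {0..1}"
    have "(\<lambda>s. hurwitz_cont k s (x + v)) \<circ> (\<lambda>s. s + 1) holomorphic_on ?U"
      using Suc.IH[of "x + v"] v Suc.prems
      by (intro holomorphic_on_compose_gen[where t = "{s. Re s > 1 - real k}"])
         (auto intro!: holomorphic_intros)
    then show "(\<lambda>s. of_real (1 - v) * hurwitz_cont k (s + 1) (x + v)) holomorphic_on ?U"
      by (auto simp: o_def intro!: holomorphic_intros)
  qed (rule open_halfspace_Re_gt)
  then show ?case using Suc.prems by (auto intro!: holomorphic_intros)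
qed

text \<open>Integration by parts for a single term of the series. For y = x, x + 1, ... the two
  powers with exponent 1 - s telescope.\<close>

lemma hurwitz_term_has_integral:
  fixes y :: real and s :: complex
  assumes "y > 0"
  shows "((\<lambda>v. (s - 1) * (of_real (1 - v) * (s * of_real (y + v) powr (- (s + 1))))) has_integral
    (s - 1) * of_real y powr (- s) - of_real y powr (1 - s) + of_real (y + 1) powr (1 - s)) {0..1}"
proof -
  \<comment> \<open>A primitive: differentiating 1 - w in the first summand gives (s - 1) (y +
    w)^(-s), which cancels the derivative of the second summand.\<close>
  define G where "G = (\<lambda>w::complex. - (s - 1) * ((1 - w) * (of_real y + w) powr (- s)) +
    (of_real y + w) powr (1 - s))"
  have "((\<lambda>v. (s - 1) * (of_real (1 - v) * (s * of_real (y + v) powr (- (s + 1))))) has_integral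
      G (of_real 1) - G (of_real 0)) {0..1}"
  proof (rule fundamental_theorem_of_calculus)
    fix v :: real assume v: "v \<in> {0..1}"
    have exponent: "- 1 - s = - s - 1" by simp
    have nz: "complex_of_real (y + v) \<notin> \<real>\<^sub>\<le>\<^sub>0"
      using assms v by (simp only: complex_nonpos_Reals_iff) auto
    have "(G has_field_derivative (s - 1) * (of_real (1 - v) * (s * of_real (y + v) powr (- (s + 1)))))
        (at (of_real v))"
      unfolding G_def using nz
      by (auto intro!: derivative_eq_intros simp: algebra_simps exponent)
    then show "((\<lambda>v. G (of_real v)) has_vector_derivative
        (s - 1) * (of_real (1 - v) * (s * of_real (y + v) powr (- (s + 1))))) (at v within {0..1})"
      by (rule has_vector_derivative_at_within[OF has_vector_derivative_real_field])
  qed simp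
  then show ?thesis by (simp add: G_def algebra_simps)
qed

text \<open>Summing the term identity over n < N leaves boundary terms at x and at N + x, and the
  latter vanishes in the limit because Re s > 1. The factor \<open>s\<close> in the integrand is (s
  + 1) - 1, which \<open>hurwitz_cont 0\<close> carries at s + 1.\<close>

lemma hurwitz_cont_Suc_0:
  assumes s: "Re s > 1" and x: "x \<ge> 1"
  shows "hurwitz_cont (Suc 0) s x = hurwitz_cont 0 s x"
proof -
  define h where "h = (\<lambda>n v. (s - 1) * (of_real (1 - v) *
      (s * of_real (real n + x + v) powr (- (s + 1)))))"
  define I where "I = (\<lambda>N. (s - 1) * (\<Sum>n<N. of_real (real n + x) powr (- s))
      - of_real x powr (1 - s) + of_real (real N + x) powr (1 - s))"
  have I: "((\<lambda>v. \<Sum>n<N. h n v) has_integral I N) {0..1}" for N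
  proof (induction N)
    case 0
    then show ?case by (simp add: I_def)
  next
    case (Suc N)
    have "(h N has_integral (s - 1) * of_real (real N + x) powr (- s)
        - of_real (real N + x) powr (1 - s) + of_real (real N + x + 1) powr (1 - s)) {0..1}"
      unfolding h_def using x by (intro hurwitz_term_has_integral) auto
    from has_integral_add[OF Suc this] show ?case
      by (simp add: I_def algebra_simps)
  qed
  have bound: "norm (h n v) \<le> norm (s - 1) * norm s * real (Suc n) powr - (Re s + 1)"
    if "v \<in> {0..1}" for n v
  proof -
    have "norm (complex_of_real (real n + (x + v)) powr (- (s + 1))) \<le> real (Suc n) powr - (Re s + 1)"
      using that s x by (intro hurwitz_term_bound) auto
    moreover have "norm (complex_of_real (1 - v)) \<le> 1"
      using that by (simp only: norm_of_real) auto
    ultimately have "norm (s - 1) * (norm (complex_of_real (1 - v)) *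
        (norm s * norm (complex_of_real (real n + (x + v)) powr (- (s + 1)))))
      \<le> norm (s - 1) * (1 * (norm s * real (Suc n) powr - (Re s + 1)))"
      by (intro mult_mono) auto
    then show ?thesis by (simp add: h_def norm_mult add.assoc mult.assoc)
  qed
  have lim: "uniform_limit {0..1} (\<lambda>N v. \<Sum>n<N. h n v) (\<lambda>v. \<Sum>n. h n v) sequentially"
    using s by (intro Weierstrass_m_test[OF bound] summable_mult summable_Suc_powr) auto
  have sum_h: "(\<Sum>n. h n v) = (s - 1) * (of_real (1 - v) * (s * hurwitz_sum (s + 1) (x + v)))"
    if "v \<in> {0..1}" for v
  proof -
    have "(\<lambda>n. complex_of_real (real n + (x + v)) powr (- (s + 1))) sums hurwitz_sum (s + 1) (x + v)"
      using that s x by (intro hurwitz_sums) auto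
    then have "(\<lambda>n. h n v) sums ((s - 1) * (of_real (1 - v) * (s * hurwitz_sum (s + 1) (x + v))))"
      unfolding h_def add.assoc by (intro sums_mult)
    then show ?thesis by (simp add: sums_iff)
  qed
  have cont: "continuous_on {0..1} (\<lambda>v. \<Sum>n<N. h n v)" for N
    unfolding h_def using x by (intro continuous_intros) (auto simp del: of_real_add)
  obtain I' J where IJ: "\<And>N. ((\<lambda>v. \<Sum>n<N. h n v) has_integral I' N) {0..1}"
     "((\<lambda>v. \<Sum>n. h n v) has_integral J) {0..1}" "I' \<longlonglongrightarrow> J"
    using uniform_limit_integral[OF lim cont] by auto
  have "I' = I" using IJ(1) I has_integral_unique by blast
  moreover have "I \<longlonglongrightarrow> (s - 1) * hurwitz_sum s x - of_real x powr (1 - s) + 0"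
    unfolding I_def
  proof (intro tendsto_intros)
    show "(\<lambda>N. \<Sum>n<N. complex_of_real (real n + x) powr - s) \<longlonglongrightarrow> hurwitz_sum s x"
      using hurwitz_sums[OF s x] by (simp add: sums_def)
    have "filterlim (\<lambda>N. real N + x) at_top sequentially"
      using filterlim_tendsto_add_at_top[OF tendsto_const filterlim_real_sequentially, of x]
      by (simp add: add.commute)
    then have "(\<lambda>N. (real N + x) powr (1 - Re s)) \<longlonglongrightarrow> 0"
      using s by (intro tendsto_neg_powr) auto
    moreover have "norm (complex_of_real (real N + x) powr (1 - s)) = (real N + x) powr (1 - Re s)" for N
      using x by (subst norm_powr_real_powr) auto
    ultimately have "(\<lambda>N. norm (complex_of_real (real N + x) powr (1 - s))) \<longlonglongrightarrow> 0"
      by (simp only:)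
    then show "(\<lambda>N. complex_of_real (real N + x) powr (1 - s)) \<longlonglongrightarrow> 0"
      by (rule tendsto_norm_zero_cancel)
  qed
  ultimately have "J = (s - 1) * hurwitz_sum s x - of_real x powr (1 - s) + 0"
    using IJ(3) LIMSEQ_unique by blast
  then have J: "J = (s - 1) * hurwitz_sum s x - of_real x powr (1 - s)" by simp
  have "J = integral {0..1} (\<lambda>v. \<Sum>n. h n v)"
    using IJ(2) by (simp add: integral_unique)
  also have "\<dots> = integral {0..1} (\<lambda>v. (s - 1) * (of_real (1 - v) * (s * hurwitz_sum (s + 1) (x + v))))"
    by (intro integral_cong sum_h)
  also have "\<dots> = (s - 1) * integral {0..1} (\<lambda>v. of_real (1 - v) * (s * hurwitz_sum (s + 1) (x + v)))"
    by (rule integral_mult_right)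
  finally show ?thesis using J by (simp add: diff_eq_eq add.commute)
qed

text \<open>Consecutive levels differ only in their integrands, which are taken at s + 1; so the
  agreement in the half-plane of convergence propagates to the left one unit at a time.\<close>

lemma hurwitz_cont_Suc:
  assumes "Re s > 1 - real k" "x \<ge> 1"
  shows "hurwitz_cont (Suc k) s x = hurwitz_cont k s x"
  using assms
proof (induction k arbitrary: s x)
  case 0
  then show ?case using hurwitz_cont_Suc_0 by simp
next
  case (Suc k)
  have "integral {0..1} (\<lambda>v. of_real (1 - v) * hurwitz_cont (Suc k) (s + 1) (x + v)) =
      integral {0..1} (\<lambda>v. of_real (1 - v) * hurwitz_cont k (s + 1) (x + v))"
    using Suc.prems by (intro integral_cong arg_cong2[of _ _ _ _ "(*)"] Suc.IH refl) auto
  then show ?case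
    by (subst (1 2) hurwitz_cont.simps(2)) (simp only:)
qed

text \<open>Both levels are compared with the higher level k + j.\<close>

lemma hurwitz_cont_eq:
  assumes "Re s > 1 - real k" "Re s > 1 - real j" "x \<ge> 1"
  shows "hurwitz_cont k s x = hurwitz_cont j s x"
proof -
  have "hurwitz_cont (k + i) s x = hurwitz_cont k s x" if "Re s > 1 - real k" for i k
    using that assms(3) by (induction i) (simp_all add: hurwitz_cont_Suc del: hurwitz_cont.simps)
  from this[of k j] this[of j k] show ?thesis using assms by (simp add: add.commute)
qed

text \<open>Each level adds one power of 1 + |s| through its factor s - 1. The margin \<delta>
  bounds the series at the bottom level uniformly in \<open>s\<close>. The bound M is there because
  \<open>x powr (1 - s)\<close> grows with \<open>x\<close> to the left of Re s = 1; the integral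
  reaches x + 1, so the induction hypothesis is applied with M + 1.\<close>

lemma hurwitz_cont_growth:
  assumes "\<delta> > 0" "M \<ge> 1"
  shows "\<exists>C\<ge>0. \<forall>s x. Re s \<ge> 1 - real k + \<delta> \<longrightarrow> 1 \<le> x \<longrightarrow> x \<le> M \<longrightarrow>
    norm (hurwitz_cont k s x) \<le> C * (1 + norm s) ^ Suc k"
  using assms(2)
proof (induction k arbitrary: M)
  case 0
  define C where "C = (\<Sum>n. real (Suc n) powr - (1 + \<delta>))"
  have sm: "summable (\<lambda>n. real (Suc n) powr - (1 + \<delta>))"
    using assms by (intro summable_Suc_powr) auto
  have "norm (hurwitz_cont 0 s x) \<le> C * (1 + norm s) ^ Suc 0" if "Re s \<ge> 1 + \<delta>" "1 \<le> x" for s x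
  proof -
    have "norm (hurwitz_sum s x) \<le> C"
      unfolding C_def hurwitz_sum_def using that assms
      by (intro norm_suminf_le sm hurwitz_term_bound) auto
    moreover have "norm (s - 1) \<le> 1 + norm s" using norm_triangle_ineq4[of s 1] by simp
    ultimately have "norm (s - 1) * norm (hurwitz_sum s x) \<le> (1 + norm s) * C"
      by (intro mult_mono) auto
    then show ?thesis by (simp add: norm_mult mult.commute)
  qed
  moreover have "C \<ge> 0" unfolding C_def by (intro suminf_nonneg sm) auto
  ultimately show ?case by auto
next
  case (Suc k)
  from Suc.IH[of "M + 1"] Suc.prems obtain C where C: "C \<ge> 0"
    "\<And>s x. Re s \<ge> 1 - real k + \<delta> \<Longrightarrow> 1 \<le> x \<Longrightarrow> x \<le> M + 1 \<Longrightarrow>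
       norm (hurwitz_cont k s x) \<le> C * (1 + norm s) ^ Suc k" by auto
  have "norm (hurwitz_cont (Suc k) s x) \<le> (M powr real (Suc k) + C * 2 ^ Suc k) * (1 + norm s) ^ Suc (Suc k)"
    if sx: "Re s \<ge> 1 - real (Suc k) + \<delta>" "1 \<le> x" "x \<le> M" for s x
  proof -
    have "norm (complex_of_real x powr (1 - s)) = x powr (1 - Re s)"
      using sx by (subst norm_powr_real_powr) auto
    also have "\<dots> \<le> x powr real (Suc k)" using sx assms by (intro powr_mono) auto
    also have "\<dots> \<le> M powr real (Suc k)" using sx by (intro powr_mono2) auto
    also have "\<dots> \<le> M powr real (Suc k) * (1 + norm s) ^ Suc (Suc k)"
      using mult_left_mono[of 1 "(1 + norm s) ^ Suc (Suc k)" "M powr real (Suc k)"]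
        one_le_power[of "1 + norm s" "Suc (Suc k)"] by simp
    finally have 1: "norm (complex_of_real x powr (1 - s)) \<le> M powr real (Suc k) * (1 + norm s) ^ Suc (Suc k)" .
    have "continuous_on {0..1} (\<lambda>v. hurwitz_cont k (s + 1) (x + v))"
      using continuous_on_compose2[OF continuous_on_hurwitz_cont[of k],
        where f = "\<lambda>v. (s + 1, x + v)" and s = "{0..1}"] sx assms
      by (force intro!: continuous_intros)
    then have "norm (integral {0..1} (\<lambda>v. of_real (1 - v) * hurwitz_cont k (s + 1) (x + v)))
        \<le> C * (2 + norm s) ^ Suc k * (1 - 0)"
    proof (intro integral_bound continuous_intros)
      fix v :: real assume v: "v \<in> {0..1}"
      have "norm (hurwitz_cont k (s + 1) (x + v)) \<le> C * (1 + norm (s + 1)) ^ Suc k"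
        using v sx by (intro C) auto
      also have "\<dots> \<le> C * (2 + norm s) ^ Suc k"
        using C(1) norm_triangle_ineq[of s 1] by (intro mult_left_mono power_mono) auto
      finally have "norm (complex_of_real (1 - v)) * norm (hurwitz_cont k (s + 1) (x + v))
          \<le> 1 * (C * (2 + norm s) ^ Suc k)"
        using v by (intro mult_mono) (auto simp del: of_real_diff)
      then show "norm (complex_of_real (1 - v) * hurwitz_cont k (s + 1) (x + v))
          \<le> C * (2 + norm s) ^ Suc k" by (simp add: norm_mult)
    qed auto
    also have "\<dots> \<le> C * (2 * (1 + norm s)) ^ Suc k"
      using C(1) by (simp del: power_Suc, intro mult_left_mono power_mono) auto
    finally have "norm (s - 1) * norm (integral {0..1} (\<lambda>v. of_real (1 - v) * hurwitz_cont k (s + 1) (x + v)))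
        \<le> (1 + norm s) * (C * (2 * (1 + norm s)) ^ Suc k)"
      using C(1) norm_triangle_ineq4[of s 1] by (intro mult_mono) auto
    also have "\<dots> = C * 2 ^ Suc k * (1 + norm s) ^ Suc (Suc k)"
      by (simp only: power_mult_distrib power_Suc mult_ac)
    finally have 2: "norm ((s - 1) * integral {0..1} (\<lambda>v. of_real (1 - v) * hurwitz_cont k (s + 1) (x + v)))
        \<le> C * 2 ^ Suc k * (1 + norm s) ^ Suc (Suc k)" by (simp add: norm_mult)
    show ?thesis
      unfolding hurwitz_cont.simps distrib_right
      by (rule order_trans[OF norm_triangle_ineq add_mono[OF 1 2]])
  qed
  moreover have "M powr real (Suc k) + C * 2 ^ Suc k \<ge> 0" using C(1) by auto
  ultimately show ?case by blast
qed

section \<open>The zeta function as the case x = 1\<close>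

definition zeta_cont :: "complex \<Rightarrow> complex" where
  "zeta_cont s = hurwitz_cont (nat \<lceil>2 - Re s\<rceil>) s 1 / (s - 1)"

text \<open>The ceiling selects a level k \<ge> 2 - Re s, so \<open>s\<close> lies in the half-plane
  of that level, where it agrees with every other admissible one. On each half-plane a single fixed
  level may therefore be used, which gives holomorphy.\<close>

lemma zeta_cont_eq:
  assumes "Re s > 1 - real k"
  shows "zeta_cont s = hurwitz_cont k s 1 / (s - 1)"
proof -
  have "Re s > 1 - real (nat \<lceil>2 - Re s\<rceil>)"
    using real_nat_ceiling_ge[of "2 - Re s"] by linarith
  then show ?thesis unfolding zeta_cont_def using hurwitz_cont_eq[OF _ assms, of _ 1] by simp
qed

lemma holomorphic_on_zeta_cont: "zeta_cont holomorphic_on (- {1})"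
proof -
  have "zeta_cont holomorphic_on (\<Union>k. {s. Re s > 1 - real k} - {1})"
  proof (rule holomorphic_on_UN_open)
    fix k :: nat
    show "open ({s. Re s > 1 - real k} - {1})"
      by (intro open_Diff open_halfspace_Re_gt) auto
    have "(\<lambda>s. hurwitz_cont k s 1 / (s - 1)) holomorphic_on ({s. Re s > 1 - real k} - {1})"
      using holomorphic_on_hurwitz_cont[of 1 k]
      by (intro holomorphic_intros) (auto intro: holomorphic_on_subset)
    then show "zeta_cont holomorphic_on ({s. Re s > 1 - real k} - {1})"
      by (rule holomorphic_transform) (simp add: zeta_cont_eq[of k])
  qed
  moreover have "(\<Union>k. {s. Re s > 1 - real k} - {1}) = - {1}"
  proof -
    have "\<exists>k. Re s > 1 - real k" for s
      using reals_Archimedean2[of "1 - Re s"] by (auto simp: algebra_simps)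
    then show ?thesis by auto
  qed
  ultimately show ?thesis by simp
qed

lemma bij_betw_Suc_UNIV: "bij_betw Suc UNIV {1..}"
  by (rule bij_betwI[of _ _ _ "\<lambda>n. n - 1"]) auto

lemma has_sum_zeta_cont:
  assumes "Re s > 1"
  shows "((\<lambda>n. of_nat n powr (- s)) has_sum zeta_cont s) {1::nat..}"
proof -
  have eq: "zeta_cont s = hurwitz_sum s 1"
    using zeta_cont_eq[of 0 s] assms by auto
  have "(\<lambda>n. complex_of_real (real n + 1) powr (- s)) sums hurwitz_sum s 1"
    using assms by (intro hurwitz_sums) auto
  moreover have "summable (\<lambda>n. norm (complex_of_real (real n + 1) powr (- s)))"
    using assms hurwitz_term_bound[of "Re s" s 1]
    by (intro summable_comparison_test'[OF summable_Suc_powr[OF assms]]) force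
  ultimately have "((\<lambda>n. complex_of_real (real n + 1) powr (- s)) has_sum hurwitz_sum s 1) UNIV"
    by (rule norm_summable_imp_has_sum[rotated])
  then have "((\<lambda>n. of_nat (Suc n) powr (- s)) has_sum zeta_cont s) UNIV"
    by (simp add: eq add.commute)
  moreover have "bij_betw Suc UNIV {1..}" by (rule bij_betw_Suc_UNIV)
  ultimately show ?thesis
    using has_sum_reindex_bij_betw[of Suc UNIV "{1..}" "\<lambda>n. of_nat n powr (- s)"] by blast
qed

text \<open>\<open>zeta_cont\<close> is the witness that gives the choice in \<open>zeta\<close> its
  meaning.\<close>

lemma zeta_spec:
  "zeta holomorphic_on (- {1}) \<and>
     (\<forall>s. Re s > 1 \<longrightarrow> ((\<lambda>n. of_nat n powr (- s)) has_sum zeta s) {1::nat..})"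
  unfolding zeta_def
  by (rule someI[of _ zeta_cont]) (use holomorphic_on_zeta_cont has_sum_zeta_cont in blast)

lemma holomorphic_on_zeta: "zeta holomorphic_on (- {1})"
  and has_sum_zeta: "Re s > 1 \<Longrightarrow> ((\<lambda>n. of_nat n powr (- s)) has_sum zeta s) {1::nat..}"
  using zeta_spec by auto

text \<open>Both have the same Dirichlet series on Re s > 1, and the plane without 1 is connected.
  This carries the growth of the construction over to \<open>zeta\<close>.\<close>

lemma zeta_eq_zeta_cont:
  assumes "s \<noteq> 1" shows "zeta s = zeta_cont s"
proof (rule analytic_continuation_open[of "{s. Re s > 1}" "- {1}" zeta zeta_cont])
  show "connected (- {1 :: complex})" by (intro connected_punctured_universe) auto
  show "{s. Re s > 1} \<noteq> {}" by (auto intro!: exI[of _ 2])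
  show "zeta z = zeta_cont z" if "z \<in> {s. Re s > 1}" for z
    using has_sum_unique[OF has_sum_zeta has_sum_zeta_cont] that by simp
qed (use assms in \<open>auto intro: open_halfspace_Re_gt holomorphic_on_zeta holomorphic_on_zeta_cont\<close>)

text \<open>At distance at least 1 from the real axis |s - 1| \<ge> 1, so the division by s - 1
  costs nothing. A level k > 2 - \<sigma> leaves the margin \<delta> = 1.\<close>

lemma zeta_growth:
  "\<exists>C k. C \<ge> 0 \<and> (\<forall>s. Re s \<ge> \<sigma> \<longrightarrow> \<bar>Im s\<bar> \<ge> 1 \<longrightarrow> norm (zeta s) \<le> C * (1 + norm s) ^ k)"
proof -
  obtain k :: nat where k: "real k > 2 - \<sigma>" using reals_Archimedean2 by blast
  obtain C where C: "C \<ge> 0"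
    "\<And>s. Re s \<ge> 1 - real k + 1 \<Longrightarrow> norm (hurwitz_cont k s 1) \<le> C * (1 + norm s) ^ Suc k"
    using hurwitz_cont_growth[of 1 1 k] by auto
  have "norm (zeta s) \<le> C * (1 + norm s) ^ Suc k" if s: "Re s \<ge> \<sigma>" "\<bar>Im s\<bar> \<ge> 1" for s
  proof -
    have "s \<noteq> 1" using s by auto
    have n: "norm (s - 1) \<ge> 1" using s abs_Im_le_cmod[of "s - 1"] by simp
    have "norm (zeta s) = norm (hurwitz_cont k s 1) / norm (s - 1)"
      using zeta_eq_zeta_cont[OF \<open>s \<noteq> 1\<close>] zeta_cont_eq[of k s] k s by (simp add: norm_divide)
    also have "\<dots> \<le> norm (hurwitz_cont k s 1) / 1"
      using n by (intro divide_left_mono) auto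
    also have "\<dots> \<le> C * (1 + norm s) ^ Suc k" using C(2)[of s] k s by simp
    finally show ?thesis .
  qed
  then show ?thesis using C(1) by blast
qed

subsection \<open>The Dirichlet series of the reciprocal\<close>

text \<open>Multiplying out \<Prod> (1 + x p) over p \<le> N gives a sum over all sets of indices up
  to N. The same expansion for the norms, with 1 + t \<le> exp t, bounds every finite partial sum by
  exp C, so the family over finite sets is absolutely summable.\<close>

lemma has_sum_Fpow_prod:
  fixes x :: "nat \<Rightarrow> complex"
  assumes bound: "\<And>N. (\<Sum>p\<in>P \<inter> {..N}. norm (x p)) \<le> C"
  shows "(\<lambda>A. norm (\<Prod>p\<in>A. x p)) summable_on Fpow P" (is ?th1)
    and "\<exists>D. ((\<lambda>A. \<Prod>p\<in>A. x p) has_sum D) (Fpow P) \<and>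
      (\<lambda>N. \<Prod>p\<in>P \<inter> {..N}. 1 + x p) \<longlonglongrightarrow> D" (is ?th2)
proof -
  have expand: "(\<Prod>p\<in>P \<inter> {..N}. 1 + y p) = (\<Sum>A\<in>Pow (P \<inter> {..N}). \<Prod>p\<in>A. y p)"
    for y :: "nat \<Rightarrow> 'a :: comm_semiring_1" and N
    using prod_add[of "P \<inter> {..N}" y "\<lambda>_. 1"] by (simp add: add.commute)
  have "sum (\<lambda>A. norm (\<Prod>p\<in>A. x p)) \<F> \<le> exp C" if \<F>: "\<F> \<subseteq> Fpow P" "finite \<F>" for \<F>
  proof -
    have "finite (\<Union>\<F>)" using \<F> by (auto simp: Fpow_def)
    then obtain N where N: "\<Union>\<F> \<subseteq> {..N}"
      by (meson finite_nat_iff_bounded_le)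
    have "sum (\<lambda>A. norm (\<Prod>p\<in>A. x p)) \<F> \<le> sum (\<lambda>A. norm (\<Prod>p\<in>A. x p)) (Pow (P \<inter> {..N}))"
      using \<F> N by (intro sum_mono2) (auto simp: Fpow_def)
    also have "\<dots> = (\<Prod>p\<in>P \<inter> {..N}. 1 + norm (x p))"
      by (simp add: expand prod_norm)
    also have "\<dots> \<le> (\<Prod>p\<in>P \<inter> {..N}. exp (norm (x p)))"
      by (intro prod_mono) (auto intro: add_nonneg_nonneg)
    also have "\<dots> = exp (\<Sum>p\<in>P \<inter> {..N}. norm (x p))" by (simp add: exp_sum)
    also have "\<dots> \<le> exp C" using bound by simp
    finally show ?thesis .
  qed
  then show th1: ?th1
    by (intro nonneg_bdd_above_summable_on bdd_aboveI2[of _ _ "exp C"]) auto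
  then obtain D where D: "((\<lambda>A. \<Prod>p\<in>A. x p) has_sum D) (Fpow P)"
    using abs_summable_summable summable_on_def by blast
  \<comment> \<open>The power sets of initial segments are cofinal among the finite families of
    finite sets. This identifies the unordered sum with the limit of products in increasing order,
    the form in which \<open>has_prod\<close> states Euler products.\<close>
  have "filterlim (\<lambda>N. Pow (P \<inter> {..N})) (finite_subsets_at_top (Fpow P)) sequentially"
    unfolding filterlim_def le_filter_def eventually_filtermap eventually_finite_subsets_at_top
  proof (intro allI impI, elim exE conjE)
    fix Q \<F> assume \<F>: "finite \<F>" "\<F> \<subseteq> Fpow P"
      and Q: "\<forall>Y. finite Y \<and> \<F> \<subseteq> Y \<and> Y \<subseteq> Fpow P \<longrightarrow> Q Y"
    have "finite (\<Union>\<F>)" using \<F> by (auto simp: Fpow_def)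
    then obtain M where M: "\<Union>\<F> \<subseteq> {..M}"
      by (meson finite_nat_iff_bounded_le)
    have "Q (Pow (P \<inter> {..N}))" if "N \<ge> M" for N
    proof -
      have "\<F> \<subseteq> Pow (P \<inter> {..N})"
        using M \<F>(2) that by (force simp: Fpow_def)
      moreover have "Pow (P \<inter> {..N}) \<subseteq> Fpow P"
        by (auto simp: Fpow_def intro: finite_subset)
      ultimately show ?thesis using Q by simp
    qed
    then show "\<forall>\<^sub>F N in sequentially. Q (Pow (P \<inter> {..N}))"
      by (auto simp: eventually_sequentially)
  qed
  from filterlim_compose[OF D[unfolded has_sum_def] this]
  show ?th2 using D by (auto simp: expand)
qed

text \<open>\<open>n = \<Prod>(prime_factors n)\<close> says that n is squarefree; these are the
  coefficients of the Euler product with factors 1 + c p p^(-s).\<close>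

definition euler_coeff :: "(nat \<Rightarrow> complex) \<Rightarrow> nat \<Rightarrow> complex" where
  "euler_coeff c n = (if n > 0 \<and> n = \<Prod>(prime_factors n) then \<Prod>p\<in>prime_factors n. c p else 0)"

lemma of_nat_prod_powr:
  fixes A :: "nat set"
  assumes "finite A" "0 \<notin> A"
  shows "of_nat (\<Prod>A) powr s = (\<Prod>p\<in>A. (of_nat p :: complex) powr s)"
  using assms
proof (induction A rule: finite_induct)
  case (insert p A)
  have "of_nat (p * \<Prod>A) powr s = (of_nat p powr s * of_nat (\<Prod>A) powr s :: complex)"
    unfolding of_nat_mult by (rule powr_times_real) (auto simp del: of_nat_prod)
  then show ?case using insert by simp
qed auto

text \<open>By unique factorisation squarefree numbers correspond to finite sets of primes, and the
  general term is multiplicative along this correspondence. All other numbers contribute 0.\<close>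

lemma euler_coeff_dirichlet:
  assumes c: "\<And>p. prime p \<Longrightarrow> norm (c p) \<le> 1" and s: "Re s > 1"
  shows "(\<lambda>n. norm (euler_coeff c n * of_nat n powr (- s))) summable_on {1..}" (is ?th1)
    and "\<exists>D. ((\<lambda>n. euler_coeff c n * of_nat n powr (- s)) has_sum D) {1..} \<and>
      (\<lambda>N. \<Prod>p\<in>{p. prime p} \<inter> {..N}. 1 + c p * of_nat p powr (- s)) \<longlonglongrightarrow> D" (is ?th2)
proof -
  let ?P = "{p::nat. prime p}"
  let ?x = "\<lambda>p. c p * of_nat p powr (- s)"
  let ?t = "\<lambda>n. euler_coeff c n * of_nat n powr (- s)"
  let ?S = "{n::nat. n > 0 \<and> n = \<Prod>(prime_factors n)}"
  have sm: "summable (\<lambda>n. real n powr - Re s)"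
    using s by (simp add: summable_real_powr_iff)
  have bound: "(\<Sum>p\<in>?P \<inter> {..N}. norm (?x p)) \<le> (\<Sum>n. real n powr - Re s)" for N
  proof -
    have "(\<Sum>p\<in>?P \<inter> {..N}. norm (?x p)) \<le> (\<Sum>p\<in>?P \<inter> {..N}. real p powr - Re s)"
    proof (intro sum_mono)
      fix p assume "p \<in> ?P \<inter> {..N}"
      then have "norm (of_nat p powr (- s) :: complex) = real p powr - Re s" "norm (c p) \<le> 1"
        using c by (auto simp: norm_powr_real_powr prime_gt_0_nat)
      then show "norm (?x p) \<le> real p powr - Re s"
        by (simp add: norm_mult mult_left_le_one_le)
    qed
    also have "\<dots> \<le> (\<Sum>n. real n powr - Re s)" by (intro sum_le_suminf sm) auto
    finally show ?thesis .
  qed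
  have pf: "prime_factors (\<Prod>A) = A" if "A \<in> Fpow ?P" for A
  proof -
    have "prime_factors (\<Prod>A) = \<Union>((prime_factors \<circ> (\<lambda>p. p)) ` A)"
      using that by (intro prime_factors_prod) (auto simp: Fpow_def)
    also have "\<dots> = (\<Union>p\<in>A. {p})"
      using that by (intro SUP_cong refl) (auto simp: Fpow_def prime_prime_factors)
    also have "\<dots> = A" by simp
    finally show ?thesis .
  qed
  have pos: "\<Prod>A > 0" if "A \<in> Fpow ?P" for A
    using that by (intro prod_pos) (auto simp: Fpow_def prime_gt_0_nat)
  have tm: "?t (\<Prod>A) = (\<Prod>p\<in>A. ?x p)" if A: "A \<in> Fpow ?P" for A
  proof -
    have "of_nat (\<Prod>A) powr (- s) = (\<Prod>p\<in>A. (of_nat p :: complex) powr (- s))"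
      using A by (intro of_nat_prod_powr) (auto simp: Fpow_def)
    then show ?thesis using pf[OF A] pos[OF A] by (simp add: euler_coeff_def prod.distrib)
  qed
  have reindex: "((\<lambda>A. h (\<Prod>A)) has_sum D) (Fpow ?P) \<longleftrightarrow> (h has_sum D) ?S"
    for h :: "nat \<Rightarrow> 'a :: topological_comm_monoid_add" and D
    by (rule has_sum_reindex_bij_witness[where i = prime_factors and j = "\<lambda>A. \<Prod>A"])
       (auto simp: pf pos, auto simp: Fpow_def)
  have neutral: "(h has_sum D) ?S \<longleftrightarrow> (h has_sum D) {1..}"
    if "\<And>n. n \<notin> ?S \<Longrightarrow> h n = 0" for h :: "nat \<Rightarrow> 'a :: topological_comm_monoid_add" and D
    using that by (intro has_sum_cong_neutral) auto
  have zero: "?t n = 0" if "n \<notin> ?S" for n using that by (auto simp: euler_coeff_def)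
  have "(\<lambda>A. norm (\<Prod>p\<in>A. ?x p)) summable_on Fpow ?P"
    by (rule has_sum_Fpow_prod(1)[OF bound])
  then obtain E where "((\<lambda>A. norm (\<Prod>p\<in>A. ?x p)) has_sum E) (Fpow ?P)"
    by (auto simp: summable_on_def)
  then have "((\<lambda>A. norm (?t (\<Prod>A))) has_sum E) (Fpow ?P)"
    by (simp only: tm cong: has_sum_cong)
  then have "((\<lambda>n. norm (?t n)) has_sum E) {1..}"
    using reindex[of "\<lambda>n. norm (?t n)"] neutral[of "\<lambda>n. norm (?t n)"] zero by simp
  then show ?th1 by (auto simp: summable_on_def)
  obtain D where D: "((\<lambda>A. \<Prod>p\<in>A. ?x p) has_sum D) (Fpow ?P)"
    "(\<lambda>N. \<Prod>p\<in>?P \<inter> {..N}. 1 + ?x p) \<longlonglongrightarrow> D"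
    using has_sum_Fpow_prod(2)[OF bound] by blast
  have "((\<lambda>A. ?t (\<Prod>A)) has_sum D) (Fpow ?P)"
    using D(1) by (simp only: tm cong: has_sum_cong)
  then have "(?t has_sum D) {1..}"
    using reindex[of ?t] neutral[of ?t] zero by simp
  then show ?th2 using D(2) by blast
qed

section \<open>Dirichlet convolution\<close>

lemma has_sum_divisors:
  fixes f :: "nat \<times> nat \<Rightarrow> 'a :: {topological_comm_monoid_add, t3_space}"
  assumes "(f has_sum S) ({1..} \<times> {1..})"
  shows "((\<lambda>n. \<Sum>d | d dvd n. f (d, n div d)) has_sum S) {1..}"
proof -
  have "((\<lambda>(n, d). f (d, n div d)) has_sum S) (Sigma {1..} (\<lambda>n. {d. d dvd n})) \<longleftrightarrow>
      (f has_sum S) ({1..} \<times> {1..})"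
    by (rule has_sum_reindex_bij_witness[where i = "\<lambda>(d, e). (d * e, d)" and j = "\<lambda>(n, d). (d, n div d)"])
       (auto simp: Suc_le_eq dvd_pos_nat dvd_div_eq_0_iff intro!: Nat.gr0I)
  with assms have "((\<lambda>(n, d). f (d, n div d)) has_sum S) (Sigma {1..} (\<lambda>n. {d. d dvd n}))" by simp
  then show ?thesis
    by (rule has_sum_SigmaD) (auto intro!: has_sum_finite)
qed

text \<open>The family over pairs (d, e) is absolutely summable, so it may be regrouped by the value
  n = d e, along which the power of n splits.\<close>

lemma dirichlet_conv:
  fixes u v :: "nat \<Rightarrow> complex"
  assumes u: "(\<lambda>n. norm (u n * of_nat n powr (- s))) summable_on {1..}"
      "((\<lambda>n. u n * of_nat n powr (- s)) has_sum U) {1..}"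
    and v: "(\<lambda>n. norm (v n * of_nat n powr (- s))) summable_on {1..}"
      "((\<lambda>n. v n * of_nat n powr (- s)) has_sum V) {1..}"
  shows "(\<lambda>n. norm ((\<Sum>d | d dvd n. u d * v (n div d)) * of_nat n powr (- s))) summable_on {1..}" (is ?th1)
    and "((\<lambda>n. (\<Sum>d | d dvd n. u d * v (n div d)) * of_nat n powr (- s)) has_sum U * V) {1..}" (is ?th2)
proof -
  let ?u = "\<lambda>n. u n * of_nat n powr (- s)" and ?v = "\<lambda>n. v n * of_nat n powr (- s)"
  let ?f = "\<lambda>(d, e). ?u d * ?v e"
  let ?N = "{1::nat..}"
  have abs: "(\<lambda>p. norm (?f p)) summable_on ?N \<times> ?N"
  proof -
    have "(\<lambda>(d, e). norm (?u d) * norm (?v e)) summable_on ?N \<times> ?N"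
      using u(1) v(1)
      by (intro summable_on_SigmaI[where g = "\<lambda>d. norm (?u d) * (\<Sum>\<^sub>\<infinity>e\<in>?N. norm (?v e))"])
         (auto intro!: has_sum_cmult_right has_sum_infsum summable_on_cmult_left)
    then show ?thesis by (simp add: case_prod_unfold norm_mult)
  qed
  have "(?f has_sum U * V) (?N \<times> ?N)"
    using u(2) v(2) abs_summable_summable[OF abs]
    by (intro has_sum_SigmaI[where g = "\<lambda>d. ?u d * V"])
       (auto intro!: has_sum_cmult_right has_sum_cmult_left)
  from has_sum_divisors[OF this]
  have 1: "((\<lambda>n. \<Sum>d | d dvd n. ?f (d, n div d)) has_sum U * V) ?N" .
  have split: "?f (d, n div d) = u d * v (n div d) * of_nat n powr (- s)"
    if "d dvd n" "n \<in> ?N" for d n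
  proof -
    from that(1) obtain e where "n = d * e" by auto
    then have "of_nat n powr (- s) = (of_nat d powr (- s) * of_nat e powr (- s) :: complex)"
      using that(2) by (simp add: powr_times_real)
    moreover have "n div d = e" using \<open>n = d * e\<close> that by auto
    ultimately show ?thesis by simp
  qed
  have eq: "(\<Sum>d | d dvd n. ?f (d, n div d)) = (\<Sum>d | d dvd n. u d * v (n div d)) * of_nat n powr (- s)"
    if "n \<in> ?N" for n
    unfolding sum_distrib_right using that by (intro sum.cong refl split) auto
  show ?th2 using 1 has_sum_cong[of ?N, OF eq] by simp
  obtain E where "((\<lambda>p. norm (?f p)) has_sum E) (?N \<times> ?N)"
    using abs by (auto simp: summable_on_def)
  from has_sum_divisors[OF this]
  have "(\<lambda>n. \<Sum>d | d dvd n. norm (?f (d, n div d))) summable_on ?N"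
    by (auto simp: summable_on_def)
  then show ?th1
    by (rule Infinite_Sum.abs_summable_on_comparison_test') (simp only: eq[symmetric] norm_sum)
qed

text \<open>Induction on the number of factors per prime: each further factor convolves the
  coefficients with those of one squarefree product. The sequence \<open>m\<close> is chosen before
  \<open>s\<close>, as one sequence must serve the whole half-plane.\<close>

lemma euler_product_dirichlet:
  fixes c :: "nat \<Rightarrow> nat \<Rightarrow> complex"
  assumes c: "\<And>p j. prime p \<Longrightarrow> j < d \<Longrightarrow> norm (c j p) \<le> 1"
  shows "\<exists>m. \<forall>s. Re s > 1 \<longrightarrow> (\<lambda>n. norm (m n * of_nat n powr (- s))) summable_on {1..} \<and>
    (\<exists>D. ((\<lambda>n. m n * of_nat n powr (- s)) has_sum D) {1..} \<and>
      (\<lambda>N. \<Prod>p\<in>{p. prime p} \<inter> {..N}. \<Prod>j<d. 1 + c j p * of_nat p powr (- s)) \<longlonglongrightarrow> D)"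
  using c
proof (induction d)
  case 0
  define m where "m = (\<lambda>n::nat. if n = 1 then 1 else 0 :: complex)"
  have "((\<lambda>n. m n * of_nat n powr (- s)) has_sum 1) {1..}" for s
    by (rule has_sum_finite_neutralI[of "{1}"]) (auto simp: m_def)
  moreover have "((\<lambda>n. norm (m n * of_nat n powr (- s))) has_sum 1) {1..}" for s
    by (rule has_sum_finite_neutralI[of "{1}"]) (auto simp: m_def)
  ultimately have "\<forall>s. Re s > 1 \<longrightarrow> (\<lambda>n. norm (m n * of_nat n powr (- s))) summable_on {1..} \<and>
      ((\<lambda>n. m n * of_nat n powr (- s)) has_sum 1) {1..}"
    by (metis has_sum_imp_summable)
  then show ?case by (intro exI[of _ m]) (simp, metis tendsto_const)
next
  case (Suc d)
  have "\<And>p j. prime p \<Longrightarrow> j < d \<Longrightarrow> norm (c j p) \<le> 1" using Suc.prems by simp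
  from Suc.IH[OF this] obtain m where m: "\<And>s. Re s > 1 \<Longrightarrow> (\<lambda>n. norm (m n * of_nat n powr (- s))) summable_on {1..} \<and>
    (\<exists>D. ((\<lambda>n. m n * of_nat n powr (- s)) has_sum D) {1..} \<and>
      (\<lambda>N. \<Prod>p\<in>{p. prime p} \<inter> {..N}. \<Prod>j<d. 1 + c j p * of_nat p powr (- s)) \<longlonglongrightarrow> D)"
    by blast
  define m' where "m' = (\<lambda>n. \<Sum>e | e dvd n. m e * euler_coeff (c d) (n div e))"
  have "(\<lambda>n. norm (m' n * of_nat n powr (- s))) summable_on {1..} \<and>
    (\<exists>D. ((\<lambda>n. m' n * of_nat n powr (- s)) has_sum D) {1..} \<and>
      (\<lambda>N. \<Prod>p\<in>{p. prime p} \<inter> {..N}. \<Prod>j<Suc d. 1 + c j p * of_nat p powr (- s)) \<longlonglongrightarrow> D)"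
    if s: "Re s > 1" for s
  proof -
    obtain D where D: "((\<lambda>n. m n * of_nat n powr (- s)) has_sum D) {1..}"
      "(\<lambda>N. \<Prod>p\<in>{p. prime p} \<inter> {..N}. \<Prod>j<d. 1 + c j p * of_nat p powr (- s)) \<longlonglongrightarrow> D"
      using m[OF s] by blast
    have cd: "norm (c d p) \<le> 1" if "prime p" for p using that Suc.prems by simp
    obtain E where E: "((\<lambda>n. euler_coeff (c d) n * of_nat n powr (- s)) has_sum E) {1..}"
      "(\<lambda>N. \<Prod>p\<in>{p. prime p} \<inter> {..N}. 1 + c d p * of_nat p powr (- s)) \<longlonglongrightarrow> E"
      using euler_coeff_dirichlet(2)[of "c d", OF cd s] by blast
    show ?thesis
      using dirichlet_conv[OF conjunct1[OF m[OF s]] D(1)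
          euler_coeff_dirichlet(1)[of "c d", OF cd s] E(1)]
        tendsto_mult[OF D(2) E(2)]
      unfolding m'_def by (auto simp: prod.distrib)
  qed
  then show ?case by blast
qed

section \<open>The coefficients of 1 / F and of zeta (s - 1) / F\<close>

lemma selberg_class_nonzero:
  assumes "F \<in> selberg_class" "Re s > 1"
  shows "F s \<noteq> 0"
proof -
  obtain b where "log_euler_product F b" using assms by (auto simp: selberg_class_def)
  then have "(\<lambda>p. if prime p then exp (\<Sum>l. b (p ^ l) * of_nat p powr (- (of_nat l * s))) else 1)
      has_prod F s"
    using assms(2) by (simp add: log_euler_product_def)
  \<comment> \<open>A convergent product vanishes only if one of its factors does, and here every
    factor is an exponential or 1.\<close>
  from has_prod_eq_0_iff[OF this] show ?thesis by (auto split: if_splits)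
qed

text \<open>The reciprocal of the polynomial Euler product has local factors \<Prod> (1 - \<alpha> j
  p p^(-s)), so the product lemma applies with - \<alpha>. This supplies the witness for the choice
  in \<open>mu_coeff\<close>.\<close>

lemma dirichlet_abs_conv_mu_coeff:
  assumes F: "F \<in> selberg_poly"
  shows "dirichlet_abs_conv (\<lambda>s. 1 / F s) (mu_coeff F)"
proof -
  obtain d and \<alpha> :: "nat \<Rightarrow> nat \<Rightarrow> complex" where \<alpha>': "\<forall>p j. prime p \<longrightarrow> j < d \<longrightarrow> norm (\<alpha> j p) \<le> 1"
    and prod': "\<forall>s. Re s > 1 \<longrightarrow> (\<lambda>p. if prime p then
        \<Prod>j<d. inverse (1 - \<alpha> j p * of_nat p powr (- s)) else 1) has_prod F s"
    using F unfolding selberg_poly_def mem_Collect_eq by blast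
  note \<alpha> = \<alpha>'[rule_format] and prod = prod'[rule_format]
  obtain m where m: "\<And>s. Re s > 1 \<Longrightarrow> (\<lambda>n. norm (m n * of_nat n powr (- s))) summable_on {1..} \<and>
    (\<exists>D. ((\<lambda>n. m n * of_nat n powr (- s)) has_sum D) {1..} \<and>
      (\<lambda>N. \<Prod>p\<in>{p. prime p} \<inter> {..N}. \<Prod>j<d. 1 + (- \<alpha> j p) * of_nat p powr (- s)) \<longlonglongrightarrow> D)"
    using euler_product_dirichlet[of d "\<lambda>j p. - \<alpha> j p"] \<alpha> by auto
  have "dirichlet_abs_conv (\<lambda>s. 1 / F s) m"
    unfolding dirichlet_abs_conv_def
  proof (intro allI impI conjI)
    fix s :: complex assume s: "Re s > 1"
    show "(\<lambda>n. norm (m n * of_nat n powr (- s))) summable_on {1..}" using m[OF s] by blast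
    obtain D where D: "((\<lambda>n. m n * of_nat n powr (- s)) has_sum D) {1..}"
      "(\<lambda>N. \<Prod>p\<in>{p. prime p} \<inter> {..N}. \<Prod>j<d. 1 + (- \<alpha> j p) * of_nat p powr (- s)) \<longlonglongrightarrow> D"
      using m[OF s] by blast
    have "(\<lambda>N. \<Prod>p\<le>N. inverse (if prime p then
        \<Prod>j<d. inverse (1 - \<alpha> j p * of_nat p powr (- s)) else 1)) \<longlonglongrightarrow> inverse (F s)"
      using has_prod_inverse[OF prod[OF s]] by (rule has_prod_imp_tendsto)
    moreover have "(\<Prod>p\<le>N. inverse (if prime p then
        \<Prod>j<d. inverse (1 - \<alpha> j p * of_nat p powr (- s)) else 1)) =
        (\<Prod>p\<in>{p. prime p} \<inter> {..N}. \<Prod>j<d. 1 + (- \<alpha> j p) * of_nat p powr (- s))" for N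
      by (rule prod.mono_neutral_cong_right) (auto simp: prod_inversef[symmetric] o_def)
    ultimately have "D = inverse (F s)"
      using D(2) LIMSEQ_unique by simp
    with D(1) show "((\<lambda>n. m n * of_nat n powr (- s)) has_sum 1 / F s) {1..}"
      by (simp add: inverse_eq_divide)
  qed
  then show ?thesis unfolding mu_coeff_def by (rule someI[of "dirichlet_abs_conv (\<lambda>s. 1 / F s)"])
qed

lemma g_coeff_dirichlet:
  assumes F: "F \<in> selberg_poly" and s: "Re s > 2"
  shows "(\<lambda>n. norm (g_coeff F n * of_nat n powr (- s))) summable_on {1..}"
    and "((\<lambda>n. g_coeff F n * of_nat n powr (- s)) has_sum (zeta (s - 1) / F s)) {1..}"
proof -
  \<comment> \<open>The series of zeta (s - 1) has coefficient n at n^(-s); this is the second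
    factor of the convolution in \<open>g_coeff\<close>.\<close>
  have shift: "of_nat n * of_nat n powr (- s) = (of_nat n powr (- (s - 1)) :: complex)"
    if "n \<in> {1..}" for n :: nat
    using that powr_add[of "of_nat n :: complex" 1 "- s"] by (simp add: algebra_simps)
  have z: "((\<lambda>n. of_nat n powr (- (s - 1)) :: complex) has_sum zeta (s - 1)) {1::nat..}"
    using has_sum_zeta[of "s - 1"] s by simp
  have 1: "((\<lambda>n. of_nat n * of_nat n powr (- s)) has_sum zeta (s - 1)) {1::nat..}"
    using z by (simp only: shift cong: has_sum_cong)
  have 2: "(\<lambda>n. norm (of_nat n * of_nat n powr (- s) :: complex)) summable_on {1::nat..}"
    by (rule summable_on_iff_abs_summable_on_complex[THEN iffD1, OF has_sum_imp_summable[OF 1]])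
  have mu: "(\<lambda>n. norm (mu_coeff F n * of_nat n powr (- s))) summable_on {1..}"
      "((\<lambda>n. mu_coeff F n * of_nat n powr (- s)) has_sum 1 / F s) {1..}"
    using dirichlet_abs_conv_mu_coeff[OF F] s by (auto simp: dirichlet_abs_conv_def)
  from dirichlet_conv[OF mu 2 1]
  show "(\<lambda>n. norm (g_coeff F n * of_nat n powr (- s))) summable_on {1..}"
    "((\<lambda>n. g_coeff F n * of_nat n powr (- s)) has_sum (zeta (s - 1) / F s)) {1..}"
    by (simp_all add: g_coeff_def)
qed

subsection \<open>Growth on the left line\<close>

text \<open>The height \<open>y\<close> enters only through the product, so the denominators cancel
  when two heights on the same vertical line are compared.\<close>

lemma rGamma_series_Complex:
  assumes "x > 0"
  shows "norm (rGamma_series (Complex x y) n) =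
    (\<Prod>k=0..n. norm (Complex (x + real k) y)) / (fact n * exp (x * ln (real n)))"
proof -
  have "Complex x y + of_nat k = Complex (x + real k) y" for k
    by (simp add: complex_eq_iff)
  moreover have "norm (exp (Complex x y * complex_of_real (ln (real n)))) = exp (x * ln (real n))"
    by (simp add: norm_exp_eq_Re)
  ultimately show ?thesis
    by (simp add: rGamma_series_def pochhammer_Suc_prod norm_divide norm_mult prod_norm[symmetric] norm_fact)
qed

text \<open>
  By Euler's product, \<open>\<bar>\<Gamma>(x + iy)\<bar> / \<Gamma>(x)\<close> is the limit of \<open>\<Prod>k\<le>n. (x + k) / \<bar>x + k + iy\<bar>\<close>, in
  which each factor increases with \<open>x\<close>.
\<close>

lemma norm_rGamma_mono:
  assumes x: "x > 0" and \<delta>: "\<delta> \<ge> 0"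
  shows "norm (rGamma (Complex (x + \<delta>) y)) * norm (rGamma (Complex x 0)) \<le>
    norm (rGamma (Complex x y)) * norm (rGamma (Complex (x + \<delta>) 0))"
proof (rule LIMSEQ_le)
  show "\<exists>N. \<forall>n\<ge>N. norm (rGamma_series (Complex (x + \<delta>) y) n) * norm (rGamma_series (Complex x 0) n)
      \<le> norm (rGamma_series (Complex x y) n) * norm (rGamma_series (Complex (x + \<delta>) 0) n)"
  proof (intro exI allI impI)
    fix n :: nat
    have step: "norm (Complex (x + \<delta> + real k) y) * norm (Complex (x + real k) 0)
        \<le> norm (Complex (x + real k) y) * norm (Complex (x + \<delta> + real k) 0)" for k
    proof -
      define u w where "u = x + real k" and "w = x + \<delta> + real k"
      have uw: "0 < u" "u \<le> w" using assms by (auto simp: u_def w_def)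
      have "y\<^sup>2 * u\<^sup>2 \<le> y\<^sup>2 * w\<^sup>2" using uw by (intro mult_left_mono power_mono) auto
      then have "(w\<^sup>2 + y\<^sup>2) * u\<^sup>2 \<le> (u\<^sup>2 + y\<^sup>2) * w\<^sup>2" by (simp add: algebra_simps)
      then have "sqrt ((w\<^sup>2 + y\<^sup>2) * u\<^sup>2) \<le> sqrt ((u\<^sup>2 + y\<^sup>2) * w\<^sup>2)" by (rule real_sqrt_le_mono)
      then show ?thesis
        unfolding u_def[symmetric] w_def[symmetric] by (simp add: real_sqrt_mult complex_norm)
    qed
    have "(\<Prod>k=0..n. norm (Complex (x + \<delta> + real k) y)) * (\<Prod>k=0..n. norm (Complex (x + real k) 0))
        \<le> (\<Prod>k=0..n. norm (Complex (x + real k) y)) * (\<Prod>k=0..n. norm (Complex (x + \<delta> + real k) 0))"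
      unfolding prod.distrib[symmetric] by (intro prod_mono conjI step) auto
    then show "norm (rGamma_series (Complex (x + \<delta>) y) n) * norm (rGamma_series (Complex x 0) n)
      \<le> norm (rGamma_series (Complex x y) n) * norm (rGamma_series (Complex (x + \<delta>) 0) n)"
      using assms by (simp add: rGamma_series_Complex divide_right_mono mult.commute)
  qed
qed (intro tendsto_intros)+

lemma Complex_notin_nonpos_Ints:
  assumes "y \<noteq> 0" shows "Complex x y \<notin> \<int>\<^sub>\<le>\<^sub>0"
  using assms by (auto elim!: nonpos_Ints_cases simp: complex_eq_iff)

lemma Complex_pos_notin_nonpos_Ints:
  assumes "x > 0" shows "Complex x y \<notin> \<int>\<^sub>\<le>\<^sub>0"
  using assms by (auto elim!: nonpos_Ints_cases simp: complex_eq_iff)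

text \<open>The constant is Gamma x / Gamma (x + \<delta>): on a vertical line the quotient of the
  absolute values is largest at the real axis.\<close>

lemma norm_Gamma_le_shift:
  assumes "x > 0" "\<delta> \<ge> 0"
  shows "\<exists>C\<ge>0. \<forall>y. norm (Gamma (Complex x y)) \<le> C * norm (Gamma (Complex (x + \<delta>) y))"
proof -
  define C where "C = norm (rGamma (Complex (x + \<delta>) 0)) / norm (rGamma (Complex x 0))"
  have nz: "rGamma (Complex u y) \<noteq> 0" if "u > 0" for u y
    using Complex_pos_notin_nonpos_Ints[OF that] by (simp add: rGamma_eq_zero_iff)
  have "norm (Gamma (Complex x y)) \<le> C * norm (Gamma (Complex (x + \<delta>) y))" for y
    using norm_rGamma_mono[OF assms, of y] nz[of x y] nz[of "x + \<delta>" y] nz[of x 0] assms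
    by (simp add: C_def Gamma_def norm_inverse norm_divide field_simps)
  then show ?thesis by (auto simp: C_def intro!: exI[of _ C])
qed

lemma norm_Gamma_shift_growth:
  assumes \<delta>: "\<delta> \<ge> 0"
  shows "\<exists>C k. C \<ge> 0 \<and> (\<forall>y. \<bar>y\<bar> \<ge> 1 \<longrightarrow>
    norm (Gamma (Complex x y)) \<le> C * (1 + \<bar>y\<bar>) ^ k * norm (Gamma (Complex (x + \<delta>) y)))"
proof -
  obtain k :: nat where k: "real k > - x" using reals_Archimedean2 by blast
  obtain C where C: "C \<ge> 0"
    "\<And>y. norm (Gamma (Complex (x + real k) y)) \<le> C * norm (Gamma (Complex (x + real k + \<delta>) y))"
    using norm_Gamma_le_shift[of "x + real k" \<delta>] k \<delta> by auto
  \<comment> \<open>Chosen so that each of the k factors of the Pochhammer product at x + \<delta>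
    is at most B (1 + |y|).\<close>
  define B where "B = \<bar>x + \<delta>\<bar> + real k + 1"
  have poch: "Gamma (Complex u y + of_nat k) = pochhammer (Complex u y) k * Gamma (Complex u y)"
    if "\<bar>y\<bar> \<ge> 1" for u y
    using pochhammer_Gamma[of "Complex u y" k] Complex_notin_nonpos_Ints[of y u] that
    by (auto simp: Gamma_eq_zero_iff)
  have sh: "Complex u y + of_nat k = Complex (u + real k) y" for u y k
    by (simp add: complex_eq_iff)
  have "norm (Gamma (Complex x y)) \<le> C * B ^ k * (1 + \<bar>y\<bar>) ^ k * norm (Gamma (Complex (x + \<delta>) y))"
    if y: "\<bar>y\<bar> \<ge> 1" for y
  proof -
    have "1 \<le> norm (pochhammer (Complex x y) k)"
      unfolding pochhammer_prod prod_norm[symmetric]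
    proof (intro prod_ge_1)
      fix i show "1 \<le> norm (Complex x y + of_nat i)"
        using abs_Im_le_cmod[of "Complex x y + of_nat i"] y by simp
    qed
    then have "norm (Gamma (Complex x y)) \<le> norm (pochhammer (Complex x y) k) * norm (Gamma (Complex x y))"
      using mult_right_mono[of 1 _ "norm (Gamma (Complex x y))"] by simp
    also have "\<dots> = norm (Gamma (Complex (x + real k) y))"
      using poch[OF y, of x] by (simp add: sh norm_mult)
    also have "\<dots> \<le> C * norm (Gamma (Complex (x + real k + \<delta>) y))" by (rule C)
    also have "x + real k + \<delta> = (x + \<delta>) + real k" by simp
    also have "norm (Gamma (Complex ((x + \<delta>) + real k) y)) =
        norm (pochhammer (Complex (x + \<delta>) y) k) * norm (Gamma (Complex (x + \<delta>) y))"
      using poch[OF y, of "x + \<delta>"] by (simp add: sh norm_mult)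
    also have "norm (pochhammer (Complex (x + \<delta>) y) k) \<le> (\<Prod>i<k. B * (1 + \<bar>y\<bar>))"
      unfolding pochhammer_prod prod_norm[symmetric] atLeast0LessThan
    proof (intro prod_mono conjI)
      fix i assume i: "i \<in> {..<k}"
      have "norm (Complex (x + \<delta>) y + of_nat i) \<le> \<bar>x + \<delta>\<bar> + \<bar>y\<bar> + real i"
        using norm_triangle_ineq[of "Complex (x + \<delta>) y" "of_nat i"] cmod_le[of "Complex (x + \<delta>) y"]
        by simp
      also have "\<dots> \<le> (B - 1) + \<bar>y\<bar>" using i by (simp add: B_def)
      also have "\<dots> \<le> B * (1 + \<bar>y\<bar>)"
      proof -
        have "0 \<le> (B - 1) * \<bar>y\<bar>" by (simp add: B_def)
        then show ?thesis by (simp add: algebra_simps)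
      qed
      finally show "norm (Complex (x + \<delta>) y + of_nat i) \<le> B * (1 + \<bar>y\<bar>)" .
    qed auto
    finally show ?thesis
      using C(1) by (simp add: power_mult_distrib mult_left_mono mult_right_mono mult.assoc)
  qed
  moreover have "C * B ^ k \<ge> 0" using C(1) by (simp add: B_def)
  ultimately show ?thesis by blast
qed

text \<open>Passing from a to 1 - a shifts the real part in a factor by lam (1 - 2 a), which is
  positive as a < 0. Above t0 all arguments have positive imaginary part and avoid the poles; this
  is recorded for the functional equation.\<close>

lemma norm_Gamma_prod_growth:
  fixes lam :: "nat \<Rightarrow> real" and mu :: "nat \<Rightarrow> complex"
  assumes lam: "\<And>j. j < r \<Longrightarrow> lam j > 0" and a: "a < 0"
  shows "\<exists>C k t0. C \<ge> 0 \<and> t0 > 0 \<and> (\<forall>t\<ge>t0. (\<forall>j<r. lam j * t + Im (mu j) > 0) \<and>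
    (\<Prod>j<r. norm (Gamma (of_real (lam j) * Complex a t + mu j))) \<le>
      C * (1 + t) ^ k * (\<Prod>j<r. norm (Gamma (of_real (lam j) * Complex (1 - a) t + mu j))))"
  using lam
proof (induction r)
  case 0
  then show ?case by (intro exI[of _ 1] exI[of _ 0]) auto
next
  case (Suc r)
  have "\<And>j. j < r \<Longrightarrow> lam j > 0" using Suc.prems by simp
  from Suc.IH[OF this] obtain C k t0 where IH: "C \<ge> 0" "t0 > 0"
    "\<And>t j. t \<ge> t0 \<Longrightarrow> j < r \<Longrightarrow> lam j * t + Im (mu j) > 0"
    "\<And>t. t \<ge> t0 \<Longrightarrow> (\<Prod>j<r. norm (Gamma (of_real (lam j) * Complex a t + mu j))) \<le>
      C * (1 + t) ^ k * (\<Prod>j<r. norm (Gamma (of_real (lam j) * Complex (1 - a) t + mu j)))"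
    by blast
  define l m where "l = lam r" and "m = mu r"
  have l: "l > 0" using Suc.prems by (simp add: l_def)
  have "l * (1 - 2 * a) \<ge> 0" using l a by simp
  from norm_Gamma_shift_growth[OF this, of "l * a + Re m"] obtain C' k' where C': "C' \<ge> 0"
    "\<And>y. \<bar>y\<bar> \<ge> 1 \<Longrightarrow> norm (Gamma (Complex (l * a + Re m) y)) \<le>
       C' * (1 + \<bar>y\<bar>) ^ k' * norm (Gamma (Complex (l * a + Re m + l * (1 - 2 * a)) y))" by blast
  \<comment> \<open>From this height on the argument of the new factor has imaginary part at least
    1, as the bound for a single factor requires.\<close>
  define t1 where "t1 = max t0 ((1 + \<bar>Im m\<bar>) / l)"
  define B where "B = 1 + l + \<bar>Im m\<bar>"
  have "(\<forall>j<Suc r. lam j * t + Im (mu j) > 0) \<and>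
    (\<Prod>j<Suc r. norm (Gamma (of_real (lam j) * Complex a t + mu j))) \<le>
      C * (C' * B ^ k') * (1 + t) ^ (k + k') *
        (\<Prod>j<Suc r. norm (Gamma (of_real (lam j) * Complex (1 - a) t + mu j)))" if t: "t \<ge> t1" for t
  proof
    have t0: "t \<ge> t0" "t > 0" using t IH(2) by (auto simp: t1_def)
    have "t \<ge> (1 + \<bar>Im m\<bar>) / l" using t by (simp add: t1_def)
    then have y: "l * t + Im m \<ge> 1" using l by (simp add: field_simps)
    then show "\<forall>j<Suc r. lam j * t + Im (mu j) > 0"
      using IH(3)[OF t0(1)] by (auto simp: less_Suc_eq l_def m_def)
    have e1: "of_real l * Complex a t + m = Complex (l * a + Re m) (l * t + Im m)"
      by (simp add: complex_eq_iff)
    have e2: "of_real l * Complex (1 - a) t + m =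
        Complex (l * a + Re m + l * (1 - 2 * a)) (l * t + Im m)"
      by (simp add: complex_eq_iff algebra_simps)
    have "1 + \<bar>l * t + Im m\<bar> \<le> B * (1 + t)"
    proof -
      have "1 + \<bar>l * t + Im m\<bar> \<le> 1 + l * t + \<bar>Im m\<bar>" using l t0 by (auto simp: abs_if)
      also have "\<dots> \<le> B * (1 + t)" using l t0 by (simp add: B_def algebra_simps)
      finally show ?thesis .
    qed
    then have pw: "(1 + \<bar>l * t + Im m\<bar>) ^ k' \<le> (B * (1 + t)) ^ k'" by (intro power_mono) auto
    have "norm (Gamma (of_real l * Complex a t + m)) \<le>
        C' * (1 + \<bar>l * t + Im m\<bar>) ^ k' * norm (Gamma (of_real l * Complex (1 - a) t + m))"
      unfolding e1 e2 using y by (intro C'(2)) auto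
    also have "\<dots> \<le> C' * (B * (1 + t)) ^ k' * norm (Gamma (of_real l * Complex (1 - a) t + m))"
      using pw C'(1) by (intro mult_right_mono mult_left_mono) auto
    finally have last: "norm (Gamma (of_real l * Complex a t + m)) \<le>
        C' * (B * (1 + t)) ^ k' * norm (Gamma (of_real l * Complex (1 - a) t + m))" .
    have "(\<Prod>j<Suc r. norm (Gamma (of_real (lam j) * Complex a t + mu j))) \<le>
      (C * (1 + t) ^ k * (\<Prod>j<r. norm (Gamma (of_real (lam j) * Complex (1 - a) t + mu j)))) *
      (C' * (B * (1 + t)) ^ k' * norm (Gamma (of_real l * Complex (1 - a) t + m)))"
      unfolding prod.lessThan_Suc l_def[symmetric] m_def[symmetric]
      using IH(1) t0 by (intro mult_mono IH(4) last) (auto intro!: mult_nonneg_nonneg prod_nonneg)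
    also have "\<dots> = C * (C' * B ^ k') * (1 + t) ^ (k + k') *
        (\<Prod>j<Suc r. norm (Gamma (of_real (lam j) * Complex (1 - a) t + mu j)))"
      by (simp add: power_mult_distrib power_add l_def m_def mult_ac)
    finally show "(\<Prod>j<Suc r. norm (Gamma (of_real (lam j) * Complex a t + mu j))) \<le>
      C * (C' * B ^ k') * (1 + t) ^ (k + k') *
        (\<Prod>j<Suc r. norm (Gamma (of_real (lam j) * Complex (1 - a) t + mu j)))" .
  qed
  moreover have "C * (C' * B ^ k') \<ge> 0" using IH(1) C'(1) l by (simp add: B_def)
  moreover have "t1 > 0" using IH(2) by (simp add: t1_def)
  ultimately show ?case by blast
qed

section \<open>Transfer through the functional equation\<close>

lemma selberg_inverse_bounded:
  assumes F: "F \<in> selberg_poly" and \<sigma>: "\<sigma> > 1"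
  shows "\<exists>M\<ge>0. \<forall>t. norm (1 / F (Complex \<sigma> t)) \<le> M"
proof -
  define M where "M = (\<Sum>\<^sub>\<infinity>n\<in>{1..}. norm (mu_coeff F n * of_nat n powr (- of_real \<sigma>)))"
  have nn: "norm (mu_coeff F n * of_nat n powr (- Complex \<sigma> t)) =
      norm (mu_coeff F n * of_nat n powr (- of_real \<sigma>))" if "n \<in> {1..}" for n t
    using that by (simp add: norm_mult norm_powr_real_powr)
  have "norm (1 / F (Complex \<sigma> t)) \<le> M" for t
  proof -
    have "((\<lambda>n. mu_coeff F n * of_nat n powr (- Complex \<sigma> t)) has_sum 1 / F (Complex \<sigma> t)) {1..}"
      "(\<lambda>n. norm (mu_coeff F n * of_nat n powr (- Complex \<sigma> t))) summable_on {1..}"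
      using dirichlet_abs_conv_mu_coeff[OF F] \<sigma> by (auto simp: dirichlet_abs_conv_def)
    then have "norm (1 / F (Complex \<sigma> t)) \<le>
        (\<Sum>\<^sub>\<infinity>n\<in>{1..}. norm (mu_coeff F n * of_nat n powr (- Complex \<sigma> t)))"
      using norm_infsum_bound infsumI by metis
    also have "\<dots> = M" unfolding M_def by (rule infsum_cong) (rule nn)
    finally show ?thesis .
  qed
  moreover have "M \<ge> 0" unfolding M_def by (intro infsum_nonneg) auto
  ultimately show ?thesis by blast
qed

text \<open>Absolute values remove \<omega> and the conjugation from the functional equation. The
  reflection 1 - cnj s keeps the height, so both sides are compared at the same t, and what remains
  is powers of Q, the Gamma quotient and the bounded 1 / F (1 - a + it).\<close>

lemma selberg_inverse_growth:
  assumes F: "F \<in> selberg_poly" and a: "a < 0"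
  shows "\<exists>C k t0. C \<ge> 0 \<and> t0 > 0 \<and> (\<forall>t\<ge>t0. norm (1 / F (Complex a t)) \<le> C * (1 + t) ^ k)"
proof -
  obtain Q r lam mu \<omega> where FE: "functional_eq F Q r lam mu \<omega>"
    using F by (auto simp: selberg_poly_def selberg_class_def)
  then have Q: "Q > 0" and lam: "\<And>j. j < r \<Longrightarrow> lam j > 0" and \<omega>: "norm \<omega> = 1"
    by (auto simp: functional_eq_def)
  obtain C k t0 where C: "C \<ge> 0" "t0 > 0"
    "\<And>t j. t \<ge> t0 \<Longrightarrow> j < r \<Longrightarrow> lam j * t + Im (mu j) > 0"
    "\<And>t. t \<ge> t0 \<Longrightarrow> (\<Prod>j<r. norm (Gamma (of_real (lam j) * Complex a t + mu j))) \<le>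
      C * (1 + t) ^ k * (\<Prod>j<r. norm (Gamma (of_real (lam j) * Complex (1 - a) t + mu j)))"
    using norm_Gamma_prod_growth[of r lam a mu, OF lam a] by blast
  obtain M where M: "M \<ge> 0" "\<And>t. norm (1 / F (Complex (1 - a) t)) \<le> M"
    using selberg_inverse_bounded[OF F, of "1 - a"] a by auto
  have "norm (1 / F (Complex a t)) \<le> (Q powr a / Q powr (1 - a) * C * M) * (1 + t) ^ k"
    if t: "t \<ge> t0" for t
  \<comment> \<open>At a zero of \<open>F\<close> the convention \<open>1 / 0 = 0\<close> makes the
    bound trivial.\<close>
  proof (cases "F (Complex a t) = 0")
    case True
    then show ?thesis using C(1,2) M(1) t by (simp add: Q)
  next
    case False
    define A where "A = (\<Prod>j<r. norm (Gamma (of_real (lam j) * Complex a t + mu j)))"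
    define B where "B = (\<Prod>j<r. norm (Gamma (of_real (lam j) * Complex (1 - a) t + mu j)))"
    have refl: "1 - cnj (Complex a t) = Complex (1 - a) t" by (simp add: complex_eq_iff)
    have np: "of_real (lam j) * Complex u t + mu j \<notin> \<int>\<^sub>\<le>\<^sub>0" if "j < r" for j u
    proof -
      have "of_real (lam j) * Complex u t + mu j =
          Complex (lam j * u + Re (mu j)) (lam j * t + Im (mu j))" by (simp add: complex_eq_iff)
      then show ?thesis using C(3)[OF t that] Complex_notin_nonpos_Ints by simp
    qed
    have ne: "Complex a t \<noteq> 0" "Complex a t \<noteq> 1" using a by (auto simp: complex_eq_iff)
    have B: "B > 0" unfolding B_def using np by (intro prod_pos) (auto simp: Gamma_eq_zero_iff)
    have F': "F (Complex (1 - a) t) \<noteq> 0"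
      using selberg_class_nonzero F a by (auto simp: selberg_poly_def)
    have "completed_fn F Q r lam mu (Complex a t) = \<omega> * cnj (completed_fn F Q r lam mu (Complex (1 - a) t))"
      using FE[unfolded functional_eq_def, THEN conjunct2, THEN conjunct2, THEN conjunct2,
        THEN spec, of "Complex a t"] np ne unfolding refl by simp
    then have "norm (completed_fn F Q r lam mu (Complex a t)) =
        norm (completed_fn F Q r lam mu (Complex (1 - a) t))"
      using \<omega> by (simp add: norm_mult)
    then have eq: "Q powr a * A * norm (F (Complex a t)) =
        Q powr (1 - a) * B * norm (F (Complex (1 - a) t))"
      using Q by (simp add: completed_fn_def norm_mult norm_powr_real_powr A_def B_def prod_norm)
    have A0: "A \<ge> 0" unfolding A_def by (intro prod_nonneg) auto
    have A: "A \<le> C * (1 + t) ^ k * B" unfolding A_def B_def by (rule C(4)[OF t])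
    have "norm (1 / F (Complex a t)) = Q powr a * A / (Q powr (1 - a) * B * norm (F (Complex (1 - a) t)))"
      using False F' B Q by (simp add: norm_divide eq[symmetric] divide_simps)
        (use eq in \<open>auto simp: mult_ac\<close>)
    also have "\<dots> = Q powr a / Q powr (1 - a) * (A / B) * norm (1 / F (Complex (1 - a) t))"
      by (simp add: norm_divide)
    also have "\<dots> \<le> Q powr a / Q powr (1 - a) * (C * (1 + t) ^ k) * M"
      using A A0 B M Q C(1,2) t by (intro mult_mono) (auto simp: field_simps)
    finally show ?thesis by (simp add: mult_ac)
  qed
  moreover have "Q powr a / Q powr (1 - a) * C * M \<ge> 0" using C(1) M(1) by simp
  ultimately show ?thesis using C(2) by blast
qed

subsection \<open>Zeros and the contour\<close>

lemma selberg_poly_imp_class: "F \<in> selberg_poly \<Longrightarrow> F \<in> selberg_class"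
  by (simp add: selberg_poly_def)

lemma holomorphic_on_selberg:
  assumes "F \<in> selberg_class"
  shows "F holomorphic_on - {1}"
proof -
  obtain m G where G: "G holomorphic_on UNIV" "\<And>s. s \<noteq> 1 \<Longrightarrow> G s = (s - 1) ^ m * F s"
    using assms by (auto simp: selberg_class_def entire_finite_order_def)
  have "(\<lambda>s. G s / (s - 1) ^ m) holomorphic_on - {1}"
    using G(1) by (intro holomorphic_intros) (auto intro: holomorphic_on_subset)
  then show ?thesis
    by (rule holomorphic_transform) (simp add: G(2))
qed

lemma connected_minus_1: "connected (- {1 :: complex})"
  by (intro connected_punctured_universe) auto

text \<open>Zeros of a nonconstant holomorphic function are finite in number on a compact set. A
  constant \<open>F\<close> equals its nonzero value at 2 everywhere off 1 and has no zero in
  K.\<close>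

lemma selberg_finite_zeros:
  assumes F: "F \<in> selberg_class" and K: "compact K" "1 \<notin> K"
  shows "finite {s \<in> K. F s = 0}"
proof (cases "F constant_on - {1}")
  case True
  then obtain c where c: "\<And>s. s \<noteq> 1 \<Longrightarrow> F s = c" by (auto simp: constant_on_def)
  have "F 2 \<noteq> 0" using selberg_class_nonzero[OF F, of 2] by simp
  then have "c \<noteq> 0" using c[of 2] by simp
  then have "F s \<noteq> 0" if "s \<in> K" for s using c[of s] K(2) that by (cases "s = 1") auto
  then have "{s \<in> K. F s = 0} = {}" by auto
  then show ?thesis by (metis finite.emptyI)
next
  case False
  then show ?thesis
    using K by (intro holomorphic_compact_finite_zeros[OF holomorphic_on_selberg[OF F] _ connected_minus_1])
      auto
qed

text \<open>A nontrivial zero with Re < 0 would be reflected to a point with Re > 1, where neither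
  \<open>F\<close> nor the Gamma factors vanish, although the functional equation makes their
  product 0 there. At a trivial zero some lam \<rho> + mu is a nonpositive integer while Re mu \<ge>
  0, so Re \<rho> \<le> 0; with Re \<rho> \<ge> 0 only the imaginary axis remains.\<close>

lemma upper_zeros_eq:
  assumes F: "F \<in> selberg_class"
  shows "upper_zeros F = {\<rho>. F \<rho> = 0 \<and> Im \<rho> > 0 \<and> Re \<rho> \<ge> 0}"
proof (intro equalityI subsetI)
  fix \<rho> assume \<rho>: "\<rho> \<in> upper_zeros F"
  have "Re \<rho> \<ge> 0"
  proof (rule ccontr)
    assume neg: "\<not> Re \<rho> \<ge> 0"
    then have \<rho>': "\<rho> \<in> nontrivial_zeros F" "Im \<rho> > 0" using \<rho> by (auto simp: upper_zeros_def)
    obtain Q r lam mu \<omega> where FE: "functional_eq F Q r lam mu \<omega>"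
      using F by (auto simp: selberg_class_def)
    have lam: "lam j > 0" "Re (mu j) \<ge> 0" if "j < r" for j
      using FE that by (auto simp: functional_eq_def)
    \<comment> \<open>A nontrivial zero avoids the Gamma poles of every functional equation of
      \<open>F\<close>, hence of the one just chosen.\<close>
    have np1: "of_real (lam j) * \<rho> + mu j \<notin> \<int>\<^sub>\<le>\<^sub>0" if "j < r" for j
      using \<rho>' FE that unfolding nontrivial_zeros_def trivial_zeros_def by blast
    have np2: "of_real (lam j) * (1 - cnj \<rho>) + mu j \<notin> \<int>\<^sub>\<le>\<^sub>0" if "j < r" for j
    proof -
      have "lam j * (1 - Re \<rho>) > 0" using lam[OF that] neg by simp
      then have "Re (of_real (lam j) * (1 - cnj \<rho>) + mu j) > 0" using lam[OF that] by simp
      then show ?thesis using Complex_pos_notin_nonpos_Ints by (metis complex_surj)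
    qed
    have ne: "\<rho> \<noteq> 0" "\<rho> \<noteq> 1" using neg by auto
    have "completed_fn F Q r lam mu \<rho> = \<omega> * cnj (completed_fn F Q r lam mu (1 - cnj \<rho>))"
      using FE[unfolded functional_eq_def, THEN conjunct2, THEN conjunct2, THEN conjunct2,
        THEN spec, of \<rho>] np1 np2 ne by simp
    moreover have "F \<rho> = 0" using \<rho>' by (auto simp: nontrivial_zeros_def)
    moreover have "F (1 - cnj \<rho>) \<noteq> 0" using selberg_class_nonzero[OF F] neg by simp
    moreover have "\<omega> \<noteq> 0" "Q > 0" using FE by (auto simp: functional_eq_def)
    ultimately show False
      using np2 by (auto simp: completed_fn_def Gamma_eq_zero_iff)
  qed
  then show "\<rho> \<in> {\<rho>. F \<rho> = 0 \<and> Im \<rho> > 0 \<and> Re \<rho> \<ge> 0}"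
    using \<rho> by (auto simp: upper_zeros_def nontrivial_zeros_def trivial_zeros_def)
next
  fix \<rho> assume "\<rho> \<in> {\<rho>. F \<rho> = 0 \<and> Im \<rho> > 0 \<and> Re \<rho> \<ge> 0}"
  then have \<rho>: "F \<rho> = 0" "Im \<rho> > 0" "Re \<rho> \<ge> 0" by auto
  have "Re \<rho> = 0" if triv: "\<rho> \<in> trivial_zeros F"
  proof -
    obtain Q r lam mu \<omega> j where *: "functional_eq F Q r lam mu \<omega>" "j < r"
      "of_real (lam j) * \<rho> + mu j \<in> \<int>\<^sub>\<le>\<^sub>0"
      using triv by (auto simp: trivial_zeros_def)
    have "lam j > 0" "Re (mu j) \<ge> 0" using *(1,2) by (auto simp: functional_eq_def)
    moreover have "Re (of_real (lam j) * \<rho> + mu j) \<le> 0"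
      using *(3) by (elim nonpos_Ints_cases) simp
    ultimately have "lam j * Re \<rho> \<le> 0" by simp
    then show ?thesis using \<open>lam j > 0\<close> \<rho>(3) by (simp add: mult_le_0_iff)
  qed
  then show "\<rho> \<in> upper_zeros F" using \<rho> by (auto simp: upper_zeros_def nontrivial_zeros_def)
qed

text \<open>The point 2 is the pole of zeta (s - 1), and at 1 \<open>F\<close> may have a pole or an
  arbitrary value.\<close>

lemma holomorphic_on_zeta_kernel:
  assumes F: "F \<in> selberg_class" and S: "1 \<notin> S" "2 \<notin> S" "\<And>s. s \<in> S \<Longrightarrow> F s \<noteq> 0"
  shows "(\<lambda>s. zeta (s - 1) / F s) holomorphic_on S" "zeta_kernel F z holomorphic_on S"
proof -
  have "zeta \<circ> (\<lambda>s. s - 1) holomorphic_on S"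
    using S by (intro holomorphic_on_compose_gen[OF _ holomorphic_on_zeta] holomorphic_intros)
      (auto simp: diff_eq_eq)
  moreover have "F holomorphic_on S"
    using S by (intro holomorphic_on_subset[OF holomorphic_on_selberg[OF F]]) auto
  ultimately show *: "(\<lambda>s. zeta (s - 1) / F s) holomorphic_on S"
    using S(3) by (intro holomorphic_on_divide) (auto simp: o_def)
  then show "zeta_kernel F z holomorphic_on S"
    unfolding zeta_kernel_def[abs_def] by (rule holomorphic_on_mult) (intro holomorphic_intros)
qed

text \<open>Near a simple zero F (w) = h (w) (w - \<rho>) with h (\<rho>) = F' (\<rho>), so the
  kernel is a holomorphic function divided by w - \<rho>.\<close>

lemma residue_zeta_kernel:
  assumes F: "F \<in> selberg_class" and \<rho>: "F \<rho> = 0" "Im \<rho> > 0" "zorder F \<rho> = 1"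
  shows "residue (zeta_kernel F z) \<rho> = exp (\<rho> * z) * zeta (\<rho> - 1) / deriv F \<rho>"
proof -
  have \<rho>1: "\<rho> \<noteq> 1" using \<rho>(2) by auto
  have hol: "F holomorphic_on - {1}" by (rule holomorphic_on_selberg[OF F])
  have "F 2 \<noteq> 0" using selberg_class_nonzero[OF F, of 2] by simp
  then have "\<exists>w\<in>- {1}. F w \<noteq> 0" by (intro bexI[of _ 2]) auto
  moreover have "open (- {1 :: complex})" by auto
  ultimately have "\<exists>r>0. cball \<rho> r \<subseteq> - {1} \<and> zor_poly F \<rho> holomorphic_on cball \<rho> r \<and>
      (\<forall>w\<in>cball \<rho> r. F w = zor_poly F \<rho> w * (w - \<rho>) ^ nat (zorder F \<rho>) \<and> zor_poly F \<rho> w \<noteq> 0)"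
    using zorder_exist_zero[OF hol _ connected_minus_1, of \<rho>] \<rho>1 by blast
  with \<rho>(3)
  obtain r where r: "r > 0" "cball \<rho> r \<subseteq> - {1}" "zor_poly F \<rho> holomorphic_on cball \<rho> r"
    "\<And>w. w \<in> cball \<rho> r \<Longrightarrow> F w = zor_poly F \<rho> w * (w - \<rho>) \<and> zor_poly F \<rho> w \<noteq> 0"
    by auto
  define h where "h = zor_poly F \<rho>"
  have h: "h holomorphic_on ball \<rho> r" "h \<rho> \<noteq> 0"
    using r by (auto simp: h_def intro: holomorphic_on_subset)
  have "(F has_field_derivative deriv F \<rho>) (at \<rho>)"
    using hol \<rho>1 by (intro holomorphic_derivI[of _ "- {1}"]) auto
  moreover have "(F has_field_derivative h \<rho>) (at \<rho>)"
  proof (rule has_field_derivative_transform_within_open)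
    obtain D where "(h has_field_derivative D) (at \<rho>)"
      using h(1) r(1) holomorphic_on_open[of "ball \<rho> r" h] by (metis centre_in_ball open_ball)
    then show "((\<lambda>w. h w * (w - \<rho>)) has_field_derivative h \<rho>) (at \<rho>)"
      by (auto intro!: derivative_eq_intros)
    show "h w * (w - \<rho>) = F w" if "w \<in> ball \<rho> r" for w
      using r(4)[of w] that by (simp add: h_def)
  qed (use r(1) in auto)
  ultimately have D: "deriv F \<rho> = h \<rho>" by (rule DERIV_unique)
  \<comment> \<open>Restricting to the upper half-plane keeps the pole of zeta (s - 1) out of the
    neighbourhood.\<close>
  define U where "U = ball \<rho> r \<inter> {s. Im s > 0}"
  have U: "open U" "\<rho> \<in> U" using r \<rho> by (auto simp: U_def open_halfspace_Im_gt)
  have hz: "zeta \<circ> (\<lambda>s. s - 1) holomorphic_on U"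
    by (intro holomorphic_on_compose_gen[OF _ holomorphic_on_zeta] holomorphic_intros)
       (auto simp: U_def diff_eq_eq)
  have hU: "h holomorphic_on U" using h(1) by (rule holomorphic_on_subset) (auto simp: U_def)
  have hn: "h w \<noteq> 0" if "w \<in> U" for w using r(4)[of w] that by (auto simp: h_def U_def)
  have "(\<lambda>s. zeta (s - 1) / h s * exp (s * z)) holomorphic_on U"
    using hz hU hn by (intro holomorphic_intros) (auto simp: o_def)
  from residue_simple[OF U this]
  have "residue (\<lambda>w. zeta (w - 1) / h w * exp (w * z) / (w - \<rho>)) \<rho> =
      zeta (\<rho> - 1) / h \<rho> * exp (\<rho> * z)" .
  moreover have "residue (zeta_kernel F z) \<rho> =
      residue (\<lambda>w. zeta (w - 1) / h w * exp (w * z) / (w - \<rho>)) \<rho>"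
  proof (rule residue_cong)
    show "\<forall>\<^sub>F w in at \<rho>. zeta_kernel F z w = zeta (w - 1) / h w * exp (w * z) / (w - \<rho>)"
      unfolding eventually_at_topological
      using U r(4) by (intro exI[of _ U]) (auto simp: zeta_kernel_def h_def U_def)
  qed simp
  ultimately show ?thesis by (simp add: D mult.commute)
qed

section \<open>The zero-free region and the residue theorem\<close>

locale zero_free_contour =
  fixes F :: "complex \<Rightarrow> complex" and a b \<alpha> :: real
  assumes F: "F \<in> selberg_poly"
    and b: "b > 5/2"
    and a: "-3/2 < a" "a < 0" "\<And>\<rho>. F \<rho> = 0 \<Longrightarrow> Re \<rho> < 0 \<Longrightarrow> Re \<rho> / 2 < a"
    and \<alpha>: "\<alpha> > 0" "upper_zeros F \<noteq> {} \<Longrightarrow> \<alpha> = (LEAST y. y \<in> Im ` upper_zeros F) / 2"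
begin

lemma Fc: "F \<in> selberg_class"
  using F by (rule selberg_poly_imp_class)

text \<open>\<open>LEAST\<close> over the reals is a minimum only if it is attained, so it must
  first be shown that there are finitely many zeros up to a given height.\<close>

lemma zero_Im_ge:
  assumes "F s = 0" "Im s > 0" "Re s \<ge> 0"
  shows "Im s \<ge> 2 * \<alpha>"
proof -
  let ?Z = "upper_zeros F"
  have s: "s \<in> ?Z" using assms upper_zeros_eq[OF Fc] by simp
  define M where "M = {\<rho> \<in> ?Z. Im \<rho> \<le> Im s}"
  have "finite M"
  proof -
    \<comment> \<open>The compact box used below contains 1, where \<open>F\<close> need not be
      holomorphic; the entire function G has the same zeros off that point.\<close>
    obtain m G where G: "G holomorphic_on UNIV" "\<And>s. s \<noteq> 1 \<Longrightarrow> G s = (s - 1) ^ m * F s"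
      using Fc by (auto simp: selberg_class_def entire_finite_order_def)
    show ?thesis
    proof (cases "G constant_on UNIV")
      case True
      then obtain c where c: "\<And>s. G s = c" by (auto simp: constant_on_def)
      have "F 2 \<noteq> 0" using selberg_class_nonzero[OF Fc, of 2] by simp
      then have "c \<noteq> 0" using c[of 2] G(2)[of 2] by simp
      have "M = {}"
      proof (rule equals0I)
        fix \<rho> assume "\<rho> \<in> M"
        then have "F \<rho> = 0" "Im \<rho> > 0" by (auto simp: M_def upper_zeros_eq[OF Fc])
        moreover from this have "\<rho> \<noteq> 1" by auto
        ultimately show False using G(2)[of \<rho>] c[of \<rho>] \<open>c \<noteq> 0\<close> by simp
      qed
      then show ?thesis by simp
    next
      case False
      have "finite {w \<in> cbox 0 (Complex 1 (Im s)). G w = 0}"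
        by (intro holomorphic_compact_finite_zeros[OF G(1) _ _ _ _ False]) auto
      moreover have "M \<subseteq> {w \<in> cbox 0 (Complex 1 (Im s)). G w = 0}"
      proof
        fix \<rho> assume "\<rho> \<in> M"
        then have \<rho>: "F \<rho> = 0" "Im \<rho> > 0" "Re \<rho> \<ge> 0" "Im \<rho> \<le> Im s"
          by (auto simp: M_def upper_zeros_eq[OF Fc])
        then have "\<rho> \<noteq> 1" by auto
        moreover have "Re \<rho> \<le> 1" using selberg_class_nonzero[OF Fc, of \<rho>] \<rho>(1) by force
        ultimately show "\<rho> \<in> {w \<in> cbox 0 (Complex 1 (Im s)). G w = 0}"
          using \<rho> G(2)[of \<rho>] by (simp add: in_cbox_complex_iff)
      qed
      ultimately show ?thesis by (rule finite_subset[rotated])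
    qed
  qed
  moreover have "s \<in> M" using s by (simp add: M_def)
  ultimately have min: "Min (Im ` M) \<in> Im ` M" "\<And>\<rho>. \<rho> \<in> M \<Longrightarrow> Min (Im ` M) \<le> Im \<rho>"
    by (auto intro!: Min_in)
  have "(LEAST y. y \<in> Im ` ?Z) = Min (Im ` M)"
  proof (rule Least_equality)
    show "Min (Im ` M) \<in> Im ` ?Z" using min(1) by (auto simp: M_def)
    fix y assume "y \<in> Im ` ?Z"
    then obtain \<rho> where \<rho>: "\<rho> \<in> ?Z" "y = Im \<rho>" by auto
    show "Min (Im ` M) \<le> y"
    proof (cases "Im \<rho> \<le> Im s")
      case True
      then show ?thesis using min(2)[of \<rho>] \<rho> by (simp add: M_def)
    next
      case False
      then show ?thesis using min(2)[OF \<open>s \<in> M\<close>] \<rho> by simp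
    qed
  qed
  moreover have "\<alpha> = (LEAST y. y \<in> Im ` ?Z) / 2" using \<alpha>(2) s by blast
  ultimately show ?thesis using min(2)[OF \<open>s \<in> M\<close>] by simp
qed

text \<open>Three reasons: the choice of \<open>a\<close>, the Euler product, and the minimality
  behind \<alpha>. The factors 2 in 2 a and 2 \<alpha> leave room on both sides of the lines Re s =
  a and Im s = \<alpha>.\<close>

lemma nonzero:
  assumes "2 * a \<le> Re s" "Re s < 0 \<or> Re s > 1 \<or> (0 < Im s \<and> Im s < 2 * \<alpha>)"
  shows "F s \<noteq> 0"
proof
  assume 0: "F s = 0"
  then have "Re s \<ge> 0" using a(3)[of s] assms(1) by force
  moreover have "Re s \<le> 1" using selberg_class_nonzero[OF Fc, of s] 0 by force
  ultimately show False using zero_Im_ge[OF 0] assms(2) by auto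
qed

text \<open>The point 1 meets none of the three alternatives, so only the pole at 2 has to be
  excluded by name.\<close>

lemma kernel_holomorphic_strip:
  assumes "\<And>s. s \<in> S \<Longrightarrow> 2 * a \<le> Re s \<and> s \<noteq> 2 \<and> (Re s < 0 \<or> Re s > 1 \<or> (0 < Im s \<and> Im s < 2 * \<alpha>))"
  shows "zeta_kernel F z holomorphic_on S" "(\<lambda>s. zeta (s - 1) / F s) holomorphic_on S"
proof -
  have "1 \<notin> S" "2 \<notin> S" "\<And>s. s \<in> S \<Longrightarrow> F s \<noteq> 0"
    using assms nonzero by force+
  then show "zeta_kernel F z holomorphic_on S" "(\<lambda>s. zeta (s - 1) / F s) holomorphic_on S"
    using holomorphic_on_zeta_kernel[OF Fc] by blast+
qed

lemma rectangle_integral: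
  assumes simple: "\<And>\<rho>. F \<rho> = 0 \<Longrightarrow> Im \<rho> > 0 \<Longrightarrow> zorder F \<rho> = 1"
    and T: "T > \<alpha>" "\<And>\<sigma>. \<sigma> \<ge> a \<Longrightarrow> F (Complex \<sigma> T) \<noteq> 0"
  shows "contour_integral (rectpath (Complex a \<alpha>) (Complex b T)) (zeta_kernel F z) =
    2 * pi * \<i> * zero_sum F T z"
proof -
  define p q where "p = Complex a \<alpha>" and "q = Complex b T"
  \<comment> \<open>An open box with a margin on all sides, so that the path runs inside it. The
    surplus at the top may contain zeros; these get winding number 0 below.\<close>
  define S where "S = box (Complex (2 * a) 0) (Complex (b + 1) (T + 1))"
  define pts where "pts = {\<rho> \<in> S. F \<rho> = 0}"
  have S: "s \<in> S \<longleftrightarrow> 2 * a < Re s \<and> Re s < b + 1 \<and> 0 < Im s \<and> Im s < T + 1" for s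
    by (auto simp: S_def in_box_complex_iff)
  have pts: "0 \<le> Re \<rho>" "Re \<rho> \<le> 1" "2 * \<alpha> \<le> Im \<rho>" "F \<rho> = 0" "Im \<rho> < T + 1" if "\<rho> \<in> pts" for \<rho>
    using that nonzero[of \<rho>] by (force simp: pts_def S)+
  have "finite pts"
  proof (rule finite_subset)
    show "pts \<subseteq> {\<rho> \<in> cbox (Complex 0 \<alpha>) (Complex 1 (T + 1)). F \<rho> = 0}"
      using pts \<alpha>(1) by (force simp: in_cbox_complex_iff)
    show "finite {\<rho> \<in> cbox (Complex 0 \<alpha>) (Complex 1 (T + 1)). F \<rho> = 0}"
      using \<alpha>(1) by (intro selberg_finite_zeros Fc) (auto simp: in_cbox_complex_iff)
  qed
  have le: "Re p \<le> Re q" "Im p \<le> Im q" using a b T by (auto simp: p_def q_def)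
  have img: "path_image (rectpath p q) \<subseteq> S - pts"
  proof
    fix s assume "s \<in> path_image (rectpath p q)"
    then have s: "(Re s = a \<or> Re s = b) \<and> \<alpha> \<le> Im s \<and> Im s \<le> T \<or>
        (Im s = \<alpha> \<or> Im s = T) \<and> a \<le> Re s \<and> Re s \<le> b"
      unfolding path_image_rectpath[OF le] by (auto simp: p_def q_def)
    then have "F s \<noteq> 0"
    proof (elim disjE conjE)
      assume "Im s = T" "a \<le> Re s" then show ?thesis using T(2)[of "Re s"] by (metis complex_surj)
    qed (use nonzero[of s] a b \<alpha> T in auto)
    then show "s \<in> S - pts" using s a b \<alpha> T by (auto simp: S pts_def)
  qed
  have "contour_integral (rectpath p q) (zeta_kernel F z) =
      2 * pi * \<i> * (\<Sum>\<rho>\<in>pts. winding_number (rectpath p q) \<rho> * residue (zeta_kernel F z) \<rho>)"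
  proof (rule Residue_theorem[of S])
    show "zeta_kernel F z holomorphic_on S - pts"
      by (intro holomorphic_on_zeta_kernel Fc) (auto simp: S pts_def)
    show "\<forall>w. w \<notin> S \<longrightarrow> winding_number (rectpath p q) w = 0"
      using img by (auto intro!: winding_number_zero_outside[of _ S] simp: S_def)
  qed (use img \<open>finite pts\<close> in \<open>auto simp: S_def intro: convex_connected\<close>)
  also have "(\<Sum>\<rho>\<in>pts. winding_number (rectpath p q) \<rho> * residue (zeta_kernel F z) \<rho>) = zero_sum F T z"
    unfolding zero_sum_def
  proof (rule sum.mono_neutral_cong_right)
    show "finite pts" by fact
    show "{\<rho> \<in> upper_zeros F. Im \<rho> < T} \<subseteq> pts"
    proof
      fix \<rho> assume \<rho>: "\<rho> \<in> {\<rho> \<in> upper_zeros F. Im \<rho> < T}"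
      then have "Re \<rho> \<le> 1" using selberg_class_nonzero[OF Fc, of \<rho>] upper_zeros_eq[OF Fc] by force
      then show "\<rho> \<in> pts" using \<rho> a b by (auto simp: pts_def S upper_zeros_eq[OF Fc])
    qed
    \<comment> \<open>Zeros in the box that the sum omits have height at least T. Height T itself
      carries no zero by assumption, so they lie outside the rectangle.\<close>
    show "\<forall>\<rho>\<in>pts - {\<rho> \<in> upper_zeros F. Im \<rho> < T}.
        winding_number (rectpath p q) \<rho> * residue (zeta_kernel F z) \<rho> = 0"
    proof
      fix \<rho> assume \<rho>: "\<rho> \<in> pts - {\<rho> \<in> upper_zeros F. Im \<rho> < T}"
      then have "Im \<rho> \<ge> T" using pts[of \<rho>] \<alpha>(1) by (auto simp: upper_zeros_eq[OF Fc])
      moreover have "Im \<rho> \<noteq> T"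
        using T(2)[of "Re \<rho>"] pts[of \<rho>] \<rho> a by (metis DiffE complex_surj dual_order.trans less_imp_le)
      ultimately have "\<rho> \<notin> cbox p q" by (auto simp: in_cbox_complex_iff q_def)
      then show "winding_number (rectpath p q) \<rho> * residue (zeta_kernel F z) \<rho> = 0"
        using winding_number_rectpath_outside[OF le] by simp
    qed
    fix \<rho> assume \<rho>: "\<rho> \<in> {\<rho> \<in> upper_zeros F. Im \<rho> < T}"
    then have \<rho>': "F \<rho> = 0" "Im \<rho> > 0" "Re \<rho> \<ge> 0" "Im \<rho> < T" by (auto simp: upper_zeros_eq[OF Fc])
    have "Re \<rho> \<le> 1" using selberg_class_nonzero[OF Fc, of \<rho>] \<rho>' by force
    then have "\<rho> \<in> box p q"
      using \<rho>' zero_Im_ge[of \<rho>] \<alpha>(1) a b by (auto simp: in_box_complex_iff p_def q_def)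
    then show "winding_number (rectpath p q) \<rho> * residue (zeta_kernel F z) \<rho> =
        exp (\<rho> * z) * zeta (\<rho> - 1) / deriv F \<rho>"
      using residue_zeta_kernel[OF Fc \<rho>'(1,2) simple[OF \<rho>'(1,2)]] by (simp add: winding_number_rectpath)
  qed
  finally show ?thesis by (simp add: p_def q_def)
qed

lemma kernel_continuous:
  assumes "\<And>s. s \<in> S \<Longrightarrow> 2 * a \<le> Re s \<and> s \<noteq> 2 \<and> (Re s < 0 \<or> Re s > 1 \<or> (0 < Im s \<and> Im s < 2 * \<alpha>))"
  shows "continuous_on S (zeta_kernel F z)"
  using kernel_holomorphic_strip(1)[OF assms] by (rule holomorphic_on_imp_continuous_on)

text \<open>The triangle meets the real axis only in the vertex a, where Re s < 0; every other point
  has height in (0, \<alpha>], below all zeros.\<close>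

lemma left_triangle:
  assumes "s \<in> convex hull {complex_of_real a, Complex ((a + b) / 2) \<alpha>, Complex a \<alpha>}"
  shows "a \<le> Re s \<and> s \<noteq> 2 \<and> (Re s < 0 \<or> (0 < Im s \<and> Im s < 2 * \<alpha>))"
proof -
  from assms obtain u v w where uvw: "0 \<le> u" "0 \<le> v" "0 \<le> w" "u + v + w = 1"
    "s = u *\<^sub>R complex_of_real a + v *\<^sub>R Complex ((a + b) / 2) \<alpha> + w *\<^sub>R Complex a \<alpha>"
    unfolding convex_hull_3 by auto
  have Re: "Re s = u * a + v * ((a + b) / 2) + w * a" and Im: "Im s = (v + w) * \<alpha>"
    by (simp_all add: uvw(5) algebra_simps)
  have "Re s = (u + v + w) * a + v * ((b - a) / 2)" unfolding Re by (simp add: field_simps)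
  then have Re': "Re s = a + v * ((b - a) / 2)" using uvw(4) by simp
  have ge: "a \<le> Re s" unfolding Re' using uvw a b by simp
  show ?thesis
  proof (cases "v + w = 0")
    case True
    then have "v = 0" using uvw by linarith
    then have "Re s = a" using Re' by simp
    then show ?thesis using a by auto
  next
    case False
    then have pos: "v + w > 0" "v + w \<le> 1" using uvw by linarith+
    then have "Im s > 0" "Im s \<le> 1 * \<alpha>" unfolding Im using \<alpha>(1) by (auto intro: mult_right_mono)
    then show ?thesis using ge \<alpha>(1) by auto
  qed
qed

text \<open>Here the vertex b is the only real point, and b > 5/2 places it to the right of the pole
  at 2.\<close>

lemma right_triangle:
  assumes "s \<in> convex hull {Complex ((a + b) / 2) \<alpha>, complex_of_real b, Complex b \<alpha>}"
  shows "a \<le> Re s \<and> s \<noteq> 2 \<and> (Re s > 1 \<or> (0 < Im s \<and> Im s < 2 * \<alpha>))"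
proof -
  from assms obtain u v w where uvw: "0 \<le> u" "0 \<le> v" "0 \<le> w" "u + v + w = 1"
    "s = u *\<^sub>R Complex ((a + b) / 2) \<alpha> + v *\<^sub>R complex_of_real b + w *\<^sub>R Complex b \<alpha>"
    unfolding convex_hull_3 by auto
  have Re: "Re s = u * ((a + b) / 2) + v * b + w * b" and Im: "Im s = (u + w) * \<alpha>"
    by (simp_all add: uvw(5) algebra_simps)
  have "Re s = (u + v + w) * b - u * ((b - a) / 2)" unfolding Re by (simp add: field_simps)
  then have Re': "Re s = b - u * ((b - a) / 2)" using uvw(4) by simp
  have "u * ((b - a) / 2) \<le> 1 * ((b - a) / 2)" using uvw a b by (intro mult_right_mono) auto
  then have "Re s \<ge> b - (b - a) / 2" unfolding Re' mult_1_left by (rule diff_left_mono)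
  then have ge: "a \<le> Re s" using a(2) b by (simp add: field_simps)
  show ?thesis
  proof (cases "u + w = 0")
    case True
    then have "u = 0" using uvw by linarith
    then have "Re s = b" using Re' by simp
    then show ?thesis using a b by auto
  next
    case False
    then have pos: "u + w > 0" "u + w \<le> 1" using uvw by linarith+
    then have "Im s > 0" "Im s \<le> 1 * \<alpha>" unfolding Im using \<alpha>(1) by (auto intro: mult_right_mono)
    then show ?thesis using ge \<alpha>(1) by auto
  qed
qed

lemma path_L_segments:
  assumes "s \<in> closed_segment (complex_of_real a) (Complex ((a + b) / 2) \<alpha>) \<union>
    closed_segment (Complex ((a + b) / 2) \<alpha>) (complex_of_real b)"
  shows "2 * a \<le> Re s \<and> s \<noteq> 2 \<and> (Re s < 0 \<or> Re s > 1 \<or> (0 < Im s \<and> Im s < 2 * \<alpha>))"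
proof -
  have "s \<in> convex hull {complex_of_real a, Complex ((a + b) / 2) \<alpha>, Complex a \<alpha>} \<or>
      s \<in> convex hull {Complex ((a + b) / 2) \<alpha>, complex_of_real b, Complex b \<alpha>}"
    using assms segments_subset_convex_hull(1) by blast
  then show ?thesis using left_triangle[of s] right_triangle[of s] a(2) by auto
qed

lemma f2_eq:
  "zeta_kernel F z contour_integrable_on path_L a b \<alpha>"
  "f2 F a b \<alpha> z =
     contour_integral (linepath (of_real a) (Complex ((a + b) / 2) \<alpha>)) (zeta_kernel F z) +
     contour_integral (linepath (Complex ((a + b) / 2) \<alpha>) (of_real b)) (zeta_kernel F z)"
proof -
  have *: "zeta_kernel F z contour_integrable_on linepath (of_real a) (Complex ((a + b) / 2) \<alpha>)"
    "zeta_kernel F z contour_integrable_on linepath (Complex ((a + b) / 2) \<alpha>) (of_real b)"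
    using path_L_segments by (auto intro!: contour_integrable_continuous_linepath kernel_continuous)
  then show "zeta_kernel F z contour_integrable_on path_L a b \<alpha>"
    unfolding path_L_def by simp
  show "f2 F a b \<alpha> z =
     contour_integral (linepath (of_real a) (Complex ((a + b) / 2) \<alpha>)) (zeta_kernel F z) +
     contour_integral (linepath (Complex ((a + b) / 2) \<alpha>) (of_real b)) (zeta_kernel F z)"
    unfolding f2_def path_L_def using * by simp
qed

text \<open>Cauchy's theorem on the two triangles trades the bottom side at height \<alpha> for L
  and two short vertical pieces; these extend the left and right sides of the rectangle down to the
  real axis.\<close>

lemma contour_identity:
  assumes simple: "\<And>\<rho>. F \<rho> = 0 \<Longrightarrow> Im \<rho> > 0 \<Longrightarrow> zorder F \<rho> = 1"
    and T: "T > \<alpha>" "\<And>\<sigma>. \<sigma> \<ge> a \<Longrightarrow> F (Complex \<sigma> T) \<noteq> 0"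
  shows "2 * pi * \<i> * zero_sum F T z =
    contour_integral (linepath (Complex a T) (of_real a)) (zeta_kernel F z) + f2 F a b \<alpha> z +
    contour_integral (linepath (of_real b) (Complex b T)) (zeta_kernel F z) +
    contour_integral (linepath (Complex b T) (Complex a T)) (zeta_kernel F z)"
proof -
  define c where "c = Complex ((a + b) / 2) \<alpha>"
  let ?I = "\<lambda>p q. contour_integral (linepath p q) (zeta_kernel F z)"
  note seg = closed_segment_same_Re closed_segment_same_Im closed_segment_eq_real_ivl
  have "(zeta_kernel F z has_contour_integral 0)
      (linepath (of_real a) c +++ linepath c (Complex a \<alpha>) +++ linepath (Complex a \<alpha>) (of_real a))"
    unfolding c_def using left_triangle a
    by (intro Cauchy_theorem_triangle kernel_holomorphic_strip) force
  then have left: "?I (of_real a) c + ?I c (Complex a \<alpha>) + ?I (Complex a \<alpha>) (of_real a) = 0"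
    by (rule has_chain_integral_chain_integral3)
  have "(zeta_kernel F z has_contour_integral 0)
      (linepath c (of_real b) +++ linepath (of_real b) (Complex b \<alpha>) +++ linepath (Complex b \<alpha>) c)"
    unfolding c_def using right_triangle a
    by (intro Cauchy_theorem_triangle kernel_holomorphic_strip) force
  then have right: "?I c (of_real b) + ?I (of_real b) (Complex b \<alpha>) + ?I (Complex b \<alpha>) c = 0"
    by (rule has_chain_integral_chain_integral3)
  have cont_a: "continuous_on (closed_segment (Complex a T) (of_real a)) (zeta_kernel F z)"
    using a by (intro kernel_continuous) (auto simp: seg)
  have cont_b: "continuous_on (closed_segment (of_real b) (Complex b T)) (zeta_kernel F z)"
    using a b by (intro kernel_continuous) (auto simp: seg)
  have cont_\<alpha>: "continuous_on (closed_segment (Complex a \<alpha>) (Complex b \<alpha>)) (zeta_kernel F z)"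
    using a b \<alpha> by (intro kernel_continuous) (auto simp: seg)
  have cont_T: "continuous_on (closed_segment (Complex b T) (Complex a T)) (zeta_kernel F z)"
  proof (intro holomorphic_on_imp_continuous_on holomorphic_on_zeta_kernel Fc)
    fix s assume "s \<in> closed_segment (Complex b T) (Complex a T)"
    then have "Im s = T" "Re s \<ge> a" using a b by (auto simp: seg)
    then show "F s \<noteq> 0" using T(2)[of "Re s"] by (metis complex_surj)
  qed (use T \<alpha> in \<open>auto simp: seg\<close>)
  have sa: "?I (Complex a T) (of_real a) = ?I (Complex a T) (Complex a \<alpha>) + ?I (Complex a \<alpha>) (of_real a)"
    using T \<alpha> by (intro contour_integral_split_linepath cont_a) (auto simp: seg)
  have sb: "?I (of_real b) (Complex b T) = ?I (of_real b) (Complex b \<alpha>) + ?I (Complex b \<alpha>) (Complex b T)"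
    using T \<alpha> by (intro contour_integral_split_linepath cont_b) (auto simp: seg)
  have s\<alpha>: "?I (Complex a \<alpha>) (Complex b \<alpha>) = ?I (Complex a \<alpha>) c + ?I c (Complex b \<alpha>)"
    using a b by (intro contour_integral_split_linepath cont_\<alpha>) (auto simp: seg c_def)
  have cseg: "closed_segment (Complex a \<alpha>) c \<subseteq> closed_segment (Complex a \<alpha>) (Complex b \<alpha>)"
    "closed_segment c (Complex b \<alpha>) \<subseteq> closed_segment (Complex a \<alpha>) (Complex b \<alpha>)"
    using a b by (auto simp: seg c_def)
  have rev: "?I c (Complex a \<alpha>) = - ?I (Complex a \<alpha>) c" "?I (Complex b \<alpha>) c = - ?I c (Complex b \<alpha>)"
    using contour_integral_reverse_linepath[OF continuous_on_subset[OF cont_\<alpha> cseg(1)]]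
      contour_integral_reverse_linepath[OF continuous_on_subset[OF cont_\<alpha> cseg(2)]] by simp_all
  have "contour_integral (rectpath (Complex a \<alpha>) (Complex b T)) (zeta_kernel F z) =
      ?I (Complex a \<alpha>) (Complex b \<alpha>) + (?I (Complex b \<alpha>) (Complex b T) +
      (?I (Complex b T) (Complex a T) + ?I (Complex a T) (Complex a \<alpha>)))"
  proof -
    have seg_b: "closed_segment (Complex b \<alpha>) (Complex b T) \<subseteq> closed_segment (of_real b) (Complex b T)"
      and seg_a: "closed_segment (Complex a T) (Complex a \<alpha>) \<subseteq> closed_segment (Complex a T) (of_real a)"
      using T \<alpha> by (auto simp: seg)
    have "zeta_kernel F z contour_integrable_on linepath (Complex a \<alpha>) (Complex b \<alpha>)"
      "zeta_kernel F z contour_integrable_on linepath (Complex b \<alpha>) (Complex b T)"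
      "zeta_kernel F z contour_integrable_on linepath (Complex b T) (Complex a T)"
      "zeta_kernel F z contour_integrable_on linepath (Complex a T) (Complex a \<alpha>)"
      using cont_\<alpha> continuous_on_subset[OF cont_b seg_b] cont_T continuous_on_subset[OF cont_a seg_a]
      by (simp_all add: contour_integrable_continuous_linepath)
    then show ?thesis by (simp add: rectpath_def Let_def valid_path_join)
  qed
  moreover have "?I (Complex a \<alpha>) c = ?I (of_real a) c + ?I (Complex a \<alpha>) (of_real a)"
    using left by (simp add: rev algebra_simps)
  moreover have "?I c (Complex b \<alpha>) = ?I c (of_real b) + ?I (of_real b) (Complex b \<alpha>)"
    using right by (simp add: rev algebra_simps)
  ultimately show ?thesis
    using rectangle_integral[OF simple T, of z] f2_eq(2)[of z, folded c_def]
    by (simp add: sa sb s\<alpha> add_ac)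
qed

end

subsection \<open>Vertical lines and the logarithmic series\<close>

text \<open>The factor |exp ((a + it) z)| = exp (a Re z - t Im z) beats any \<phi> of subexponential
  growth, uniformly for z in a disc inside the half-plane. Cutting the half-line into unit intervals
  turns the improper integral into a series of entire functions that converges uniformly on such
  discs.\<close>

lemma vertical_integral_limit:
  fixes \<phi> :: "real \<Rightarrow> complex" and a :: real
  assumes cont: "continuous_on {0..} \<phi>"
    and growth: "\<And>\<epsilon>. \<epsilon> > 0 \<Longrightarrow> \<exists>C. \<forall>t\<ge>0. norm (\<phi> t) \<le> C * exp (\<epsilon> * t)"
  obtains J where "J holomorphic_on {z. Im z > 0}"
    "\<And>z. Im z > 0 \<Longrightarrow> ((\<lambda>R. integral {0..R} (\<lambda>t. \<phi> t * exp (Complex a t * z))) \<longlongrightarrow> J z) at_top"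
proof -
  define f where "f = (\<lambda>z t. \<phi> t * exp (Complex a t * z))"
  have cont_f: "continuous_on {c..d} (f z)" if "c \<ge> 0" for c d z
  proof -
    have "continuous_on {c..d} \<phi>" using that by (intro continuous_on_subset[OF cont]) auto
    then show ?thesis unfolding f_def Complex_eq by (intro continuous_intros)
  qed
  have bound: "\<exists>C \<epsilon>. C \<ge> 0 \<and> \<epsilon> > 0 \<and> (\<forall>z\<in>cball z0 (Im z0 / 2). \<forall>t\<ge>0. norm (f z t) \<le> C * exp (- \<epsilon> * t))"
    if z0: "Im z0 > 0" for z0
  proof -
    \<comment> \<open>On the disc of radius Im z0 / 2 one has Im z \<ge> 2 \<epsilon>: one
      \<epsilon> absorbs the growth of \<phi>, the other is left as decay.\<close>
    define \<epsilon> where "\<epsilon> = Im z0 / 4"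
    have \<epsilon>: "\<epsilon> > 0" using z0 by (simp add: \<epsilon>_def)
    obtain C where C: "\<And>t. t \<ge> 0 \<Longrightarrow> norm (\<phi> t) \<le> C * exp (\<epsilon> * t)"
      using growth[OF \<epsilon>] by blast
    have C0: "C \<ge> 0" using order_trans[OF norm_ge_zero C[of 0]] by simp
    define A where "A = \<bar>a\<bar> * (norm z0 + Im z0 / 2)"
    have "norm (f z t) \<le> C * exp A * exp (- \<epsilon> * t)" if z: "z \<in> cball z0 (Im z0 / 2)" and t: "t \<ge> 0" for z t
    proof -
      have "\<bar>Im z0 - Im z\<bar> \<le> Im z0 / 2" "norm z0 - norm z \<le> Im z0 / 2" "norm z - norm z0 \<le> Im z0 / 2"
        using z abs_Im_le_cmod[of "z0 - z"] norm_triangle_ineq2[of z0 z] norm_triangle_ineq2[of z z0]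
        by (auto simp: dist_norm norm_minus_commute)
      then have Im: "Im z \<ge> 2 * \<epsilon>" and nz: "norm z \<le> norm z0 + Im z0 / 2"
        unfolding \<epsilon>_def by linarith+
      have "a * Re z \<le> \<bar>a\<bar> * norm z"
        using mult_left_mono[OF abs_Re_le_cmod[of z], of "\<bar>a\<bar>"] abs_ge_self[of "a * Re z"]
        by (simp add: abs_mult)
      also have "\<dots> \<le> A" unfolding A_def using nz by (intro mult_left_mono) auto
      finally have "a * Re z \<le> A" .
      moreover have "t * Im z \<ge> t * (2 * \<epsilon>)" using Im t by (intro mult_left_mono) auto
      ultimately have "exp (a * Re z - t * Im z) \<le> exp (A - t * (2 * \<epsilon>))" by simp
      moreover have "norm (f z t) = norm (\<phi> t) * exp (a * Re z - t * Im z)"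
        by (simp add: f_def norm_mult norm_exp_eq_Re)
      ultimately have "norm (f z t) \<le> (C * exp (\<epsilon> * t)) * exp (A - t * (2 * \<epsilon>))"
        using C[OF t] C0 by (auto intro!: mult_mono)
      also have "\<dots> = C * exp A * exp (- \<epsilon> * t)"
        by (simp add: mult.assoc exp_add[symmetric])
      finally show ?thesis .
    qed
    moreover have "C * exp A \<ge> 0" using C0 by simp
    ultimately show ?thesis using \<epsilon> by blast
  qed
  have piece: "norm (integral {real n..r} (f z)) \<le> C * exp (- \<epsilon> * real n)"
    if "C \<ge> 0" "\<epsilon> > 0" "\<And>t. t \<ge> 0 \<Longrightarrow> norm (f z t) \<le> C * exp (- \<epsilon> * t)" "real n \<le> r" "r \<le> real n + 1"
    for C \<epsilon> z n r
  proof -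
    have "norm (integral {real n..r} (f z)) \<le> C * exp (- \<epsilon> * real n) * (r - real n)"
    proof (rule integral_bound)
      fix t assume t: "t \<in> {real n..r}"
      have "norm (f z t) \<le> C * exp (- \<epsilon> * t)" using t by (intro that(3)) auto
      also have "\<dots> \<le> C * exp (- \<epsilon> * real n)" using t that(1,2) by (intro mult_left_mono) auto
      finally show "norm (f z t) \<le> C * exp (- \<epsilon> * real n)" .
    qed (use that cont_f in auto)
    also have "\<dots> \<le> C * exp (- \<epsilon> * real n) * 1" using that by (intro mult_left_mono) auto
    finally show ?thesis by simp
  qed
  have sum_eq: "(\<Sum>n<N. integral {real n..real n + 1} (f z)) = integral {0..real N} (f z)" for N z
  proof (induction N)
    case (Suc N)
    have "integral {0..real N} (f z) + integral {real N..real N + 1} (f z) = integral {0..real N + 1} (f z)"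
      by (intro Henstock_Kurzweil_Integration.integral_combine integrable_continuous_interval cont_f) auto
    then show ?case using Suc by (simp add: add.commute)
  qed simp
  define J where "J = (\<lambda>z. \<Sum>n. integral {real n..real n + 1} (f z))"
  have geo: "summable (\<lambda>n. C * exp (- \<epsilon> * real n))" if "\<epsilon> > 0" for C \<epsilon> :: real
  proof -
    have "summable (\<lambda>n. exp (- \<epsilon>) ^ n)" using that by (intro summable_geometric) auto
    moreover have "exp (- \<epsilon>) ^ n = exp (- \<epsilon> * real n)" for n
      by (simp add: exp_of_nat_mult[symmetric] mult.commute)
    ultimately show ?thesis by (intro summable_mult) simp
  qed
  have unif: "uniform_limit (cball z0 (Im z0 / 2)) (\<lambda>N z. \<Sum>n<N. integral {real n..real n + 1} (f z)) J sequentially"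
    if z0: "Im z0 > 0" for z0
  proof -
    obtain C \<epsilon> where C: "C \<ge> 0" "\<epsilon> > 0"
      "\<And>z t. z \<in> cball z0 (Im z0 / 2) \<Longrightarrow> t \<ge> 0 \<Longrightarrow> norm (f z t) \<le> C * exp (- \<epsilon> * t)"
      using bound[OF z0] by blast
    show ?thesis unfolding J_def
      by (intro Weierstrass_m_test[OF _ geo[OF C(2), of C]] piece C) auto
  qed
  have hol_piece: "(\<lambda>z. integral {real n..real n + 1} (f z)) holomorphic_on UNIV" for n
  proof (rule holomorphic_on_integral_param)
    have "continuous_on (UNIV \<times> {real n..real n + 1}) (\<lambda>p. \<phi> (snd p))"
      by (rule continuous_on_compose2[OF cont]) (auto intro!: continuous_intros)
    then show "continuous_on (UNIV \<times> {real n..real n + 1}) (\<lambda>(z, t). f z t)"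
      unfolding f_def split_beta Complex_eq by (intro continuous_intros)
    show "(\<lambda>z. f z t) holomorphic_on UNIV" for t unfolding f_def by (intro holomorphic_intros)
  qed auto
  have "J holomorphic_on {z. Im z > 0}"
  proof (rule holomorphic_uniform_sequence)
    show "(\<lambda>z. \<Sum>n<N. integral {real n..real n + 1} (f z)) holomorphic_on {z. Im z > 0}" for N
      using hol_piece by (intro holomorphic_intros) (auto intro: holomorphic_on_subset)
    fix z0 assume "z0 \<in> {z. Im z > 0}"
    then have z0: "Im z0 > 0" by simp
    have "cball z0 (Im z0 / 2) \<subseteq> {z. Im z > 0}"
    proof
      fix z assume "z \<in> cball z0 (Im z0 / 2)"
      then have "\<bar>Im z0 - Im z\<bar> \<le> Im z0 / 2"
        using abs_Im_le_cmod[of "z0 - z"] by (auto simp: dist_norm)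
      then show "z \<in> {z. Im z > 0}" using z0 unfolding mem_Collect_eq by linarith
    qed
    then show "\<exists>d>0. cball z0 d \<subseteq> {z. Im z > 0} \<and> uniform_limit (cball z0 d)
        (\<lambda>N z. \<Sum>n<N. integral {real n..real n + 1} (f z)) J sequentially"
      using unif[OF z0] z0 by (intro exI[of _ "Im z0 / 2"]) auto
  qed (rule open_halfspace_Im_gt)
  moreover have "((\<lambda>R. integral {0..R} (f z)) \<longlongrightarrow> J z) at_top" if z: "Im z > 0" for z
  proof -
    obtain C \<epsilon> where C: "C \<ge> 0" "\<epsilon> > 0"
      "\<And>w t. w \<in> cball z (Im z / 2) \<Longrightarrow> t \<ge> 0 \<Longrightarrow> norm (f w t) \<le> C * exp (- \<epsilon> * t)"
      using bound[OF z] by blast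
    have C': "norm (f z t) \<le> C * exp (- \<epsilon> * t)" if "t \<ge> 0" for t using C(3)[of z t] z that by auto
    have "(\<lambda>N. integral {0..real N} (f z)) \<longlonglongrightarrow> J z"
      using tendsto_uniform_limitI[OF unif[OF z], of z] z by (simp add: sum_eq)
    moreover have fl: "filterlim (\<lambda>R::real. nat \<lfloor>R\<rfloor>) sequentially at_top"
      by (intro filterlim_compose[OF filterlim_nat_sequentially filterlim_floor_sequentially])
    ultimately have 1: "((\<lambda>R::real. integral {0..real (nat \<lfloor>R\<rfloor>)} (f z)) \<longlongrightarrow> J z) at_top"
      by (rule filterlim_compose)
    \<comment> \<open>The part beyond the last integer lies in one unit interval, so the bound for
      the pieces also takes the limit from integers to real R.\<close>
    have 2: "((\<lambda>R. integral {real (nat \<lfloor>R\<rfloor>)..R} (f z)) \<longlongrightarrow> 0) at_top"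
    proof (rule Lim_null_comparison)
      show "\<forall>\<^sub>F R in at_top. norm (integral {real (nat \<lfloor>R\<rfloor>)..R} (f z)) \<le> C * exp (- \<epsilon> * real (nat \<lfloor>R\<rfloor>))"
        using eventually_ge_at_top[of "0::real"]
      proof eventually_elim
        case (elim R)
        then have "real (nat \<lfloor>R\<rfloor>) = of_int \<lfloor>R\<rfloor>" by simp
        then have "real (nat \<lfloor>R\<rfloor>) \<le> R" "R \<le> real (nat \<lfloor>R\<rfloor>) + 1" by linarith+
        then show ?case by (intro piece C(1,2) C')
      qed
      show "((\<lambda>R::real. C * exp (- \<epsilon> * real (nat \<lfloor>R\<rfloor>))) \<longlongrightarrow> 0) at_top"
        by (rule filterlim_compose[OF summable_LIMSEQ_zero[OF geo[OF C(2)]] fl])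
    qed
    have "\<forall>\<^sub>F R in at_top. integral {0..real (nat \<lfloor>R\<rfloor>)} (f z) + integral {real (nat \<lfloor>R\<rfloor>)..R} (f z)
        = integral {0..R} (f z)"
      using eventually_ge_at_top[of "0::real"]
    proof eventually_elim
      case (elim R)
      then show ?case
        by (intro Henstock_Kurzweil_Integration.integral_combine integrable_continuous_interval cont_f) auto
    qed
    from Lim_transform_eventually[OF tendsto_add[OF 1 2] this] show ?thesis by simp
  qed
  ultimately show ?thesis using that unfolding f_def by blast
qed

lemma holomorphic_on_segment_integral:
  assumes "continuous_on (closed_segment p q) \<phi>"
  shows "(\<lambda>z. contour_integral (linepath p q) (\<lambda>s. \<phi> s * exp (s * z))) holomorphic_on UNIV"
proof -
  have "(\<lambda>z. integral {0..1} (\<lambda>t. \<phi> (linepath p q t) * exp (linepath p q t * z) * (q - p))) holomorphic_on UNIV"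
  proof (rule holomorphic_on_integral_param)
    have "continuous_on (UNIV \<times> {0..1}) (\<lambda>x. \<phi> (linepath p q (snd x)))"
      by (rule continuous_on_compose2[OF assms])
         (auto simp: linepath_in_path intro!: continuous_intros continuous_on_compose2[OF continuous_on_linepath])
    moreover have "continuous_on (UNIV \<times> {0..1}) (\<lambda>x. linepath p q (snd x))"
      unfolding linepath_def by (intro continuous_intros)
    ultimately show "continuous_on (UNIV \<times> {0..1})
        (\<lambda>(z, t). \<phi> (linepath p q t) * exp (linepath p q t * z) * (q - p))"
      unfolding split_beta by (intro continuous_intros)
    show "(\<lambda>z. \<phi> (linepath p q t) * exp (linepath p q t * z) * (q - p)) holomorphic_on UNIV" for t
      by (intro holomorphic_intros)
  qed auto
  then show ?thesis by (simp add: contour_integral_integral vector_derivative_linepath_at)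
qed

section \<open>The series over the points log n\<close>

context zero_free_contour
begin

lemma summable_g: "summable (\<lambda>n. norm (g_coeff F (Suc n)) * real (Suc n) powr - b)"
proof -
  have "(\<lambda>n. norm (g_coeff F n * of_nat n powr (- of_real b))) summable_on {1..}"
    using g_coeff_dirichlet(1)[OF F, of "of_real b"] b by simp
  moreover have "bij_betw Suc UNIV {1..}" by (rule bij_betw_Suc_UNIV)
  ultimately have "(\<lambda>n. norm (g_coeff F (Suc n) * of_nat (Suc n) powr (- of_real b))) summable_on UNIV"
    by (subst summable_on_reindex_bij_betw[of Suc UNIV "{1..}"])
  moreover have "norm (g_coeff F (Suc n) * of_nat (Suc n) powr (- of_real b)) =
      norm (g_coeff F (Suc n)) * real (Suc n) powr - b" for n
    by (subst norm_mult, subst norm_powr_real_powr) (auto simp del: of_nat_Suc)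
  ultimately show ?thesis by (simp add: summable_on_UNIV_nonneg_real_iff)
qed

lemma norm_log_term:
  "norm (log_term F b z (Suc n)) =
    norm (g_coeff F (Suc n)) * real (Suc n) powr - b / norm (z - of_real (ln (real (Suc n))))"
  by (simp add: log_term_def norm_divide norm_mult powr_minus divide_inverse norm_inverse del: of_nat_Suc)

lemma log_term_tail:
  obtains N where "\<And>n (z :: complex). norm z \<le> R \<Longrightarrow> n \<ge> N \<Longrightarrow> norm (z - of_real (ln (real (Suc n)))) \<ge> 1"
    "\<And>n z. norm z \<le> R \<Longrightarrow> n \<ge> N \<Longrightarrow>
      norm (log_term F b z (Suc n)) \<le> norm (g_coeff F (Suc n)) * real (Suc n) powr - b"
proof -
  \<comment> \<open>From exp (R + 1) on, log n exceeds every |z| \<le> R by at least 1.\<close>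
  obtain N :: nat where N: "real N \<ge> exp (R + 1)" using real_arch_simple by blast
  have 1: "norm (z - of_real (ln (real (Suc n)))) \<ge> 1" if "norm z \<le> R" "n \<ge> N" for n and z :: complex
  proof -
    have "exp (R + 1) \<le> real (Suc n)" using N that by linarith
    then have "R + 1 \<le> ln (real (Suc n))" by (simp add: ln_ge_iff del: of_nat_Suc)
    moreover have "norm (complex_of_real (ln (real (Suc n)))) - norm z \<le> norm (z - of_real (ln (real (Suc n))))"
      by (subst norm_minus_commute) (rule norm_triangle_ineq2)
    moreover have "ln (real (Suc n)) \<le> norm (complex_of_real (ln (real (Suc n))))"
      by (simp only: norm_of_real abs_ge_self)
    ultimately show ?thesis using that by linarith
  qed
  have "norm (log_term F b z (Suc n)) \<le> norm (g_coeff F (Suc n)) * real (Suc n) powr - b"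
    if "norm z \<le> R" "n \<ge> N" for n z
  proof -
    have "norm (g_coeff F (Suc n)) * real (Suc n) powr - b / norm (z - of_real (ln (real (Suc n))))
        \<le> norm (g_coeff F (Suc n)) * real (Suc n) powr - b / 1"
      using 1[OF that] by (intro divide_left_mono) auto
    then show ?thesis by (simp only: norm_log_term div_by_1)
  qed
  with 1 show ?thesis using that by blast
qed

text \<open>Only the tail matters, so z = log n is no exception; the singular term is 0 there by
  \<open>x / 0 = 0\<close>.\<close>

lemma summable_log_term: "summable (\<lambda>n. log_term F b z (Suc n))"
proof -
  obtain N where "\<And>n. n \<ge> N \<Longrightarrow>
      norm (log_term F b z (Suc n)) \<le> norm (g_coeff F (Suc n)) * real (Suc n) powr - b"
    using log_term_tail[of "norm z"] by (metis order_refl)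
  then show ?thesis by (rule summable_comparison_test'[OF summable_g])
qed

text \<open>One Laurent form from which analyticity, meromorphy and the list of poles all follow.
  The coefficient \<open>c\<close> collects the indices with log n = z0, at most one as ln is
  injective; if its g (n) is 0, then log n is no pole.\<close>

lemma log_series_local:
  obtains U r c where "open U" "z0 \<in> U" "r holomorphic_on U"
    "\<And>z. z \<in> U \<Longrightarrow> log_series F b z = exp (of_real b * z) * (c / (z - z0) + r z)"
    "c \<noteq> 0 \<longleftrightarrow> (\<exists>n\<ge>1. z0 = of_real (ln (real n)) \<and> g_coeff F n \<noteq> 0)"
proof -
  define R where "R = norm z0 + 1"
  obtain N where N: "\<And>n (z :: complex). norm z \<le> R \<Longrightarrow> n \<ge> N \<Longrightarrow> norm (z - of_real (ln (real (Suc n)))) \<ge> 1"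
    "\<And>n z. norm z \<le> R \<Longrightarrow> n \<ge> N \<Longrightarrow>
      norm (log_term F b z (Suc n)) \<le> norm (g_coeff F (Suc n)) * real (Suc n) powr - b"
    using log_term_tail[of R] by metis
  define A where "A = {n. n < N \<and> complex_of_real (ln (real (Suc n))) = z0}"
  define B where "B = {..<N} - A"
  define U where "U = ball z0 1 - (\<lambda>n. complex_of_real (ln (real (Suc n)))) ` B"
  define tail where "tail = (\<lambda>z. \<Sum>n. log_term F b z (Suc (n + N)))"
  define r where "r = (\<lambda>z. (\<Sum>n\<in>B. log_term F b z (Suc n)) + tail z)"
  define c where "c = (\<Sum>n\<in>A. g_coeff F (Suc n) / of_real (real (Suc n) powr b))"
  have fin: "finite A" "finite B" by (auto simp: A_def B_def)
  have U1: "open U" unfolding U_def using fin by (intro open_Diff finite_imp_closed) auto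
  have U2: "z0 \<in> U" by (auto simp: U_def A_def B_def)
  have UR: "norm z < R" if "z \<in> ball z0 1" for z
    using that norm_triangle_ineq2[of z z0] by (auto simp: R_def dist_norm norm_minus_commute)
  have "tail holomorphic_on ball z0 1"
  proof (rule holomorphic_uniform_sequence)
    show "(\<lambda>z. \<Sum>n<M. log_term F b z (Suc (n + N))) holomorphic_on ball z0 1" for M
    proof (intro holomorphic_on_sum)
      fix n
      have "z - of_real (ln (real (Suc (n + N)))) \<noteq> 0" if "z \<in> ball z0 1" for z
        using N(1)[of z "n + N"] UR[OF that] by fastforce
      then show "(\<lambda>z. log_term F b z (Suc (n + N))) holomorphic_on ball z0 1"
        unfolding log_term_def by (intro holomorphic_intros) (simp_all del: of_nat_Suc)
    qed
    fix z assume "z \<in> ball z0 1"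
    then obtain d where d: "d > 0" "cball z d \<subseteq> ball z0 1"
      using open_contains_cball by (metis open_ball)
    have "uniform_limit (cball z d) (\<lambda>M z. \<Sum>n<M. log_term F b z (Suc (n + N))) tail sequentially"
      unfolding tail_def
    proof (rule Weierstrass_m_test)
      show "summable (\<lambda>n. norm (g_coeff F (Suc (n + N))) * real (Suc (n + N)) powr - b)"
        using summable_g by (subst summable_iff_shift)
      show "norm (log_term F b w (Suc (n + N))) \<le> norm (g_coeff F (Suc (n + N))) * real (Suc (n + N)) powr - b"
        if "w \<in> cball z d" for n w
        using UR[of w] that d by (intro N(2)) auto
    qed
    then show "\<exists>d>0. cball z d \<subseteq> ball z0 1 \<and> uniform_limit (cball z d)
        (\<lambda>M z. \<Sum>n<M. log_term F b z (Suc (n + N))) tail sequentially" using d by blast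
  qed auto
  then have "tail holomorphic_on U" by (rule holomorphic_on_subset) (auto simp: U_def)
  moreover have "(\<lambda>z. \<Sum>n\<in>B. log_term F b z (Suc n)) holomorphic_on U"
    unfolding log_term_def by (intro holomorphic_intros) (auto simp: U_def simp del: of_nat_Suc)
  ultimately have U3: "r holomorphic_on U" unfolding r_def by (intro holomorphic_on_add)
  \<comment> \<open>This includes z = z0: there c / (z - z0) and the terms with index in A are all 0
    by \<open>x / 0 = 0\<close>.\<close>
  have U4: "log_series F b z = exp (of_real b * z) * (c / (z - z0) + r z)" for z
  proof -
    have "(\<Sum>n. log_term F b z (Suc n)) = tail z + (\<Sum>n<N. log_term F b z (Suc n))"
      unfolding tail_def using suminf_split_initial_segment[OF summable_log_term, of z N] by simp
    also have "(\<Sum>n<N. log_term F b z (Suc n)) = (\<Sum>n\<in>B. log_term F b z (Suc n)) + (\<Sum>n\<in>A. log_term F b z (Suc n))"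
      unfolding B_def by (rule sum.subset_diff) (auto simp: A_def)
    also have "(\<Sum>n\<in>A. log_term F b z (Suc n)) = c / (z - z0)"
      unfolding c_def sum_divide_distrib by (intro sum.cong refl) (auto simp: A_def log_term_def)
    finally show ?thesis by (simp add: log_series_def r_def algebra_simps)
  qed
  have U5: "c \<noteq> 0 \<longleftrightarrow> (\<exists>n\<ge>1. z0 = of_real (ln (real n)) \<and> g_coeff F n \<noteq> 0)"
  proof
    assume "c \<noteq> 0"
    then obtain n where "n \<in> A" "g_coeff F (Suc n) / of_real (real (Suc n) powr b) \<noteq> 0"
      unfolding c_def by (rule sum.not_neutral_contains_not_neutral)
    then show "\<exists>n\<ge>1. z0 = of_real (ln (real n)) \<and> g_coeff F n \<noteq> 0"
      by (intro exI[of _ "Suc n"]) (auto simp: A_def)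
  next
    assume "\<exists>n\<ge>1. z0 = of_real (ln (real n)) \<and> g_coeff F n \<noteq> 0"
    then obtain n where n: "n \<ge> 1" "z0 = of_real (ln (real n))" "g_coeff F n \<noteq> 0" by blast
    then obtain m where m: "n = Suc m" by (cases n) auto
    have "m < N"
    proof (rule ccontr)
      assume "\<not> m < N"
      then have "norm (z0 - of_real (ln (real (Suc m)))) \<ge> 1" by (intro N(1)) (auto simp: R_def)
      then show False using n m by simp
    qed
    have "A = {m}"
    proof (intro equalityI subsetI)
      fix k assume "k \<in> A"
      then have "ln (real (Suc k)) = ln (real (Suc m))" using n m by (simp add: A_def del: of_nat_Suc)
      then show "k \<in> {m}" by (subst (asm) ln_inj_iff) auto
    qed (use n m \<open>m < N\<close> in \<open>auto simp: A_def\<close>)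
    then show "c \<noteq> 0" using n m by (simp add: c_def del: of_nat_Suc)
  qed
  show ?thesis by (rule that[OF U1 U2 U3 U4 U5])
qed

lemma log_series_analytic:
  "log_series F b analytic_on - {of_real (ln (real n)) | n. n \<ge> 1}"
  unfolding analytic_on_analytic_at[of _ "- _"]
proof
  fix z0 assume z0: "z0 \<in> - {complex_of_real (ln (real n)) | n. n \<ge> 1}"
  obtain U r c where U: "open U" "z0 \<in> U" "r holomorphic_on U"
    "\<And>z. z \<in> U \<Longrightarrow> log_series F b z = exp (of_real b * z) * (c / (z - z0) + r z)"
    "c \<noteq> 0 \<longleftrightarrow> (\<exists>n\<ge>1. z0 = of_real (ln (real n)) \<and> g_coeff F n \<noteq> 0)"
    using log_series_local[of z0] by metis
  have "c = 0" using U(5) z0 by blast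
  have "(\<lambda>z. exp (of_real b * z) * r z) holomorphic_on U" by (intro holomorphic_intros U(3))
  then have "log_series F b holomorphic_on U"
    by (rule holomorphic_transform) (simp add: U(4) \<open>c = 0\<close>)
  then show "log_series F b analytic_on {z0}" using U(1,2) analytic_at by blast
qed

lemma log_series_meromorphic: "log_series F b meromorphic_on UNIV"
  unfolding meromorphic_on_meromorphic_at[of _ UNIV]
proof
  fix z0
  obtain U r c where U: "open U" "z0 \<in> U" "r holomorphic_on U"
    "\<And>z. z \<in> U \<Longrightarrow> log_series F b z = exp (of_real b * z) * (c / (z - z0) + r z)"
    using log_series_local[of z0] by metis
  have "r analytic_on {z0}" using U(1-3) analytic_at by blast
  then have "(\<lambda>z. exp (of_real b * z) * (c / (z - z0) + r z)) meromorphic_on {z0}"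
    by (intro meromorphic_intros analytic_on_imp_meromorphic_on analytic_intros)
  moreover have "\<forall>\<^sub>F z in at z0. log_series F b z = exp (of_real b * z) * (c / (z - z0) + r z)"
    unfolding eventually_at_topological using U by (intro exI[of _ U]) auto
  then have "log_series F b meromorphic_on {z0} \<longleftrightarrow>
      (\<lambda>z. exp (of_real b * z) * (c / (z - z0) + r z)) meromorphic_on {z0}"
    by (intro meromorphic_on_cong) auto
  ultimately show "log_series F b meromorphic_on {z0}" by blast
qed

lemma is_pole_log_series:
  "is_pole (log_series F b) z0 \<longleftrightarrow> (\<exists>n\<ge>1. z0 = of_real (ln (real n)) \<and> g_coeff F n \<noteq> 0)"
proof -
  obtain U r c where U: "open U" "z0 \<in> U" "r holomorphic_on U"
    "\<And>z. z \<in> U \<Longrightarrow> log_series F b z = exp (of_real b * z) * (c / (z - z0) + r z)"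
    "c \<noteq> 0 \<longleftrightarrow> (\<exists>n\<ge>1. z0 = of_real (ln (real n)) \<and> g_coeff F n \<noteq> 0)"
    using log_series_local[of z0] by metis
  have hol: "(\<lambda>z. exp (of_real b * z) * (c + r z * (z - z0))) holomorphic_on U"
    by (intro holomorphic_intros U(3))
  have ev: "\<forall>\<^sub>F z in at z0. log_series F b z = exp (of_real b * z) * (c + r z * (z - z0)) / (z - z0)"
    unfolding eventually_at_topological using U by (intro exI[of _ U]) (auto simp: field_simps)
  show ?thesis
  proof (cases "c = 0")
    case True
    have "(\<lambda>z. exp (of_real b * z) * r z) holomorphic_on U" by (intro holomorphic_intros U(3))
    then have "log_series F b holomorphic_on U"
      by (rule holomorphic_transform) (simp add: U(4) True)
    then have "\<not> is_pole (log_series F b) z0"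
      using U(1,2) not_is_pole_holomorphic by blast
    then show ?thesis using U(5) True by simp
  next
    case False
    have "is_pole (\<lambda>z. exp (of_real b * z) * (c + r z * (z - z0)) / (z - z0)) z0"
      using is_pole_basic[OF hol U(1,2), of 1] False by simp
    then have "is_pole (log_series F b) z0"
      using is_pole_cong[OF ev refl] by simp
    then show ?thesis using U(5) False by simp
  qed
qed

end

subsection \<open>Limits of the sides of the contour\<close>

text \<open>The exponential series at \<epsilon> (1 + t) dominates its k-th term.\<close>

lemma power_le_exp:
  assumes "\<epsilon> > 0"
  shows "\<exists>C\<ge>0. \<forall>t\<ge>0. (1 + t) ^ k \<le> C * exp (\<epsilon> * t :: real)"
proof -
  have pow: "x ^ k \<le> fact k * exp x" if "x \<ge> 0" for x :: real
  proof -
    have "(\<Sum>n\<in>{k}. x ^ n /\<^sub>R fact n) \<le> (\<Sum>n. x ^ n /\<^sub>R fact n)"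
      using that by (intro sum_le_suminf summable_exp_generic) auto
    then show ?thesis by (simp add: exp_def field_simps)
  qed
  have "(1 + t) ^ k \<le> (fact k * exp \<epsilon> / \<epsilon> ^ k) * exp (\<epsilon> * t)" if "t \<ge> 0" for t
  proof -
    have "(\<epsilon> * (1 + t)) ^ k \<le> fact k * exp (\<epsilon> * (1 + t))"
      using assms that by (intro pow) auto
    also have "exp (\<epsilon> * (1 + t)) = exp \<epsilon> * exp (\<epsilon> * t)"
      by (simp add: exp_add[symmetric] distrib_left)
    finally have "\<epsilon> ^ k * (1 + t) ^ k \<le> fact k * (exp \<epsilon> * exp (\<epsilon> * t))"
      by (simp only: power_mult_distrib)
    then show ?thesis using assms by (simp add: field_simps)
  qed
  moreover have "fact k * exp \<epsilon> / \<epsilon> ^ k \<ge> 0" using assms by simp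
  ultimately show ?thesis by blast
qed

lemma admissible_heightsD:
  assumes "admissible_heights F T"
  obtains C K where "\<forall>\<^sub>F n in sequentially. T n \<in> {real n..real n + 1} \<and>
    (\<forall>\<sigma>\<ge>-2. F (Complex \<sigma> (T n)) \<noteq> 0 \<and>
       inverse (norm (F (Complex \<sigma> (T n)))) \<le> K * exp (C * (ln (real n + 1/2))\<^sup>2))"
proof -
  obtain D C K X0 where D: "D > 0" and T: "\<And>X n. X \<ge> X0 \<Longrightarrow>
     {real n..real n + 1} \<subseteq> {X - D * ln (ln X)..X + D * ln (ln X)} \<Longrightarrow>
       T n \<in> {real n..real n + 1} \<and>
       (\<forall>\<sigma>\<ge>-2. F (Complex \<sigma> (T n)) \<noteq> 0 \<and>
          inverse (norm (F (Complex \<sigma> (T n)))) \<le> K * exp (C * (ln X)\<^sup>2))"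
    using assms unfolding admissible_heights_def by blast
  \<comment> \<open>With X = n + 1/2 the interval [n, n + 1] is centred at X, so it fits into the
    window as soon as D ln (ln X) \<ge> 1/2.\<close>
  have "filterlim (\<lambda>n. D * ln (ln (real n + 1/2))) at_top sequentially"
    using D by real_asymp
  then have "\<forall>\<^sub>F n in sequentially. D * ln (ln (real n + 1/2)) \<ge> 1/2"
    unfolding filterlim_at_top by blast
  moreover have "\<forall>\<^sub>F n in sequentially. real n \<ge> X0"
    using filterlim_real_sequentially unfolding filterlim_at_top by blast
  ultimately have "\<forall>\<^sub>F n in sequentially. T n \<in> {real n..real n + 1} \<and>
    (\<forall>\<sigma>\<ge>-2. F (Complex \<sigma> (T n)) \<noteq> 0 \<and>
       inverse (norm (F (Complex \<sigma> (T n)))) \<le> K * exp (C * (ln (real n + 1/2))\<^sup>2))"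
    by eventually_elim (rule T, auto)
  then show ?thesis by (rule that)
qed

context zero_free_contour
begin

lemma left_line_continuous: "continuous_on {0..} (\<lambda>t. zeta (Complex a t - 1) / F (Complex a t))"
proof -
  have "continuous_on {s. Re s = a} (\<lambda>s. zeta (s - 1) / F s)"
    using a by (intro holomorphic_on_imp_continuous_on kernel_holomorphic_strip) auto
  then show ?thesis
    by (rule continuous_on_compose2) (auto simp: Complex_eq intro!: continuous_intros)
qed

text \<open>Compactness below \<open>t1\<close>, polynomial bounds above it. The maximum in
  \<open>t1\<close> is there because \<open>zeta_growth\<close> asks for height at least 1.\<close>

lemma left_line_growth:
  assumes "\<epsilon> > 0"
  shows "\<exists>C. \<forall>t\<ge>0. norm (zeta (Complex a t - 1) / F (Complex a t)) \<le> C * exp (\<epsilon> * t)"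
proof -
  obtain C1 k1 where C1: "C1 \<ge> 0"
    "\<And>s. Re s \<ge> a - 1 \<Longrightarrow> \<bar>Im s\<bar> \<ge> 1 \<Longrightarrow> norm (zeta s) \<le> C1 * (1 + norm s) ^ k1"
    using zeta_growth[of "a - 1"] by blast
  obtain C2 k2 t0 where C2: "C2 \<ge> 0" "t0 > 0"
    "\<And>t. t \<ge> t0 \<Longrightarrow> norm (1 / F (Complex a t)) \<le> C2 * (1 + t) ^ k2"
    using selberg_inverse_growth[OF F a(2)] by blast
  obtain C3 where C3: "C3 \<ge> 0" "\<And>t. t \<ge> 0 \<Longrightarrow> (1 + t) ^ (k1 + k2) \<le> C3 * exp (\<epsilon> * t)"
    using power_le_exp[OF assms] by blast
  define A where "A = 1 + \<bar>a - 1\<bar>"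
  define t1 where "t1 = max 1 t0"
  have "compact ((\<lambda>t. zeta (Complex a t - 1) / F (Complex a t)) ` {0..t1})"
    by (intro compact_continuous_image continuous_on_subset[OF left_line_continuous]) auto
  then obtain M where M: "M > 0" "\<And>t. t \<in> {0..t1} \<Longrightarrow> norm (zeta (Complex a t - 1) / F (Complex a t)) \<le> M"
    using compact_imp_bounded bounded_pos by (metis (no_types, lifting) image_eqI)
  define C where "C = C1 * A ^ k1 * C2 * C3"
  have C: "C \<ge> 0" using C1 C2 C3 by (simp add: C_def A_def)
  have "norm (zeta (Complex a t - 1) / F (Complex a t)) \<le> (C + M) * exp (\<epsilon> * t)" if t: "t \<ge> 0" for t
  proof (cases "t \<le> t1")
    case True
    have "norm (zeta (Complex a t - 1) / F (Complex a t)) \<le> M" using M(2) t True by auto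
    also have "\<dots> \<le> M * exp (\<epsilon> * t)" using M(1) assms t by simp
    also have "\<dots> \<le> (C + M) * exp (\<epsilon> * t)" using C by (intro mult_right_mono) auto
    finally show ?thesis .
  next
    case False
    then have t1: "t \<ge> 1" "t \<ge> t0" by (auto simp: t1_def)
    have "1 + norm (Complex a t - 1) \<le> 1 + (\<bar>a - 1\<bar> + t)"
      using cmod_le[of "Complex a t - 1"] t by simp
    also have "\<dots> \<le> A * (1 + t)" using t by (simp add: A_def algebra_simps)
    finally have nrm: "1 + norm (Complex a t - 1) \<le> A * (1 + t)" .
    have "norm (zeta (Complex a t - 1)) \<le> C1 * (1 + norm (Complex a t - 1)) ^ k1"
      using t1 by (intro C1) auto
    also have "\<dots> \<le> C1 * (A * (1 + t)) ^ k1"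
      using nrm C1(1) by (intro mult_left_mono power_mono) auto
    finally have "norm (zeta (Complex a t - 1)) * norm (1 / F (Complex a t)) \<le>
        (C1 * (A * (1 + t)) ^ k1) * (C2 * (1 + t) ^ k2)"
      using C2(3)[OF t1(2)] C1(1) t by (intro mult_mono) (auto simp: A_def)
    also have "\<dots> = C1 * A ^ k1 * C2 * (1 + t) ^ (k1 + k2)"
      by (simp add: power_mult_distrib power_add mult_ac)
    also have "\<dots> \<le> C1 * A ^ k1 * C2 * (C3 * exp (\<epsilon> * t))"
      using C1(1) C2(1) by (intro mult_left_mono C3(2) t) (auto simp: A_def)
    also have "\<dots> \<le> (C + M) * exp (\<epsilon> * t)" using M(1) by (simp add: C_def algebra_simps)
    finally show ?thesis by (simp add: norm_divide)
  qed
  then show ?thesis by blast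
qed

lemma left_line_integral:
  assumes "R > 0"
  shows "zeta_kernel F z contour_integrable_on linepath (Complex a R) (of_real a)"
    and "contour_integral (linepath (Complex a R) (of_real a)) (zeta_kernel F z) =
      - \<i> * integral {0..R} (\<lambda>t. zeta (Complex a t - 1) / F (Complex a t) * exp (Complex a t * z))"
proof -
  have cont: "continuous_on (closed_segment (Complex a R) (of_real a)) (zeta_kernel F z)"
    using a by (intro kernel_continuous) (auto simp: closed_segment_same_Re)
  then show "zeta_kernel F z contour_integrable_on linepath (Complex a R) (of_real a)"
    by (rule contour_integrable_continuous_linepath)
  have "contour_integral (linepath (of_real a) (Complex a R)) (zeta_kernel F z) =
      \<i> * integral {0..R} (\<lambda>t. zeta_kernel F z (Complex a t))"
    using assms by (intro contour_integral_linepath_same_Re) auto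
  then show "contour_integral (linepath (Complex a R) (of_real a)) (zeta_kernel F z) =
      - \<i> * integral {0..R} (\<lambda>t. zeta (Complex a t - 1) / F (Complex a t) * exp (Complex a t * z))"
    using contour_integral_reverse_linepath[OF cont] by (simp add: zeta_kernel_def)
qed

lemma f1_analytic: "f1 F a analytic_on {z. Im z > 0}"
  and f1_tendsto: "Im z > 0 \<Longrightarrow>
    ((\<lambda>R. contour_integral (linepath (Complex a R) (of_real a)) (zeta_kernel F z)) \<longlongrightarrow> f1 F a z) at_top"
proof -
  obtain J where J: "J holomorphic_on {z. Im z > 0}"
    "\<And>z. Im z > 0 \<Longrightarrow> ((\<lambda>R. integral {0..R}
       (\<lambda>t. zeta (Complex a t - 1) / F (Complex a t) * exp (Complex a t * z))) \<longlongrightarrow> J z) at_top"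
    using vertical_integral_limit[OF left_line_continuous left_line_growth] by blast
  have lim: "((\<lambda>R. contour_integral (linepath (Complex a R) (of_real a)) (zeta_kernel F z))
      \<longlongrightarrow> - \<i> * J z) at_top" if "Im z > 0" for z
  proof (rule Lim_transform_eventually)
    show "((\<lambda>R. - \<i> * integral {0..R}
       (\<lambda>t. zeta (Complex a t - 1) / F (Complex a t) * exp (Complex a t * z))) \<longlongrightarrow> - \<i> * J z) at_top"
      by (intro tendsto_mult_left J that)
    show "\<forall>\<^sub>F R in at_top. - \<i> * integral {0..R}
       (\<lambda>t. zeta (Complex a t - 1) / F (Complex a t) * exp (Complex a t * z)) =
       contour_integral (linepath (Complex a R) (of_real a)) (zeta_kernel F z)"
      using eventually_gt_at_top[of 0] by eventually_elim (simp only: left_line_integral(2))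
  qed
  have f1: "f1 F a z = - \<i> * J z" if "Im z > 0" for z
    unfolding f1_def using lim[OF that] by (intro tendsto_Lim) auto
  show "((\<lambda>R. contour_integral (linepath (Complex a R) (of_real a)) (zeta_kernel F z))
      \<longlongrightarrow> f1 F a z) at_top" if "Im z > 0"
    using lim[OF that] f1[OF that] by simp
  have "(\<lambda>z. - \<i> * J z) holomorphic_on {z. Im z > 0}" by (intro holomorphic_intros J)
  then have "f1 F a holomorphic_on {z. Im z > 0}"
    by (rule holomorphic_transform) (simp add: f1)
  then show "f1 F a analytic_on {z. Im z > 0}"
    by (simp add: analytic_on_open open_halfspace_Im_gt)
qed

lemma f2_analytic: "f2 F a b \<alpha> analytic_on UNIV"
proof -
  let ?c = "Complex ((a + b) / 2) \<alpha>"
  have "continuous_on (closed_segment (of_real a) ?c) (\<lambda>s. zeta (s - 1) / F s)"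
    "continuous_on (closed_segment ?c (of_real b)) (\<lambda>s. zeta (s - 1) / F s)"
    using path_L_segments by (auto intro!: holomorphic_on_imp_continuous_on kernel_holomorphic_strip(2))
  then have "(\<lambda>z. contour_integral (linepath (of_real a) ?c) (\<lambda>s. zeta (s - 1) / F s * exp (s * z)) +
      contour_integral (linepath ?c (of_real b)) (\<lambda>s. zeta (s - 1) / F s * exp (s * z))) holomorphic_on UNIV"
    by (intro holomorphic_on_add holomorphic_on_segment_integral)
  then have "f2 F a b \<alpha> holomorphic_on UNIV"
    by (rule holomorphic_transform) (simp add: f2_eq(2) zeta_kernel_def[abs_def])
  then show ?thesis by (simp add: analytic_on_open)
qed

text \<open>The n-th term of the integrand is g (n) exp (s w) with w = z - log n, and exp (s w) / w
  is a primitive of exp (s w). The lower end b yields the terms of \<open>log_series\<close>, the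
  upper end a remainder of order exp (- R Im z). As Im w = Im z for every n, the denominators stay
  uniformly away from 0.\<close>

lemma right_line_tendsto:
  assumes z: "Im z > 0"
  shows "((\<lambda>R. contour_integral (linepath (of_real b) (Complex b R)) (zeta_kernel F z))
    \<longlongrightarrow> - log_series F b z) at_top"
proof -
  define w where "w = (\<lambda>n. z - of_real (ln (real (Suc n))))"
  define G where "G = (\<lambda>n. norm (g_coeff F (Suc n)) * real (Suc n) powr - b)"
  define h where "h = (\<lambda>n s. g_coeff F (Suc n) * exp (s * w n))"
  have Im_w: "Im (w n) = Im z" for n by (simp add: w_def)
  have w: "w n \<noteq> 0" "norm (w n) \<ge> Im z" for n
    using Im_w[of n] z abs_Im_le_cmod[of "w n"] by auto
  have powr: "of_nat (Suc n) powr s = exp (s * of_real (ln (real (Suc n))))" for n and s :: complex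
    by (simp add: powr_def Ln_of_nat del: of_nat_Suc)
  have h_eq: "h n s = g_coeff F (Suc n) * of_nat (Suc n) powr (- s) * exp (s * z)" for n s
    by (simp add: h_def w_def powr exp_add[symmetric] algebra_simps del: of_nat_Suc)
  have norm_h: "norm (h n s) = G n * exp (b * Re z - Im s * Im z)" if "Re s = b" for n s
  proof -
    have "norm (of_nat (Suc n) powr (- s) :: complex) = real (Suc n) powr - b"
      using that by (subst norm_powr_real_powr) (auto simp del: of_nat_Suc)
    then show ?thesis using that by (simp add: h_eq G_def norm_mult norm_exp_eq_Re)
  qed
  have h_sums: "(\<lambda>n. h n s) sums zeta_kernel F z s" if "Re s = b" for s
  proof -
    have "((\<lambda>n. g_coeff F n * of_nat n powr (- s)) has_sum (zeta (s - 1) / F s)) {1..}"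
      using that b by (intro g_coeff_dirichlet F) auto
    moreover have "bij_betw Suc UNIV {1..}" by (rule bij_betw_Suc_UNIV)
    ultimately have "((\<lambda>n. g_coeff F (Suc n) * of_nat (Suc n) powr (- s)) has_sum (zeta (s - 1) / F s)) UNIV"
      by (subst has_sum_reindex_bij_betw[of Suc UNIV "{1..}"])
    from sums_mult2[OF has_sum_imp_sums[OF this], of "exp (s * z)"]
    show ?thesis by (simp add: h_eq zeta_kernel_def)
  qed
  define V where "V = (\<lambda>R. contour_integral (linepath (of_real b) (Complex b R)) (zeta_kernel F z))"
  have G: "summable G" unfolding G_def by (rule summable_g)
  have bound: "norm (V R + log_series F b z) \<le> exp (b * Re z - R * Im z) * ((\<Sum>n. G n) / Im z)"
    if R: "R > 0" for R
  proof -
    \<comment> \<open>The contribution of the upper end b + iR to the n-th term.\<close>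
    define e where "e = (\<lambda>n. g_coeff F (Suc n) * exp (Complex b R * w n) / w n)"
    have seg: "Re s = b" "0 \<le> Im s" if "s \<in> closed_segment (of_real b) (Complex b R)" for s
      using that R by (auto simp: closed_segment_same_Re closed_segment_eq_real_ivl)
    have term_int: "(h n has_contour_integral e n - exp (of_real b * z) * log_term F b z (Suc n))
        (linepath (of_real b) (Complex b R))" for n
    proof -
      have "((\<lambda>s. g_coeff F (Suc n) * exp (s * w n) / w n) has_field_derivative h n s) (at s)" for s
        using w(1)[of n] by (auto intro!: derivative_eq_intros simp: h_def)
      then have "(h n has_contour_integral e n - g_coeff F (Suc n) * exp (of_real b * w n) / w n)
          (linepath (of_real b) (Complex b R))"
        using contour_integral_primitive[of UNIV "\<lambda>s. g_coeff F (Suc n) * exp (s * w n) / w n" "h n"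
          "linepath (of_real b) (Complex b R)"] by (simp add: e_def)
      moreover have "exp (of_real b * w n) = exp (of_real b * z) / of_real (real (Suc n) powr b)"
        by (simp add: w_def right_diff_distrib exp_diff powr_def exp_of_real[symmetric] del: of_nat_Suc)
      ultimately show ?thesis by (simp add: log_term_def w_def mult_ac del: of_nat_Suc)
    qed
    have unif: "uniform_limit (path_image (linepath (of_real b) (Complex b R)))
        (\<lambda>N s. \<Sum>n<N. h n s) (\<lambda>s. \<Sum>n. h n s) sequentially"
    proof (rule Weierstrass_m_test)
      show "summable (\<lambda>n. G n * exp (b * Re z))" by (intro summable_mult2 G)
      fix n s assume "s \<in> path_image (linepath (of_real b) (Complex b R))"
      then have s: "Re s = b" "0 \<le> Im s" using seg by auto
      then have "exp (b * Re z - Im s * Im z) \<le> exp (b * Re z)" using z by simp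
      then show "norm (h n s) \<le> G n * exp (b * Re z)"
        unfolding norm_h[OF s(1)] by (intro mult_left_mono) (auto simp: G_def)
    qed
    have sum_int: "((\<lambda>s. \<Sum>n<N. h n s) has_contour_integral
        (\<Sum>n<N. e n - exp (of_real b * z) * log_term F b z (Suc n))) (linepath (of_real b) (Complex b R))" for N
      by (intro has_contour_integral_sum term_int) auto
    have "(\<lambda>N. contour_integral (linepath (of_real b) (Complex b R)) (\<lambda>s. \<Sum>n<N. h n s)) \<longlonglongrightarrow>
        contour_integral (linepath (of_real b) (Complex b R)) (\<lambda>s. \<Sum>n. h n s)"
      using unif has_contour_integral_integrable[OF sum_int]
      by (intro contour_integral_uniform_limit(2)[where B = "norm (Complex b R - of_real b)"])
         (auto simp: vector_derivative_linepath_at)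
    moreover have "contour_integral (linepath (of_real b) (Complex b R)) (\<lambda>s. \<Sum>n. h n s) = V R"
      unfolding V_def using h_sums seg by (intro contour_integral_cong) (auto simp: sums_iff)
    moreover have "contour_integral (linepath (of_real b) (Complex b R)) (\<lambda>s. \<Sum>n<N. h n s) =
        (\<Sum>n<N. e n - exp (of_real b * z) * log_term F b z (Suc n))" for N
      by (rule contour_integral_unique[OF sum_int])
    ultimately have "(\<lambda>n. e n - exp (of_real b * z) * log_term F b z (Suc n)) sums V R"
      by (simp add: sums_def)
    moreover have "(\<lambda>n. exp (of_real b * z) * log_term F b z (Suc n)) sums log_series F b z"
      unfolding log_series_def by (intro sums_mult summable_sums summable_log_term)
    ultimately have "e sums (V R + log_series F b z)"
      using sums_add by fastforce
    moreover have norm_e: "norm (e n) \<le> G n * (exp (b * Re z - R * Im z) / Im z)" for n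
    proof -
      have "norm (e n) = norm (h n (Complex b R)) / norm (w n)"
        by (simp add: e_def h_def norm_divide)
      also have "\<dots> = G n * exp (b * Re z - R * Im z) / norm (w n)"
        by (subst norm_h) auto
      also have "\<dots> \<le> G n * exp (b * Re z - R * Im z) / Im z"
        using w[of n] z by (intro divide_left_mono) (auto simp: G_def)
      finally show ?thesis by simp
    qed
    ultimately have "norm (V R + log_series F b z) \<le> (\<Sum>n. G n * (exp (b * Re z - R * Im z) / Im z))"
      using norm_suminf_le[of e, OF norm_e summable_mult2[OF G]] by (simp add: sums_iff)
    also have "\<dots> = exp (b * Re z - R * Im z) * ((\<Sum>n. G n) / Im z)"
      using suminf_mult2[OF G, of "exp (b * Re z - R * Im z) / Im z"] by (simp add: mult.commute)
    finally show ?thesis .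
  qed
  have "((\<lambda>R. V R + log_series F b z) \<longlongrightarrow> 0) at_top"
  proof (rule Lim_null_comparison)
    show "\<forall>\<^sub>F R in at_top. norm (V R + log_series F b z) \<le> exp (b * Re z - R * Im z) * ((\<Sum>n. G n) / Im z)"
      using eventually_gt_at_top[of 0] by eventually_elim (rule bound)
    have "((\<lambda>R. exp (b * Re z - R * Im z)) \<longlongrightarrow> 0) at_top" using z by real_asymp
    then show "((\<lambda>R. exp (b * Re z - R * Im z) * ((\<Sum>n. G n) / Im z)) \<longlongrightarrow> 0) at_top"
      by (rule tendsto_mult_left_zero)
  qed
  from tendsto_diff[OF this tendsto_const, of "log_series F b z"]
  show ?thesis by (simp add: V_def)
qed

text \<open>The exponential decays like exp (- 2 y n) with y = Im z / 2. One half absorbs the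
  polynomial bound on zeta, the other outweighs exp (C (ln (n + 1/2))^2) from the choice of heights.
  That choice covers all \<sigma> \<ge> -2, hence the whole side, as a > -3/2.\<close>

lemma horizontal_tendsto:
  assumes T: "admissible_heights F T" and z: "Im z > 0"
  shows "(\<lambda>n. contour_integral (linepath (Complex b (T n)) (Complex a (T n))) (zeta_kernel F z)) \<longlonglongrightarrow> 0"
proof -
  obtain C K where CK: "\<forall>\<^sub>F n in sequentially. T n \<in> {real n..real n + 1} \<and>
    (\<forall>\<sigma>\<ge>-2. F (Complex \<sigma> (T n)) \<noteq> 0 \<and>
       inverse (norm (F (Complex \<sigma> (T n)))) \<le> K * exp (C * (ln (real n + 1/2))\<^sup>2))"
    using admissible_heightsD[OF T] by blast
  obtain C1 k where C1: "C1 \<ge> 0"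
    "\<And>s. Re s \<ge> a - 1 \<Longrightarrow> \<bar>Im s\<bar> \<ge> 1 \<Longrightarrow> norm (zeta s) \<le> C1 * (1 + norm s) ^ k"
    using zeta_growth[of "a - 1"] by blast
  define y where "y = Im z / 2"
  have y: "y > 0" using z by (simp add: y_def)
  obtain C3 where C3: "C3 \<ge> 0" "\<And>t. t \<ge> 0 \<Longrightarrow> (1 + t) ^ k \<le> C3 * exp (y * t)"
    using power_le_exp[OF y] by blast
  \<comment> \<open>From 1 + |Re s - 1| + t \<le> 3 + |a| + |b| + n, which uses t \<le> n +
    1.\<close>
  define A where "A = 3 + \<bar>a\<bar> + \<bar>b\<bar>"
  define B where "B = (\<bar>a\<bar> + \<bar>b\<bar>) * norm z"
  define M where "M = C1 * A ^ k * C3 * K * exp B * (b - a)"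
  have "\<forall>\<^sub>F n in sequentially. norm (contour_integral (linepath (Complex b (T n)) (Complex a (T n))) (zeta_kernel F z))
      \<le> M * exp (C * (ln (real n + 1/2))\<^sup>2 - y * real n)"
    using CK eventually_ge_at_top[of 1]
  proof eventually_elim
    case (elim n)
    define t where "t = T n"
    have t: "real n \<le> t" "t \<le> real n + 1" "t \<ge> 1" and
      F: "\<And>\<sigma>. \<sigma> \<ge> - 2 \<Longrightarrow> F (Complex \<sigma> t) \<noteq> 0"
      "\<And>\<sigma>. \<sigma> \<ge> - 2 \<Longrightarrow> inverse (norm (F (Complex \<sigma> t))) \<le> K * exp (C * (ln (real n + 1/2))\<^sup>2)"
      using elim by (auto simp: t_def)
    \<comment> \<open>The sign of K is not prescribed by the definition of the heights; the bound at
      a single point forces it to be positive, as the product estimates require.\<close>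
    have K: "K > 0"
    proof -
      have "0 < inverse (norm (F (Complex 0 t)))" using F(1)[of 0] by simp
      also have "\<dots> \<le> K * exp (C * (ln (real n + 1/2))\<^sup>2)" by (rule F(2)) simp
      finally show ?thesis by (simp add: zero_less_mult_iff)
    qed
    have seg: "s = Complex (Re s) t \<and> a \<le> Re s \<and> Re s \<le> b"
      if "s \<in> closed_segment (Complex b t) (Complex a t)" for s
      using that a b by (auto simp: closed_segment_same_Im closed_segment_eq_real_ivl complex_eq_iff)
    have "norm (contour_integral (linepath (Complex b t) (Complex a t)) (zeta_kernel F z))
        \<le> (C1 * A ^ k * C3 * K * exp B * exp (C * (ln (real n + 1/2))\<^sup>2 - y * real n)) *
           norm (Complex a t - Complex b t)"
    proof (rule contour_integral_bound_linepath)
      show "zeta_kernel F z contour_integrable_on linepath (Complex b t) (Complex a t)"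
      proof (intro contour_integrable_continuous_linepath holomorphic_on_imp_continuous_on
          holomorphic_on_zeta_kernel Fc)
        fix s assume "s \<in> closed_segment (Complex b t) (Complex a t)"
        from seg[OF this] show "F s \<noteq> 0" using F(1)[of "Re s"] a(1) by auto
      qed (use seg t in \<open>force simp: complex_eq_iff\<close>)+
      show "0 \<le> C1 * A ^ k * C3 * K * exp B * exp (C * (ln (real n + 1/2))\<^sup>2 - y * real n)"
        using C1(1) C3(1) K by (simp add: A_def)
      fix s assume "s \<in> closed_segment (Complex b t) (Complex a t)"
      then have s: "s = Complex (Re s) t" "a \<le> Re s" "Re s \<le> b" using seg by auto
      then have Im_s: "Im s = t" by (metis complex.sel(2))
      have abs_s: "\<bar>Re s\<bar> \<le> \<bar>a\<bar> + \<bar>b\<bar>" using s by auto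
      have "1 + norm (s - 1) \<le> 1 + (\<bar>Re s - 1\<bar> + t)"
        using cmod_le[of "s - 1"] t Im_s by simp
      also have "\<dots> \<le> A + real n" using abs_s t by (simp add: A_def)
      also have "\<dots> \<le> A * (1 + real n)" by (simp add: A_def algebra_simps)
      finally have nrm: "1 + norm (s - 1) \<le> A * (1 + real n)" .
      have "norm (zeta (s - 1)) \<le> C1 * (1 + norm (s - 1)) ^ k"
        using s Im_s t by (intro C1) auto
      also have "\<dots> \<le> C1 * (A * (1 + real n)) ^ k"
        using nrm C1(1) by (intro mult_left_mono power_mono) auto
      also have "\<dots> = C1 * A ^ k * (1 + real n) ^ k" by (simp add: power_mult_distrib)
      also have "\<dots> \<le> C1 * A ^ k * (C3 * exp (y * real n))"
        using C1(1) by (intro mult_left_mono C3) (auto simp: A_def)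
      finally have 1: "norm (zeta (s - 1)) \<le> C1 * A ^ k * (C3 * exp (y * real n))" .
      have 2: "inverse (norm (F s)) \<le> K * exp (C * (ln (real n + 1/2))\<^sup>2)"
        using F(2)[of "Re s"] s a(1) by auto
      have "Re s * Re z \<le> \<bar>Re s\<bar> * \<bar>Re z\<bar>" by (metis abs_ge_self abs_mult)
      also have "\<dots> \<le> B" unfolding B_def using abs_s abs_Re_le_cmod[of z] by (intro mult_mono) auto
      finally have "Re s * Re z \<le> B" .
      moreover have "real n * (2 * y) \<le> t * Im z" using t y unfolding y_def by (intro mult_mono) auto
      ultimately have 3: "norm (exp (s * z)) \<le> exp (B - real n * (2 * y))"
        by (simp add: norm_exp_eq_Re Im_s)
      have "norm (zeta_kernel F z s) = norm (zeta (s - 1)) * inverse (norm (F s)) * norm (exp (s * z))"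
        by (simp add: zeta_kernel_def norm_mult norm_inverse divide_inverse)
      also have "\<dots> \<le> (C1 * A ^ k * (C3 * exp (y * real n))) * (K * exp (C * (ln (real n + 1/2))\<^sup>2)) *
          exp (B - real n * (2 * y))"
        using 1 2 3 C1(1) C3(1) K by (intro mult_mono) (auto simp: A_def)
      also have "\<dots> = C1 * A ^ k * C3 * K * (exp (y * real n) * exp (C * (ln (real n + 1/2))\<^sup>2) *
          exp (B - real n * (2 * y)))" by (simp add: mult_ac)
      also have "exp (y * real n) * exp (C * (ln (real n + 1/2))\<^sup>2) * exp (B - real n * (2 * y)) =
          exp B * exp (C * (ln (real n + 1/2))\<^sup>2 - y * real n)"
        unfolding exp_add[symmetric] by (simp add: algebra_simps)
      finally show "norm (zeta_kernel F z s) \<le>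
          C1 * A ^ k * C3 * K * exp B * exp (C * (ln (real n + 1/2))\<^sup>2 - y * real n)"
        by (simp add: mult_ac)
    qed
    also have "norm (Complex a t - Complex b t) = b - a"
      using a b by (simp add: complex_diff cmod_def)
    finally show ?case by (simp add: M_def t_def mult_ac)
  qed
  moreover have "(\<lambda>n. M * exp (C * (ln (real n + 1/2))\<^sup>2 - y * real n)) \<longlonglongrightarrow> 0"
  proof -
    have "(\<lambda>n. exp (C * (ln (real n + 1/2))\<^sup>2 - y * real n)) \<longlonglongrightarrow> 0" using y by real_asymp
    then show ?thesis by (rule tendsto_mult_right_zero)
  qed
  ultimately show ?thesis by (rule Lim_null_comparison)
qed

lemma zero_sum_tendsto:
  assumes simple: "\<And>\<rho>. F \<rho> = 0 \<Longrightarrow> Im \<rho> > 0 \<Longrightarrow> zorder F \<rho> = 1"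
    and T: "admissible_heights F T" and z: "Im z > 0"
  shows "(\<lambda>n. zero_sum F (T n) z) \<longlonglongrightarrow> (f1 F a z + f2 F a b \<alpha> z - log_series F b z) / (2 * pi * \<i>)"
proof -
  let ?I = "\<lambda>p q. contour_integral (linepath p q) (zeta_kernel F z)"
  obtain C K where CK: "\<forall>\<^sub>F n in sequentially. T n \<in> {real n..real n + 1} \<and>
    (\<forall>\<sigma>\<ge>-2. F (Complex \<sigma> (T n)) \<noteq> 0 \<and>
       inverse (norm (F (Complex \<sigma> (T n)))) \<le> K * exp (C * (ln (real n + 1/2))\<^sup>2))"
    using admissible_heightsD[OF T] by blast
  have "\<forall>\<^sub>F n in sequentially. real n \<le> T n" using CK by eventually_elim auto
  then have T_lim: "filterlim T at_top sequentially"
    by (rule filterlim_at_top_mono[OF filterlim_real_sequentially])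
  then have "\<forall>\<^sub>F n in sequentially. T n > \<alpha>" by (simp add: filterlim_at_top_dense)
  with CK have ev: "\<forall>\<^sub>F n in sequentially. (?I (Complex a (T n)) (of_real a) + f2 F a b \<alpha> z +
      ?I (of_real b) (Complex b (T n)) + ?I (Complex b (T n)) (Complex a (T n))) / (2 * pi * \<i>) =
      zero_sum F (T n) z"
  proof eventually_elim
    case (elim n)
    have "F (Complex \<sigma> (T n)) \<noteq> 0" if "\<sigma> \<ge> a" for \<sigma> using elim that a(1) by auto
    from contour_identity[OF simple elim(2) this, of z] show ?case
      by (simp add: field_simps)
  qed
  have "(\<lambda>n. (?I (Complex a (T n)) (of_real a) + f2 F a b \<alpha> z +
      ?I (of_real b) (Complex b (T n)) + ?I (Complex b (T n)) (Complex a (T n))) / (2 * pi * \<i>)) \<longlonglongrightarrow>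
      (f1 F a z + f2 F a b \<alpha> z + - log_series F b z + 0) / (2 * pi * \<i>)"
    using z by (intro tendsto_intros filterlim_compose[OF f1_tendsto[OF z] T_lim]
      filterlim_compose[OF right_line_tendsto[OF z] T_lim] horizontal_tendsto[OF T z]) auto
  from Lim_transform_eventually[OF this ev] show ?thesis by simp
qed

end

theorem theorem4p1:
  fixes F :: "complex \<Rightarrow> complex" and T :: "nat \<Rightarrow> real" and a b \<alpha> :: real
  assumes F: "F \<in> selberg_poly"
    and simple: "\<And>\<rho>. F \<rho> = 0 \<Longrightarrow> Im \<rho> > 0 \<Longrightarrow> zorder F \<rho> = 1"
    and T: "admissible_heights F T"
    and b: "b > 5/2"
    and a: "-3/2 < a" "a < 0" "\<And>\<rho>. F \<rho> = 0 \<Longrightarrow> Re \<rho> < 0 \<Longrightarrow> Re \<rho> / 2 < a"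
    \<comment> \<open>\<open>upper_zeros F\<close> is empty only for \<open>F = 1\<close>; then there is no minimum and any positive
       \<open>\<alpha>\<close> is allowed\<close>
    and \<alpha>: "\<alpha> > 0" "upper_zeros F \<noteq> {} \<Longrightarrow> \<alpha> = (LEAST y. y \<in> Im ` upper_zeros F) / 2"
  shows "(\<forall>z. Im z > 0 \<longrightarrow> convergent (\<lambda>n. zero_sum F (T n) z))
    \<and> f_lim F T analytic_on {z. Im z > 0}
    \<and> (\<forall>z. Im z > 0 \<longrightarrow>
         2 * pi * \<i> * f_lim F T z = f1 F a z + f2 F a b \<alpha> z - log_series F b z)
    \<and> (\<forall>z. z \<notin> {of_real (ln (real n)) | n. n \<ge> 1} \<longrightarrow>
         summable (\<lambda>n. log_term F b z (Suc n)))
    \<and> log_series F b meromorphic_on UNIV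
    \<and> log_series F b analytic_on - {of_real (ln (real n)) | n. n \<ge> 1}
    \<and> {z. is_pole (log_series F b) z} = {of_real (ln (real n)) | n. n \<ge> 1 \<and> g_coeff F n \<noteq> 0}
    \<and> (\<forall>z. Im z > 0 \<longrightarrow>
         (\<forall>R>0. zeta_kernel F z contour_integrable_on linepath (Complex a R) (of_real a)) \<and>
         (\<exists>l. ((\<lambda>R. contour_integral (linepath (Complex a R) (of_real a)) (zeta_kernel F z))
                 \<longlongrightarrow> l) at_top))
    \<and> f1 F a analytic_on {z. Im z > 0}
    \<and> (\<forall>z. zeta_kernel F z contour_integrable_on path_L a b \<alpha>)
    \<and> f2 F a b \<alpha> analytic_on UNIV"
proof -
  interpret zero_free_contour F a b \<alpha> by unfold_locales (use F b a \<alpha> in auto)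
  let ?H = "{z. Im z > 0}"
  define S where "S = (\<lambda>z. (f1 F a z + f2 F a b \<alpha> z - log_series F b z) / (2 * pi * \<i>))"
  have lim: "(\<lambda>n. zero_sum F (T n) z) \<longlonglongrightarrow> S z" if "Im z > 0" for z
    unfolding S_def using simple T that by (rule zero_sum_tendsto)
  have f_lim: "f_lim F T z = S z" if "Im z > 0" for z
    unfolding f_lim_def using lim[OF that] by (rule limI)
  \<comment> \<open>The excluded points log n are real.\<close>
  have "log_series F b analytic_on ?H"
    using log_series_analytic by (rule analytic_on_subset) auto
  moreover have "f2 F a b \<alpha> analytic_on ?H"
    using f2_analytic by (rule analytic_on_subset) auto
  ultimately have "S analytic_on ?H"
    unfolding S_def using f1_analytic by (intro analytic_intros) auto
  then have "S holomorphic_on ?H" by (rule analytic_imp_holomorphic)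
  then have "f_lim F T holomorphic_on ?H" by (rule holomorphic_transform) (simp add: f_lim)
  then have "f_lim F T analytic_on ?H" by (simp add: analytic_on_open open_halfspace_Im_gt)
  moreover have "{z. is_pole (log_series F b) z} =
      {of_real (ln (real n)) | n. n \<ge> 1 \<and> g_coeff F n \<noteq> 0}"
    by (auto simp: is_pole_log_series)
  moreover have "2 * pi * \<i> * f_lim F T z = f1 F a z + f2 F a b \<alpha> z - log_series F b z"
    if "Im z > 0" for z
    using f_lim[OF that] by (simp add: S_def)
  moreover have "convergent (\<lambda>n. zero_sum F (T n) z)" if "Im z > 0" for z
    using lim[OF that] by (rule convergentI)
  moreover have "\<exists>l. ((\<lambda>R. contour_integral (linepath (Complex a R) (of_real a)) (zeta_kernel F z))
      \<longlongrightarrow> l) at_top" if "Im z > 0" for z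
    using f1_tendsto[OF that] by blast
  ultimately show ?thesis
    using f1_analytic f2_analytic f2_eq(1) log_series_analytic log_series_meromorphic
      summable_log_term left_line_integral(1)
    by (intro conjI allI impI) simp_all
qed

end
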